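(* Let $d\ge 0$, let $E=\mathbb{C}^d$, and let $A=\mathrm{Sym}(E\otimes\mathbb{C}^\infty)$, regarded as a twisted commutative algebra. Then the spectrum $\mathrm{Spec}(A)$ is canonically homeomorphic to the total Grassmannian $\mathrm{Gr}(E)$.
   Context: A representation of $\mathrm{GL}_\infty=\bigcup_n \mathrm{GL}_n(\mathbb{C})$ is polynomial if it is a subquotient of a direct sum of tensor powers of $\mathbf{V}=\mathbb{C}^\infty=\bigcup_n\mathbb{C}^n$. A twisted commutative algebra (tca) is a commutative associative unital $\mathbb{C}$-algebra with an action of $\mathrm{GL}_\infty$ by algebra automorphisms that is a polynomial representation. An ideal of a tca always means a $\mathrm{GL}_\infty$-stable ideal. The tca $A=\mathrm{Sym}(E\otimes\mathbf{V})$ is the polynomial ring in variables $x_{i,j}$ ($1\le i\le d$, $j\ge 1$) with its natural $\mathrm{GL}_\infty$-action. A (proper) ideal $I\subset A$ is prime if for all $\mathrm{GL}_\infty$-stable ideals $\mathfrak{a},\mathfrak{b}$ of $A$, $\mathfrak{a}\mathfrak{b}\subset I$ implies $\mathfrak{a}\subset I$ or $\mathfrak{b}\subset I$. $\mathrm{Spec}(A)$ is the set of prime ideals with the Zariski topology (closed sets are $V(I)=\{\mathfrak{p}\supseteq I\}$ for ideals $I$). For $0\le r\le d$ let $\mathrm{Gr}_r(E)$ be the scheme parametrizing rank $r$ quotients of $E$. The total Grassmannian $\mathrm{Gr}(E)$ is, as a set, the disjoint union of the underlying topological spaces $|\mathrm{Gr}_r(E)|$ (including non-closed points), $0\le r\le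 d$. A subset $Z\subset \mathrm{Gr}(E)$ is closed if each $Z_r=Z\cap\mathrm{Gr}_r(E)$ is Zariski closed and $Z$ is downwards closed: for all $r\le s$, $Z_s^{(r)}\subset Z_r$, where $Z_s^{(r)}=\pi_r(\pi_s^{-1}(Z_s))$ and $\pi_s,\pi_r$ are the projections from the partial flag variety $\mathrm{Fl}_{r,s}(E)$ (parametrizing $E\to Q_s\to Q_r$ surjections with $Q_s,Q_r$ of ranks $s,r$) to $\mathrm{Gr}_s(E)$, $\mathrm{Gr}_r(E)$. In other words, if a quotient $E\to U$ belongs to $Z$ then so does every quotient of $U$. *)

theory Defs
  imports
    "HOL-Library.Poly_Mapping"
    "HOL-Algebra.Ideal_Product"
    "HOL-Algebra.QuotRing"
    "HOL-Analysis.Abstract_Topology"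
    "Jordan_Normal_Form.Determinant"
begin

section \<open>Polynomial rings over the complex numbers\<close>

type_synonym 'v cpoly = "('v \<Rightarrow>\<^sub>0 nat) \<Rightarrow>\<^sub>0 complex"

definition PVar :: "'v \<Rightarrow> ('v \<Rightarrow>\<^sub>0 nat) \<Rightarrow>\<^sub>0 'a::zero_neq_one" where
  "PVar v = Poly_Mapping.single (Poly_Mapping.single v 1) 1"

definition PConst :: "'a::zero \<Rightarrow> ('v \<Rightarrow>\<^sub>0 nat) \<Rightarrow>\<^sub>0 'a" where
  "PConst c = Poly_Mapping.single 0 c"

definition poly_vars :: "'v cpoly \<Rightarrow> 'v set" where
  "poly_vars f = (\<Union>m\<in>Poly_Mapping.keys f. Poly_Mapping.keys m)"

definition poly_ring :: "'v set \<Rightarrow> 'v cpoly ring" where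
  "poly_ring X = \<lparr>carrier = {f. poly_vars f \<subseteq> X}, monoid.mult = (*), one = 1, zero = 0, add = (+)\<rparr>"

text \<open>The value of \<open>f\<close> when its coefficients are mapped by \<open>\<phi>\<close> and \<open>\<sigma> v\<close> is substituted for \<open>v\<close>.\<close>

definition poly_subst ::
    "(complex \<Rightarrow> 'b) \<Rightarrow> ('v \<Rightarrow> 'b) \<Rightarrow> 'v cpoly \<Rightarrow> 'b::comm_ring_1" where
  "poly_subst \<phi> \<sigma> f = (\<Sum>m\<in>Poly_Mapping.keys f. \<phi> (Poly_Mapping.lookup f m) *
      (\<Prod>v\<in>Poly_Mapping.keys m. \<sigma> v ^ Poly_Mapping.lookup m v))"

text \<open>Gradings in which the variable \<open>v\<close> has degree \<open>w v\<close>.\<close>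

definition mon_deg :: "('v \<Rightarrow> nat) \<Rightarrow> ('v \<Rightarrow>\<^sub>0 nat) \<Rightarrow> nat" where
  "mon_deg w m = (\<Sum>v\<in>Poly_Mapping.keys m. w v * Poly_Mapping.lookup m v)"

definition homogeneous :: "('v \<Rightarrow> nat) \<Rightarrow> 'v cpoly \<Rightarrow> bool" where
  "homogeneous w f \<longleftrightarrow> (\<exists>n. \<forall>m\<in>Poly_Mapping.keys f. mon_deg w m = n)"

definition hom_component :: "('v \<Rightarrow> nat) \<Rightarrow> nat \<Rightarrow> 'v cpoly \<Rightarrow> 'v cpoly" where
  "hom_component w n f = (\<Sum>m\<in>{m\<in>Poly_Mapping.keys f. mon_deg w m = n}.
      Poly_Mapping.single m (Poly_Mapping.lookup f m))"

definition graded_set :: "('v \<Rightarrow> nat) \<Rightarrow> 'v cpoly set \<Rightarrow> bool" where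
  "graded_set w I \<longleftrightarrow> (\<forall>f\<in>I. \<forall>n. hom_component w n f \<in> I)"


section \<open>The twisted commutative algebra and its spectrum\<close>

text \<open>
  The variable \<open>(i, j)\<close> is \<open>x\<^sub>i\<^sub>j = e\<^sub>i \<otimes> v\<^sub>j\<close>. Indices start at 0, for \<open>E\<close> as well as for \<open>V\<close>.
\<close>

definition tca_A :: "nat \<Rightarrow> (nat \<times> nat) cpoly ring" where
  "tca_A d = poly_ring ({..<d} \<times> UNIV)"

text \<open>
  \<open>GL\<^sub>n\<close> sits inside the infinite matrices by extending an invertible matrix by the identity.
\<close>

definition GL_inf :: "(nat \<Rightarrow> nat \<Rightarrow> complex) set" where
  "GL_inf = (\<Union>n. (\<lambda>M k j. if k < n \<and> j < n then M $$ (k, j) else if k = j then 1 else 0) `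
      {M \<in> carrier_mat n n. invertible_mat M})"

text \<open>\<open>g\<close> sends \<open>v\<^sub>j\<close> to the sum of the \<open>g\<^sub>k\<^sub>j v\<^sub>k\<close>, a finite sum since \<open>g\<close> has finite columns.\<close>

definition GL_act :: "(nat \<Rightarrow> nat \<Rightarrow> complex) \<Rightarrow> (nat \<times> nat) cpoly \<Rightarrow> (nat \<times> nat) cpoly" where
  "GL_act g = poly_subst PConst (\<lambda>(i, j). \<Sum>k\<in>{k. g k j \<noteq> 0}. PConst (g k j) * PVar (i, k))"

definition GL_ideal :: "nat \<Rightarrow> (nat \<times> nat) cpoly set \<Rightarrow> bool" where
  "GL_ideal d I \<longleftrightarrow> ideal I (tca_A d) \<and> (\<forall>g\<in>GL_inf. \<forall>f\<in>I. GL_act g f \<in> I)"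

definition GL_prime :: "nat \<Rightarrow> (nat \<times> nat) cpoly set \<Rightarrow> bool" where
  "GL_prime d P \<longleftrightarrow> GL_ideal d P \<and> P \<noteq> carrier (tca_A d) \<and>
     (\<forall>I J. GL_ideal d I \<longrightarrow> GL_ideal d J \<longrightarrow> ideal_prod (tca_A d) I J \<subseteq> P \<longrightarrow> I \<subseteq> P \<or> J \<subseteq> P)"

definition Spec_A :: "nat \<Rightarrow> (nat \<times> nat) cpoly set set" where
  "Spec_A d = {P. GL_prime d P}"

definition Spec_closed :: "nat \<Rightarrow> (nat \<times> nat) cpoly set set \<Rightarrow> bool" where
  "Spec_closed d Z \<longleftrightarrow> (\<exists>I. GL_ideal d I \<and> Z = {P \<in> Spec_A d. I \<subseteq> P})"

definition Spec_topology :: "nat \<Rightarrow> (nat \<times> nat) cpoly set topology" where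
  "Spec_topology d = topology (\<lambda>U. U \<subseteq> Spec_A d \<and> Spec_closed d (Spec_A d - U))"


section \<open>Grassmannians and flag varieties\<close>

text \<open>
  Underlying set of the closed subscheme, defined by the equations \<open>R\<close>, of the multiprojective
  space with homogeneous coordinates \<open>X\<close>. Each factor is given by its grading \<open>w\<close>, in which
  the coordinates of that factor have degree 1 and all the others degree 0. Points are the
  multihomogeneous primes that do not contain the irrelevant ideal of any factor; for a single
  factor this is the underlying set of Proj, non-closed points included.
\<close>

definition multi_Proj :: "('v \<Rightarrow> nat) set \<Rightarrow> 'v set \<Rightarrow> 'v cpoly set \<Rightarrow> 'v cpoly set set" where
  "multi_Proj W X R = {P. primeideal P (poly_ring X) \<and> R \<subseteq> P \<and>
     (\<forall>w\<in>W. graded_set w P \<and> \<not> {PVar v |v. v \<in> X \<and> w v = 1} \<subseteq> P)}"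

text \<open>
  A rank \<open>r\<close> quotient \<open>Q\<close> of \<open>E\<close> with a basis is a full rank \<open>r \<times> d\<close> matrix \<open>M\<close>; its Pluecker
  coordinates are the coordinates of the line quotient \<open>E\<^sup>\<otimes>\<^sup>r \<rightarrow> \<Lambda>\<^sup>r E \<rightarrow> \<Lambda>\<^sup>r Q\<close>. We use all
  \<open>r\<close>-tuples of basis vectors of \<open>E\<close> as indices; that the coordinates are alternating is among
  the relations below, so that the coordinate ring is the usual Pluecker algebra.
  The variable \<open>(k, i)\<close> is the entry of the generic matrix in row \<open>k\<close> and column \<open>i\<close>.
\<close>

definition tuples :: "nat \<Rightarrow> nat \<Rightarrow> nat list set" where
  "tuples d r = {L. length L = r \<and> set L \<subseteq> {..<d}}"

definition minor :: "nat \<Rightarrow> nat list \<Rightarrow> (nat \<times> nat) cpoly" where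
  "minor r L = det (mat r r (\<lambda>(k, l). PVar (k, L ! l)))"

definition pluecker_relations :: "nat \<Rightarrow> nat \<Rightarrow> nat list cpoly set" where
  "pluecker_relations d r = {F \<in> carrier (poly_ring (tuples d r)).
     homogeneous (\<lambda>_. 1) F \<and> poly_subst PConst (minor r) F = 0}"

text \<open>The points of the scheme of rank \<open>r\<close> quotients of \<open>E\<close>, in its Pluecker embedding.\<close>

definition Gr :: "nat \<Rightarrow> nat \<Rightarrow> nat list cpoly set set" where
  "Gr d r = multi_Proj {\<lambda>_. 1} (tuples d r) (pluecker_relations d r)"

definition Gr_closed :: "nat \<Rightarrow> nat \<Rightarrow> nat list cpoly set set \<Rightarrow> bool" where
  "Gr_closed d r Z \<longleftrightarrow> (\<exists>J. ideal J (poly_ring (tuples d r)) \<and> graded_set (\<lambda>_. 1) J \<and>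
     Z = {P \<in> Gr d r. J \<subseteq> P})"

text \<open>
  The partial flag variety of \<open>E \<rightarrow> Q\<^sub>s \<rightarrow> Q\<^sub>r\<close> as a closed subscheme of the product of the two
  Pluecker spaces; \<open>Inl\<close> marks the coordinates of \<open>Q\<^sub>s\<close> and \<open>Inr\<close> those of \<open>Q\<^sub>r\<close>. In a basis of
  \<open>Q\<^sub>s\<close> adapted to \<open>Q\<^sub>r\<close>, the matrix of \<open>E \<rightarrow> Q\<^sub>r\<close> consists of the first \<open>r\<close> rows of that of
  \<open>E \<rightarrow> Q\<^sub>s\<close>. The relations are the bihomogeneous equations between the minors of these matrices.
\<close>

definition Fl_coords :: "nat \<Rightarrow> nat \<Rightarrow> nat \<Rightarrow> (nat list + nat list) set" where
  "Fl_coords d r s = Inl ` tuples d s \<union> Inr ` tuples d r"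

definition deg_s :: "nat list + nat list \<Rightarrow> nat" where
  "deg_s = case_sum (\<lambda>_. 1) (\<lambda>_. 0)"

definition deg_r :: "nat list + nat list \<Rightarrow> nat" where
  "deg_r = case_sum (\<lambda>_. 0) (\<lambda>_. 1)"

definition flag_relations :: "nat \<Rightarrow> nat \<Rightarrow> nat \<Rightarrow> (nat list + nat list) cpoly set" where
  "flag_relations d r s = {F \<in> carrier (poly_ring (Fl_coords d r s)).
     homogeneous deg_s F \<and> homogeneous deg_r F \<and>
     poly_subst PConst (case_sum (minor s) (minor r)) F = 0}"

definition Fl :: "nat \<Rightarrow> nat \<Rightarrow> nat \<Rightarrow> (nat list + nat list) cpoly set set" where
  "Fl d r s = multi_Proj {deg_s, deg_r} (Fl_coords d r s) (flag_relations d r s)"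

text \<open>The projections to the two Grassmannians are given by contraction of primes.\<close>

definition proj_s :: "nat \<Rightarrow> nat \<Rightarrow> (nat list + nat list) cpoly set \<Rightarrow> nat list cpoly set" where
  "proj_s d s P = {F \<in> carrier (poly_ring (tuples d s)). poly_subst PConst (\<lambda>L. PVar (Inl L)) F \<in> P}"

definition proj_r :: "nat \<Rightarrow> nat \<Rightarrow> (nat list + nat list) cpoly set \<Rightarrow> nat list cpoly set" where
  "proj_r d r P = {F \<in> carrier (poly_ring (tuples d r)). poly_subst PConst (\<lambda>L. PVar (Inr L)) F \<in> P}"


section \<open>The total Grassmannian\<close>

definition total_Gr :: "nat \<Rightarrow> (nat \<times> nat list cpoly set) set" where
  "total_Gr d = (SIGMA r:{..d}. Gr d r)"

definition total_Gr_closed :: "nat \<Rightarrow> (nat \<times> nat list cpoly set) set \<Rightarrow> bool" where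
  "total_Gr_closed d Z \<longleftrightarrow> Z \<subseteq> total_Gr d \<and>
     (\<forall>r\<le>d. Gr_closed d r (Z `` {r})) \<and>
     (\<forall>s\<le>d. \<forall>r\<le>s. proj_r d r ` {P \<in> Fl d r s. proj_s d s P \<in> Z `` {s}} \<subseteq> Z `` {r})"

definition total_Gr_topology :: "nat \<Rightarrow> (nat \<times> nat list cpoly set) topology" where
  "total_Gr_topology d =
     topology (\<lambda>U. U \<subseteq> total_Gr d \<and> total_Gr_closed d (total_Gr d - U))"

text \<open>
  The canonical map sends a point \<open>p\<close> of the Grassmannian, with residue field \<open>\<kappa>\<close> and tautological
  quotient \<open>E \<otimes> \<kappa> \<rightarrow> Q\<close>, to the kernel of \<open>A \<rightarrow> Sym(Q \<otimes> V)\<close>. On the chart where the coordinate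
  \<open>p\<^sub>L\<close> is invertible, the images of the \<open>e\<^bsub>L ! k\<^esub>\<close> form a basis of \<open>Q\<close>, and by Cramer's rule the
  coefficient of \<open>e\<^sub>i\<close> at the \<open>k\<close>-th basis vector is \<open>p\<^bsub>L[k := i]\<^esub> / p\<^sub>L\<close>. So with \<open>y\<^sub>k\<^sub>j\<close>
  the corresponding variables of \<open>Sym(Q \<otimes> V)\<close>, the map is
  \<open>x\<^sub>i\<^sub>j \<mapsto> (\<Sum>\<^sub>k p\<^bsub>L[k := i]\<^esub> y\<^sub>k\<^sub>j) / p\<^sub>L\<close>. The substitution below omits the denominator; this
  only multiplies the coefficient of each monomial of degree \<open>n\<close> in the \<open>y\<^sub>k\<^sub>j\<close> by the \<open>n\<close>-th
  power of \<open>p\<^sub>L\<close>, a unit in \<open>\<kappa>\<close>. The coefficients are homogeneous of degree \<open>n\<close> in the Pluecker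
  coordinates, and so vanish in \<open>\<kappa>\<close> if and only if they lie in \<open>p\<close>.
\<close>

definition chart_subst ::
    "nat list \<Rightarrow> (nat \<times> nat) cpoly \<Rightarrow> ((nat \<times> nat) \<Rightarrow>\<^sub>0 nat) \<Rightarrow>\<^sub>0 nat list cpoly" where
  "chart_subst L = poly_subst (\<lambda>c. PConst (PConst c))
     (\<lambda>(i, j). \<Sum>k<length L. PConst (PVar (L[k := i])) * PVar (k, j))"

definition canonical_map :: "nat \<Rightarrow> nat \<times> nat list cpoly set \<Rightarrow> (nat \<times> nat) cpoly set" where
  "canonical_map d = (\<lambda>(r, p). {f \<in> carrier (tca_A d). \<forall>L\<in>tuples d r. PVar L \<notin> p \<longrightarrow>
     (\<forall>\<beta>. Poly_Mapping.lookup (chart_subst L f) \<beta> \<in> p)})"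


section \<open>The two families of closed sets define topologies\<close>

lemma poly_vars_add: "poly_vars (f + g) \<subseteq> poly_vars f \<union> poly_vars g"
  using Poly_Mapping.keys_add[of f g] by (fastforce simp: poly_vars_def)

lemma poly_vars_mult: "poly_vars (f * g) \<subseteq> poly_vars f \<union> poly_vars g"
proof
  fix v assume "v \<in> poly_vars (f * g)"
  then obtain m where m: "m \<in> Poly_Mapping.keys (f * g)" "v \<in> Poly_Mapping.keys m"
    by (auto simp: poly_vars_def)
  then obtain a b where "m = a + b" "a \<in> Poly_Mapping.keys f" "b \<in> Poly_Mapping.keys g"
    using keys_mult[of f g] by fastforce
  then show "v \<in> poly_vars f \<union> poly_vars g"
    using m(2) Poly_Mapping.keys_add[of a b] by (auto simp: poly_vars_def)
qed

lemma poly_vars_uminus: "poly_vars (- f) = poly_vars f"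
  by (simp add: poly_vars_def)

lemma poly_vars_zero [simp]: "poly_vars 0 = {}"
  by (simp add: poly_vars_def)

lemma poly_vars_one [simp]: "poly_vars 1 = {}"
  by (simp add: poly_vars_def)

lemma poly_vars_PConst [simp]: "poly_vars (PConst c) = {}"
  by (simp add: poly_vars_def PConst_def)

lemma poly_vars_PVar [simp]: "poly_vars (PVar v) = {v}"
  by (simp add: poly_vars_def PVar_def)

lemma poly_vars_power: "poly_vars (f ^ n) \<subseteq> poly_vars f"
proof (induction n)
  case (Suc n)
  then show ?case using poly_vars_mult[of f "f ^ n"] by auto
qed simp

lemma poly_vars_sum: "poly_vars (\<Sum>x\<in>S. f x) \<subseteq> (\<Union>x\<in>S. poly_vars (f x))"
proof (induction S rule: infinite_finite_induct)
  case (insert x S)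
  then show ?case using poly_vars_add[of "f x" "sum f S"] by auto
qed auto

lemma poly_vars_prod: "poly_vars (\<Prod>x\<in>S. f x) \<subseteq> (\<Union>x\<in>S. poly_vars (f x))"
proof (induction S rule: infinite_finite_induct)
  case (insert x S)
  then show ?case using poly_vars_mult[of "f x" "prod f S"] by auto
qed auto

lemma poly_vars_subst:
  "poly_vars (poly_subst PConst \<sigma> f) \<subseteq> (\<Union>v\<in>poly_vars f. poly_vars (\<sigma> v))"
proof
  fix x assume "x \<in> poly_vars (poly_subst PConst \<sigma> f)"
  then obtain m where m: "m \<in> Poly_Mapping.keys f"
    and "x \<in> poly_vars (PConst (Poly_Mapping.lookup f m) *
      (\<Prod>v\<in>Poly_Mapping.keys m. \<sigma> v ^ Poly_Mapping.lookup m v))"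
    using poly_vars_sum unfolding poly_subst_def by fastforce
  then have "x \<in> poly_vars (\<Prod>v\<in>Poly_Mapping.keys m. \<sigma> v ^ Poly_Mapping.lookup m v)"
    using poly_vars_mult by fastforce
  then obtain v where "v \<in> Poly_Mapping.keys m" "x \<in> poly_vars (\<sigma> v)"
    using poly_vars_prod poly_vars_power by fastforce
  then show "x \<in> (\<Union>v\<in>poly_vars f. poly_vars (\<sigma> v))"
    using m by (auto simp: poly_vars_def)
qed

lemma carrier_poly_ring: "f \<in> carrier (poly_ring X) \<longleftrightarrow> poly_vars f \<subseteq> X"
  by (simp add: poly_ring_def)

lemma poly_ring_simps [simp]:
  "f \<otimes>\<^bsub>poly_ring X\<^esub> g = f * g" "f \<oplus>\<^bsub>poly_ring X\<^esub> g = f + g"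
  "\<one>\<^bsub>poly_ring X\<^esub> = 1" "\<zero>\<^bsub>poly_ring X\<^esub> = 0"
  by (simp_all add: poly_ring_def)

lemma poly_ring_closed:
  assumes "f \<in> carrier (poly_ring X)" "g \<in> carrier (poly_ring X)"
  shows "f + g \<in> carrier (poly_ring X)" "f * g \<in> carrier (poly_ring X)"
    "- f \<in> carrier (poly_ring X)"
  using assms poly_vars_add[of f g] poly_vars_mult[of f g]
  by (auto simp: carrier_poly_ring poly_vars_uminus)

lemma cring_poly_ring: "cring (poly_ring X)"
proof (rule cringI)
  show "abelian_group (poly_ring X)"
  proof (rule abelian_groupI)
    fix f assume "f \<in> carrier (poly_ring X)"
    then show "\<exists>y\<in>carrier (poly_ring X). y \<oplus>\<^bsub>poly_ring X\<^esub> f = \<zero>\<^bsub>poly_ring X\<^esub>"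
      by (intro bexI[of _ "- f"]) (simp_all add: poly_ring_closed)
  qed (simp_all add: poly_ring_closed carrier_poly_ring[of 0] ac_simps)
  show "comm_monoid (poly_ring X)"
    by (rule comm_monoidI) (simp_all add: poly_ring_closed carrier_poly_ring[of 1] ac_simps)
qed (simp add: distrib_right)

lemma GL_act_zero: "GL_act g 0 = 0"
  by (simp add: GL_act_def poly_subst_def)

lemma poly_subst_closed:
  assumes "f \<in> carrier (poly_ring X)" "\<And>v. v \<in> X \<Longrightarrow> poly_vars (\<sigma> v) \<subseteq> Y"
  shows "poly_subst PConst \<sigma> f \<in> carrier (poly_ring Y)"
  unfolding carrier_poly_ring
proof (rule order.trans[OF poly_vars_subst], rule UN_least)
  fix v assume "v \<in> poly_vars f"
  then show "poly_vars (\<sigma> v) \<subseteq> Y" using assms by (auto simp: carrier_poly_ring)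
qed

lemma GL_act_closed:
  assumes "f \<in> carrier (tca_A d)" shows "GL_act g f \<in> carrier (tca_A d)"
  unfolding GL_act_def tca_A_def
proof (rule poly_subst_closed)
  show "f \<in> carrier (poly_ring ({..<d} \<times> UNIV))" using assms by (simp add: tca_A_def)
  fix v :: "nat \<times> nat" assume v: "v \<in> {..<d} \<times> UNIV"
  obtain i j where ij: "v = (i, j)" by (cases v)
  have "poly_vars (\<Sum>k\<in>{k. g k j \<noteq> 0}. PConst (g k j) * PVar (i, k)) \<subseteq> {i} \<times> UNIV"
  proof (rule order.trans[OF poly_vars_sum], rule UN_least)
    fix k
    show "poly_vars (PConst (g k j) * PVar (i, k)) \<subseteq> {i} \<times> UNIV"
      using poly_vars_mult[of "PConst (g k j)" "PVar (i, k)"] by auto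
  qed
  also have "\<dots> \<subseteq> {..<d} \<times> UNIV" using v ij by auto
  finally show "poly_vars ((\<lambda>(i, j). \<Sum>k\<in>{k. g k j \<noteq> 0}. PConst (g k j) * PVar (i, k)) v)
      \<subseteq> {..<d} \<times> UNIV"
    by (simp add: ij)
qed

lemma GL_ideal_carrier: "GL_ideal d (carrier (tca_A d))"
  using ring.oneideal[OF cring.axioms(1)[OF cring_poly_ring]] GL_act_closed
  by (auto simp: GL_ideal_def tca_A_def)

lemma GL_ideal_zero: "GL_ideal d {0}"
  using ring.zeroideal[OF cring.axioms(1)[OF cring_poly_ring]]
  by (auto simp: GL_ideal_def tca_A_def GL_act_zero poly_ring_def)

lemma GL_ideal_Inter:
  assumes "S \<noteq> {}" "\<And>I. I \<in> S \<Longrightarrow> GL_ideal d I" shows "GL_ideal d (\<Inter>S)"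
  using assms ring.i_Intersect[OF cring.axioms(1)[OF cring_poly_ring], of S]
  by (auto simp: GL_ideal_def tca_A_def)

lemma GL_ideal_subset: "GL_ideal d I \<Longrightarrow> I \<subseteq> carrier (tca_A d)"
  unfolding GL_ideal_def by (meson ideal.Icarr subsetI)

lemma Spec_closed_Un:
  assumes "Spec_closed d Y" "Spec_closed d Z" shows "Spec_closed d (Y \<union> Z)"
proof -
  obtain I J where I: "GL_ideal d I" "Y = {P \<in> Spec_A d. I \<subseteq> P}"
    and J: "GL_ideal d J" "Z = {P \<in> Spec_A d. J \<subseteq> P}"
    using assms by (auto simp: Spec_closed_def)
  have "GL_ideal d (I \<inter> J)"
    using GL_ideal_Inter[of "{I, J}" d] I(1) J(1) by auto
  moreover have "ideal_prod (tca_A d) I J \<subseteq> I \<inter> J"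
    unfolding tca_A_def
    by (rule ring.ideal_prod_inter[OF cring.axioms(1)[OF cring_poly_ring]])
      (use I(1) J(1) in \<open>simp_all add: GL_ideal_def tca_A_def\<close>)
  then have "I \<subseteq> P \<or> J \<subseteq> P" if "P \<in> Spec_A d" "I \<inter> J \<subseteq> P" for P
    using that I(1) J(1) unfolding Spec_A_def GL_prime_def by blast
  ultimately show ?thesis
    unfolding Spec_closed_def using I(2) J(2) by (intro exI[of _ "I \<inter> J"]) auto
qed

lemma Spec_closed_Inter:
  assumes "\<And>Z. Z \<in> K \<Longrightarrow> Spec_closed d Z" shows "Spec_closed d (Spec_A d \<inter> \<Inter>K)"
proof -
  have "\<exists>I. \<forall>Z\<in>K. GL_ideal d (I Z) \<and> Z = {P \<in> Spec_A d. I Z \<subseteq> P}"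
    using assms by (intro bchoice ballI) (simp add: Spec_closed_def)
  then obtain I where I0: "\<forall>Z\<in>K. GL_ideal d (I Z) \<and> Z = {P \<in> Spec_A d. I Z \<subseteq> P}"
    by (rule exE)
  note I = bspec[OF I0, THEN conjunct1] bspec[OF I0, THEN conjunct2]
  define T where "T = \<Inter>{J. GL_ideal d J \<and> (\<forall>Z\<in>K. I Z \<subseteq> J)}"
  have "GL_ideal d T" unfolding T_def
  proof (rule GL_ideal_Inter)
    show "{J. GL_ideal d J \<and> (\<forall>Z\<in>K. I Z \<subseteq> J)} \<noteq> {}"
      using GL_ideal_carrier I(1) GL_ideal_subset by blast
  qed auto
  moreover have "T \<subseteq> P \<longleftrightarrow> (\<forall>Z\<in>K. I Z \<subseteq> P)" if "P \<in> Spec_A d" for P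
    using that unfolding T_def Spec_A_def GL_prime_def by blast
  moreover have "P \<in> Z \<longleftrightarrow> I Z \<subseteq> P" if "P \<in> Spec_A d" "Z \<in> K" for P Z
    using I(2)[OF that(2)] that(1) by blast
  ultimately have "Spec_A d \<inter> \<Inter>K = {P \<in> Spec_A d. T \<subseteq> P}"
    by auto
  with \<open>GL_ideal d T\<close> show ?thesis unfolding Spec_closed_def by blast
qed

lemma Spec_closed_empty: "Spec_closed d {}"
proof -
  have "{} = {P \<in> Spec_A d. carrier (tca_A d) \<subseteq> P}"
    using GL_ideal_subset unfolding Spec_A_def GL_prime_def by blast
  then show ?thesis using GL_ideal_carrier unfolding Spec_closed_def by blast
qed

lemma istopology_closed_sets:
  assumes "C {}" "\<And>Y Z. C Y \<Longrightarrow> C Z \<Longrightarrow> C (Y \<union> Z)"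
    "\<And>K. (\<And>Z. Z \<in> K \<Longrightarrow> C Z) \<Longrightarrow> C (S \<inter> \<Inter>K)"
  shows "istopology (\<lambda>U. U \<subseteq> S \<and> C (S - U))"
  unfolding istopology_def
proof (intro conjI allI impI)
  fix U V assume "U \<subseteq> S \<and> C (S - U)" "V \<subseteq> S \<and> C (S - V)"
  then show "U \<inter> V \<subseteq> S" "C (S - (U \<inter> V))"
    unfolding Diff_Int by (blast intro: assms(2))+
next
  fix K assume K: "\<forall>U\<in>K. U \<subseteq> S \<and> C (S - U)"
  then show "\<Union>K \<subseteq> S" by auto
  have "S - \<Union>K = S \<inter> \<Inter>((-) S ` K)" by auto
  moreover have "C (S \<inter> \<Inter>((-) S ` K))" by (rule assms(3)) (use K in blast)
  ultimately show "C (S - \<Union>K)" by simp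
qed

lemma istopology_Spec: "istopology (\<lambda>U. U \<subseteq> Spec_A d \<and> Spec_closed d (Spec_A d - U))"
proof (rule istopology_closed_sets[where C = "Spec_closed d"])
  show "Spec_closed d (Y \<union> Z)" if "Spec_closed d Y" "Spec_closed d Z" for Y Z
    using that by (rule Spec_closed_Un)
  show "Spec_closed d (Spec_A d \<inter> \<Inter>K)" if "\<And>Z. Z \<in> K \<Longrightarrow> Spec_closed d Z" for K
    using that by (rule Spec_closed_Inter)
qed (rule Spec_closed_empty)

lemma openin_Spec:
  "openin (Spec_topology d) U \<longleftrightarrow> U \<subseteq> Spec_A d \<and> Spec_closed d (Spec_A d - U)"
  unfolding Spec_topology_def using topology_inverse'[OF istopology_Spec] by simp

lemma topspace_Spec: "topspace (Spec_topology d) = Spec_A d"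
proof
  show "topspace (Spec_topology d) \<subseteq> Spec_A d"
    using openin_topspace[of "Spec_topology d"] openin_Spec by blast
  have "openin (Spec_topology d) (Spec_A d)" by (simp add: openin_Spec Spec_closed_empty)
  then show "Spec_A d \<subseteq> topspace (Spec_topology d)" by (rule openin_subset)
qed

lemma hom_component_closed:
  assumes "f \<in> carrier (poly_ring X)" shows "hom_component w n f \<in> carrier (poly_ring X)"
proof -
  have "poly_vars (hom_component w n f) \<subseteq> poly_vars f"
    unfolding hom_component_def
    by (rule order.trans[OF poly_vars_sum]) (auto simp: poly_vars_def split: if_splits)
  then show ?thesis using assms by (simp add: carrier_poly_ring)
qed

lemma Gr_prime: "P \<in> Gr d r \<Longrightarrow> primeideal P (poly_ring (tuples d r))"
  by (simp add: Gr_def multi_Proj_def)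

lemma Gr_closed_Un:
  assumes "Gr_closed d r Y" "Gr_closed d r Z" shows "Gr_closed d r (Y \<union> Z)"
proof -
  let ?S = "poly_ring (tuples d r)"
  obtain I J where I: "ideal I ?S" "graded_set (\<lambda>_. 1) I" "Y = {P \<in> Gr d r. I \<subseteq> P}"
    and J: "ideal J ?S" "graded_set (\<lambda>_. 1) J" "Z = {P \<in> Gr d r. J \<subseteq> P}"
    using assms by (auto simp: Gr_closed_def)
  have "I \<subseteq> P \<or> J \<subseteq> P" if P: "P \<in> Gr d r" "I \<inter> J \<subseteq> P" for P
  proof (rule ccontr)
    assume "\<not> (I \<subseteq> P \<or> J \<subseteq> P)"
    then obtain a b where ab: "a \<in> I" "a \<notin> P" "b \<in> J" "b \<notin> P" by blast
    then have "a \<in> carrier ?S" "b \<in> carrier ?S" using I(1) J(1) ideal.Icarr by metis+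
    moreover from this have "a \<otimes>\<^bsub>?S\<^esub> b \<in> I \<inter> J"
      using ideal.I_r_closed[OF I(1)] ideal.I_l_closed[OF J(1)] ab by blast
    ultimately show False
      using primeideal.I_prime[OF Gr_prime[OF P(1)]] P(2) ab by blast
  qed
  moreover have "ideal (I \<inter> J) ?S"
    using ring.i_intersect[OF cring.axioms(1)[OF cring_poly_ring]] I(1) J(1) by blast
  moreover have "graded_set (\<lambda>_. 1) (I \<inter> J)"
    using I(2) J(2) by (auto simp: graded_set_def)
  ultimately show ?thesis
    unfolding Gr_closed_def using I(3) J(3) by (intro exI[of _ "I \<inter> J"]) auto
qed

lemma Gr_closed_Inter:
  assumes "\<And>Z. Z \<in> K \<Longrightarrow> Gr_closed d r Z" shows "Gr_closed d r (Gr d r \<inter> \<Inter>K)"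
proof -
  let ?S = "poly_ring (tuples d r)"
  let ?good = "\<lambda>J. ideal J ?S \<and> graded_set (\<lambda>_. 1) J"
  have "\<exists>I. \<forall>Z\<in>K. ?good (I Z) \<and> Z = {P \<in> Gr d r. I Z \<subseteq> P}"
    using assms by (intro bchoice ballI) (simp add: Gr_closed_def)
  then obtain I where I0: "\<forall>Z\<in>K. ?good (I Z) \<and> Z = {P \<in> Gr d r. I Z \<subseteq> P}"
    by (rule exE)
  note I = bspec[OF I0, THEN conjunct1] bspec[OF I0, THEN conjunct2]
  define F where "F = {J. ?good J \<and> (\<forall>Z\<in>K. I Z \<subseteq> J)}"
  have carr: "carrier ?S \<in> F"
    using I(1) ring.oneideal[OF cring.axioms(1)[OF cring_poly_ring]]
    by (auto simp: F_def graded_set_def hom_component_closed dest: ideal.Icarr)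
  then have "ideal (\<Inter>F) ?S"
    using ring.i_Intersect[OF cring.axioms(1)[OF cring_poly_ring], of F]
    by (auto simp: F_def)
  moreover have "graded_set (\<lambda>_. 1) (\<Inter>F)"
    by (auto simp: F_def graded_set_def)
  moreover have "\<Inter>F \<subseteq> P \<longleftrightarrow> (\<forall>Z\<in>K. I Z \<subseteq> P)" if P: "P \<in> Gr d r" for P
  proof
    assume "\<forall>Z\<in>K. I Z \<subseteq> P"
    then have "P \<in> F"
      using P Gr_prime[OF P] by (auto simp: F_def Gr_def multi_Proj_def primeideal_def)
    then show "\<Inter>F \<subseteq> P" by blast
  qed (auto simp: F_def)
  moreover have "P \<in> Z \<longleftrightarrow> I Z \<subseteq> P" if "P \<in> Gr d r" "Z \<in> K" for P Z
    using I(2)[OF that(2)] that(1) by blast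
  ultimately have "ideal (\<Inter>F) ?S" "graded_set (\<lambda>_. 1) (\<Inter>F)"
      "Gr d r \<inter> \<Inter>K = {P \<in> Gr d r. \<Inter>F \<subseteq> P}" by blast+
  then show ?thesis unfolding Gr_closed_def by blast
qed

lemma Gr_closed_empty: "Gr_closed d r {}"
proof -
  let ?S = "poly_ring (tuples d r)"
  have "\<not> carrier ?S \<subseteq> P" if "P \<in> Gr d r" for P
    using primeideal.I_notcarr[OF Gr_prime[OF that]]
      ideal.Icarr[OF primeideal.axioms(1)[OF Gr_prime[OF that]]] by blast
  then have "{} = {P \<in> Gr d r. carrier ?S \<subseteq> P}" by blast
  moreover have "ideal (carrier ?S) ?S \<and> graded_set (\<lambda>_. 1) (carrier ?S)"
    using ring.oneideal[OF cring.axioms(1)[OF cring_poly_ring]]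
    by (auto simp: graded_set_def hom_component_closed)
  ultimately show ?thesis unfolding Gr_closed_def by blast
qed

text \<open>
  The empty intersection is the whole total Grassmannian; it is downwards closed because the
  second projection maps the flag variety to the Grassmannian of rank \<open>r\<close> quotients.
\<close>

definition mon_value :: "('v \<Rightarrow> 'b) \<Rightarrow> ('v \<Rightarrow>\<^sub>0 nat) \<Rightarrow> 'b::comm_ring_1" where
  "mon_value \<sigma> m = (\<Prod>v\<in>Poly_Mapping.keys m. \<sigma> v ^ Poly_Mapping.lookup m v)"

lemma mon_value_superset:
  assumes "finite S" "Poly_Mapping.keys m \<subseteq> S"
  shows "mon_value \<sigma> m = (\<Prod>v\<in>S. \<sigma> v ^ Poly_Mapping.lookup m v)"
  unfolding mon_value_def
  by (rule prod.mono_neutral_left) (use assms in \<open>auto simp: in_keys_iff\<close>)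

lemma mon_value_add: "mon_value \<sigma> (a + b) = mon_value \<sigma> a * mon_value \<sigma> b"
proof -
  let ?S = "Poly_Mapping.keys a \<union> Poly_Mapping.keys b"
  have "mon_value \<sigma> (a + b) = (\<Prod>v\<in>?S. \<sigma> v ^ Poly_Mapping.lookup (a + b) v)"
    by (rule mon_value_superset) (use Poly_Mapping.keys_add[of a b] in auto)
  also have "\<dots> = (\<Prod>v\<in>?S. \<sigma> v ^ Poly_Mapping.lookup a v) *
      (\<Prod>v\<in>?S. \<sigma> v ^ Poly_Mapping.lookup b v)"
    by (simp add: lookup_add power_add prod.distrib)
  also have "\<dots> = mon_value \<sigma> a * mon_value \<sigma> b"
    by (simp add: mon_value_superset[of ?S])
  finally show ?thesis .
qed

lemma PConst_hom [simp]:
  "PConst 0 = 0" "PConst 1 = 1" "PConst (a + b) = PConst a + PConst b"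
  "PConst (a * b) = PConst a * PConst b"
  by (simp_all add: PConst_def single_add mult_single)

lemma poly_subst_superset:
  assumes "finite S" "Poly_Mapping.keys f \<subseteq> S"
  shows "poly_subst PConst \<sigma> f = (\<Sum>m\<in>S. PConst (Poly_Mapping.lookup f m) * mon_value \<sigma> m)"
  unfolding poly_subst_def mon_value_def
  by (rule sum.mono_neutral_left) (use assms in \<open>auto simp: in_keys_iff\<close>)

lemma poly_subst_add: "poly_subst PConst \<sigma> (f + g) = poly_subst PConst \<sigma> f + poly_subst PConst \<sigma> g"
proof -
  let ?S = "Poly_Mapping.keys f \<union> Poly_Mapping.keys g"
  have "poly_subst PConst \<sigma> (f + g) =
      (\<Sum>m\<in>?S. PConst (Poly_Mapping.lookup (f + g) m) * mon_value \<sigma> m)"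
    by (rule poly_subst_superset) (use Poly_Mapping.keys_add[of f g] in auto)
  also have "\<dots> = (\<Sum>m\<in>?S. PConst (Poly_Mapping.lookup f m) * mon_value \<sigma> m) +
      (\<Sum>m\<in>?S. PConst (Poly_Mapping.lookup g m) * mon_value \<sigma> m)"
    by (simp add: lookup_add distrib_right sum.distrib)
  also have "\<dots> = poly_subst PConst \<sigma> f + poly_subst PConst \<sigma> g"
    by (simp add: poly_subst_superset[of ?S])
  finally show ?thesis .
qed

lemma poly_subst_zero [simp]: "poly_subst \<phi> \<sigma> 0 = 0"
  by (simp add: poly_subst_def)

lemma poly_subst_sum: "poly_subst PConst \<sigma> (\<Sum>x\<in>S. f x) = (\<Sum>x\<in>S. poly_subst PConst \<sigma> (f x))"
  by (induction S rule: infinite_finite_induct) (simp_all add: poly_subst_add)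

lemma poly_subst_single: "poly_subst PConst \<sigma> (Poly_Mapping.single m c) = PConst c * mon_value \<sigma> m"
  by (simp add: poly_subst_superset[of "{m}"])

lemma poly_mapping_sum_single:
  "f = (\<Sum>m\<in>Poly_Mapping.keys f. Poly_Mapping.single m (Poly_Mapping.lookup f m))"
proof (rule poly_mapping_eqI)
  fix k
  show "Poly_Mapping.lookup f k = Poly_Mapping.lookup
      (\<Sum>m\<in>Poly_Mapping.keys f. Poly_Mapping.single m (Poly_Mapping.lookup f m)) k"
    by (simp add: lookup_sum lookup_single when_def in_keys_iff)
qed

lemma poly_subst_mult: "poly_subst PConst \<sigma> (f * g) = poly_subst PConst \<sigma> f * poly_subst PConst \<sigma> g"
proof -
  let ?f = "\<lambda>m. Poly_Mapping.single m (Poly_Mapping.lookup f m)"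
  let ?g = "\<lambda>m. Poly_Mapping.single m (Poly_Mapping.lookup g m)"
  have 1: "poly_subst PConst \<sigma> (?f a * ?g b) = poly_subst PConst \<sigma> (?f a) * poly_subst PConst \<sigma> (?g b)"
    for a b
    by (simp add: mult_single poly_subst_single mon_value_add ac_simps)
  have "poly_subst PConst \<sigma> (f * g) = poly_subst PConst \<sigma>
      ((\<Sum>a\<in>Poly_Mapping.keys f. ?f a) * (\<Sum>b\<in>Poly_Mapping.keys g. ?g b))"
    by (simp flip: poly_mapping_sum_single)
  also have "\<dots> = (\<Sum>a\<in>Poly_Mapping.keys f. poly_subst PConst \<sigma> (?f a)) *
      (\<Sum>b\<in>Poly_Mapping.keys g. poly_subst PConst \<sigma> (?g b))"
    unfolding sum_product poly_subst_sum 1 ..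
  also have "\<dots> = poly_subst PConst \<sigma> f * poly_subst PConst \<sigma> g"
    unfolding poly_subst_sum[symmetric] by (simp flip: poly_mapping_sum_single)
  finally show ?thesis .
qed

lemma poly_subst_PConst: "poly_subst PConst \<sigma> (PConst c) = PConst c"
proof -
  have "poly_subst PConst \<sigma> (Poly_Mapping.single 0 c) = PConst c"
    by (simp add: poly_subst_single mon_value_def)
  then show ?thesis unfolding PConst_def .
qed

lemma poly_subst_one: "poly_subst PConst \<sigma> 1 = 1"
  using poly_subst_PConst[of \<sigma> 1] by simp

lemma poly_subst_PVar: "poly_subst PConst \<sigma> (PVar v) = \<sigma> v"
  by (simp add: PVar_def poly_subst_single mon_value_def)

lemma poly_subst_power: "poly_subst PConst \<sigma> (f ^ n) = poly_subst PConst \<sigma> f ^ n"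
  by (induction n) (simp_all add: poly_subst_one poly_subst_mult)

lemma poly_subst_prod: "poly_subst PConst \<sigma> (\<Prod>x\<in>S. f x) = (\<Prod>x\<in>S. poly_subst PConst \<sigma> (f x))"
  by (induction S rule: infinite_finite_induct) (simp_all add: poly_subst_one poly_subst_mult)

lemma poly_subst_subst:
  "poly_subst PConst \<tau> (poly_subst PConst \<sigma> f) = poly_subst PConst (\<lambda>v. poly_subst PConst \<tau> (\<sigma> v)) f"
  unfolding poly_subst_def[of PConst \<sigma> f]
    poly_subst_def[of PConst "\<lambda>v. poly_subst PConst \<tau> (\<sigma> v)" f]
  by (simp add: poly_subst_sum poly_subst_mult poly_subst_PConst poly_subst_prod poly_subst_power)

text \<open>Renaming of variables.\<close>

definition mon_rename :: "('v \<Rightarrow> 'w) \<Rightarrow> ('v \<Rightarrow>\<^sub>0 nat) \<Rightarrow> ('w \<Rightarrow>\<^sub>0 nat)" where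
  "mon_rename e m = (\<Sum>v\<in>Poly_Mapping.keys m. Poly_Mapping.single (e v) (Poly_Mapping.lookup m v))"

abbreviation poly_rename :: "('v \<Rightarrow> 'w) \<Rightarrow> 'v cpoly \<Rightarrow> 'w cpoly" where
  "poly_rename e \<equiv> poly_subst PConst (\<lambda>v. PVar (e v))"

lemma PVar_power: "PVar v ^ n = (Poly_Mapping.single (Poly_Mapping.single v n) 1 :: 'v cpoly)"
  by (induction n) (simp_all add: PVar_def mult_single flip: single_add)

lemma prod_single:
  "(\<Prod>x\<in>S. Poly_Mapping.single (k x) 1 :: 'v cpoly) = Poly_Mapping.single (\<Sum>x\<in>S. k x) 1"
  by (induction S rule: infinite_finite_induct) (simp_all add: mult_single)

lemma poly_rename_single:
  "poly_rename e (Poly_Mapping.single m c) = Poly_Mapping.single (mon_rename e m) c"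
  by (simp add: poly_subst_single mon_value_def PVar_power prod_single mon_rename_def
      PConst_def mult_single)

lemma poly_rename_eq: "poly_rename e f =
    (\<Sum>m\<in>Poly_Mapping.keys f. Poly_Mapping.single (mon_rename e m) (Poly_Mapping.lookup f m))"
  by (subst poly_mapping_sum_single[of f]) (simp add: poly_subst_sum poly_rename_single)

lemma mon_deg_superset:
  assumes "finite S" "Poly_Mapping.keys m \<subseteq> S"
  shows "mon_deg w m = (\<Sum>v\<in>S. w v * Poly_Mapping.lookup m v)"
  unfolding mon_deg_def
  by (rule sum.mono_neutral_left) (use assms in \<open>auto simp: in_keys_iff\<close>)

lemma mon_deg_add: "mon_deg w (a + b) = mon_deg w a + mon_deg w b"
proof -
  let ?S = "Poly_Mapping.keys a \<union> Poly_Mapping.keys b"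
  have "mon_deg w (a + b) = (\<Sum>v\<in>?S. w v * Poly_Mapping.lookup (a + b) v)"
    by (rule mon_deg_superset) (use Poly_Mapping.keys_add[of a b] in auto)
  also have "\<dots> = mon_deg w a + mon_deg w b"
    by (simp add: mon_deg_superset[of ?S] lookup_add distrib_left sum.distrib)
  finally show ?thesis .
qed

lemma mon_deg_sum: "mon_deg w (\<Sum>x\<in>S. k x) = (\<Sum>x\<in>S. mon_deg w (k x))"
  by (induction S rule: infinite_finite_induct) (simp_all add: mon_deg_add, simp_all add: mon_deg_def)

lemma mon_deg_rename: "mon_deg w (mon_rename e m) = mon_deg (\<lambda>v. w (e v)) m"
proof -
  have "mon_deg w (Poly_Mapping.single v n) = w v * n" for v n
    by (simp add: mon_deg_superset[of "{v}"])
  then show ?thesis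
    unfolding mon_rename_def mon_deg_sum by (simp add: mon_deg_def)
qed

lemma lookup_hom_component:
  "Poly_Mapping.lookup (hom_component w n f) k =
     (if mon_deg w k = n then Poly_Mapping.lookup f k else 0)"
  by (simp add: hom_component_def lookup_sum lookup_single when_def in_keys_iff)

lemma hom_component_add:
  "hom_component w n (f + g) = hom_component w n f + hom_component w n g"
  by (rule poly_mapping_eqI) (simp add: lookup_hom_component lookup_add)

lemma hom_component_sum:
  "hom_component w n (\<Sum>x\<in>S. f x) = (\<Sum>x\<in>S. hom_component w n (f x))"
  by (induction S rule: infinite_finite_induct)
    (simp_all add: hom_component_add, simp_all add: hom_component_def)

lemma hom_component_single:
  "hom_component w n (Poly_Mapping.single m c) =
     (if mon_deg w m = n then Poly_Mapping.single m c else 0)"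
  by (rule poly_mapping_eqI) (auto simp: lookup_hom_component lookup_single when_def)

lemma hom_component_rename:
  "hom_component w n (poly_rename e f) = poly_rename e (hom_component (\<lambda>v. w (e v)) n f)"
proof -
  have "hom_component w n (poly_rename e f) = (\<Sum>m\<in>Poly_Mapping.keys f. poly_rename e
      (hom_component (\<lambda>v. w (e v)) n (Poly_Mapping.single m (Poly_Mapping.lookup f m))))"
    unfolding poly_rename_eq[of e f] hom_component_sum
    by (rule sum.cong)
      (simp_all add: hom_component_single mon_deg_rename poly_rename_single)
  also have "\<dots> = poly_rename e (hom_component (\<lambda>v. w (e v)) n f)"
    unfolding poly_subst_sum[symmetric] hom_component_sum[symmetric]
    by (simp flip: poly_mapping_sum_single)
  finally show ?thesis .
qed

lemma homogeneous_rename: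
  assumes "homogeneous (\<lambda>v. w (e v)) f" shows "homogeneous w (poly_rename e f)"
proof -
  have "Poly_Mapping.keys (poly_rename e f) \<subseteq> mon_rename e ` Poly_Mapping.keys f"
    unfolding poly_rename_eq[of e f]
    by (rule order.trans[OF keys_sum]) (auto split: if_splits)
  then show ?thesis
    using assms by (fastforce simp: homogeneous_def mon_deg_rename)
qed

lemma poly_rename_closed:
  assumes "f \<in> carrier (poly_ring X)" "e ` X \<subseteq> Y"
  shows "poly_rename e f \<in> carrier (poly_ring Y)"
  by (rule poly_subst_closed[OF assms(1)]) (use assms(2) in auto)

lemma primeideal_contract:
  assumes "primeideal P (poly_ring Y)" "e ` X \<subseteq> Y"
  shows "primeideal {F \<in> carrier (poly_ring X). poly_rename e F \<in> P} (poly_ring X)"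
proof (rule ring_hom_ring.primeideal_vimage[OF _ cring_poly_ring assms(1)])
  show "ring_hom_ring (poly_ring X) (poly_ring Y) (poly_rename e)"
    by (rule ring_hom_ringI)
      (auto simp: poly_subst_add poly_subst_mult poly_subst_one
        intro: poly_rename_closed[OF _ assms(2)] cring.axioms(1)[OF cring_poly_ring])
qed

lemma deg_simps [simp]: "deg_s (Inl L) = 1" "deg_s (Inr L) = 0" "deg_r (Inl L) = 0" "deg_r (Inr L) = 1"
  by (simp_all add: deg_s_def deg_r_def)

lemma homogeneous_zero: "homogeneous (\<lambda>_. 0) f"
  by (simp add: homogeneous_def mon_deg_def)

lemma proj_r_Gr:
  assumes P: "P \<in> Fl d r s" shows "proj_r d r P \<in> Gr d r"
proof -
  have e: "Inr ` tuples d r \<subseteq> Fl_coords d r s" by (auto simp: Fl_coords_def)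
  have prime: "primeideal (proj_r d r P) (poly_ring (tuples d r))"
    unfolding proj_r_def
    by (rule primeideal_contract[OF _ e]) (use P in \<open>simp add: Fl_def multi_Proj_def\<close>)
  have rel: "pluecker_relations d r \<subseteq> proj_r d r P"
  proof
    fix F assume F: "F \<in> pluecker_relations d r"
    have "poly_rename Inr F \<in> flag_relations d r s"
      using F poly_rename_closed[OF _ e, of F] homogeneous_rename[of deg_s Inr F]
        homogeneous_rename[of deg_r Inr F] homogeneous_zero[of F]
      by (simp add: pluecker_relations_def flag_relations_def poly_subst_subst poly_subst_PVar)
    then show "F \<in> proj_r d r P"
      using P F by (auto simp: proj_r_def Fl_def multi_Proj_def pluecker_relations_def)
  qed
  have graded: "graded_set (\<lambda>_. 1) (proj_r d r P)"
    unfolding graded_set_def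
  proof (intro ballI allI)
    fix F n assume F: "F \<in> proj_r d r P"
    have "hom_component deg_r n (poly_rename Inr F) \<in> P"
      using P F by (simp add: proj_r_def Fl_def multi_Proj_def graded_set_def)
    then show "hom_component (\<lambda>_. 1) n F \<in> proj_r d r P"
      using F by (simp add: proj_r_def hom_component_rename hom_component_closed)
  qed
  have "\<not> {PVar v |v. v \<in> Fl_coords d r s \<and> deg_r v = 1} \<subseteq> P"
    using P by (simp add: Fl_def multi_Proj_def)
  then obtain L where "L \<in> tuples d r" "PVar (Inr L) \<notin> P"
    by (auto simp: Fl_coords_def)
  then have "\<not> {PVar v |v. v \<in> tuples d r} \<subseteq> proj_r d r P"
    by (auto simp: proj_r_def poly_subst_PVar)
  then show ?thesis
    using prime rel graded by (simp add: Gr_def multi_Proj_def)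
qed

lemma Gr_closed_whole: "Gr_closed d r (Gr d r)"
  using Gr_closed_Inter[of "{}"] by simp

lemma total_Gr_closed_empty: "total_Gr_closed d {}"
  by (simp add: total_Gr_closed_def Gr_closed_empty)

lemma total_Gr_closedD:
  assumes "total_Gr_closed d Z"
  shows "Z \<subseteq> total_Gr d" "r \<le> d \<Longrightarrow> Gr_closed d r (Z `` {r})"
    "s \<le> d \<Longrightarrow> r \<le> s \<Longrightarrow> P \<in> Fl d r s \<Longrightarrow> proj_s d s P \<in> Z `` {s} \<Longrightarrow> proj_r d r P \<in> Z `` {r}"
  using assms unfolding total_Gr_closed_def by (simp_all add: image_subset_iff)

lemma total_Gr_closedI:
  assumes "Z \<subseteq> total_Gr d" "\<And>r. r \<le> d \<Longrightarrow> Gr_closed d r (Z `` {r})"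
    "\<And>r s P. s \<le> d \<Longrightarrow> r \<le> s \<Longrightarrow> P \<in> Fl d r s \<Longrightarrow> proj_s d s P \<in> Z `` {s} \<Longrightarrow>
      proj_r d r P \<in> Z `` {r}"
  shows "total_Gr_closed d Z"
  using assms unfolding total_Gr_closed_def by (simp add: image_subset_iff)

lemma total_Gr_closed_Un:
  assumes Y: "total_Gr_closed d Y" and Z: "total_Gr_closed d Z"
  shows "total_Gr_closed d (Y \<union> Z)"
proof (rule total_Gr_closedI)
  show "Y \<union> Z \<subseteq> total_Gr d"
    using total_Gr_closedD(1)[OF Y] total_Gr_closedD(1)[OF Z] by (rule Un_least)
  show "Gr_closed d r ((Y \<union> Z) `` {r})" if "r \<le> d" for r
    unfolding Un_Image
    by (rule Gr_closed_Un[OF total_Gr_closedD(2)[OF Y that] total_Gr_closedD(2)[OF Z that]])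
  show "proj_r d r P \<in> (Y \<union> Z) `` {r}"
    if "s \<le> d" "r \<le> s" "P \<in> Fl d r s" "proj_s d s P \<in> (Y \<union> Z) `` {s}" for r s P
    using that(4) total_Gr_closedD(3)[OF Y that(1-3)] total_Gr_closedD(3)[OF Z that(1-3)]
    unfolding Un_Image by (elim UnE) simp_all
qed

lemma total_Gr_closed_Inter:
  assumes K: "\<And>Z. Z \<in> K \<Longrightarrow> total_Gr_closed d Z"
  shows "total_Gr_closed d (total_Gr d \<inter> \<Inter>K)"
proof (rule total_Gr_closedI)
  let ?T = "total_Gr d \<inter> \<Inter>K"
  have slice: "?T `` {r} = Gr d r \<inter> \<Inter>((\<lambda>Z. Z `` {r}) ` K)" if "r \<le> d" for r
    using that by (auto simp: total_Gr_def)
  show "?T \<subseteq> total_Gr d" by (rule Int_lower1)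
  show "Gr_closed d r (?T `` {r})" if "r \<le> d" for r
    unfolding slice[OF that]
    by (rule Gr_closed_Inter) (use total_Gr_closedD(2)[OF K that] in blast)
  show "proj_r d r P \<in> ?T `` {r}"
    if "s \<le> d" "r \<le> s" "P \<in> Fl d r s" "proj_s d s P \<in> ?T `` {s}" for r s P
  proof -
    have "proj_r d r P \<in> Z `` {r}" if Z: "Z \<in> K" for Z
      by (rule total_Gr_closedD(3)[OF K[OF Z] \<open>s \<le> d\<close> \<open>r \<le> s\<close> \<open>P \<in> Fl d r s\<close>])
        (use \<open>proj_s d s P \<in> ?T `` {s}\<close> Z in blast)
    then show ?thesis
      using proj_r_Gr[OF that(3)] that(1,2) slice[of r] by simp
  qed
qed

lemma istopology_total_Gr:
  "istopology (\<lambda>U. U \<subseteq> total_Gr d \<and> total_Gr_closed d (total_Gr d - U))"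
proof (rule istopology_closed_sets[where C = "total_Gr_closed d"])
  show "total_Gr_closed d (Y \<union> Z)" if "total_Gr_closed d Y" "total_Gr_closed d Z" for Y Z
    using that by (rule total_Gr_closed_Un)
  show "total_Gr_closed d (total_Gr d \<inter> \<Inter>K)"
    if "\<And>Z. Z \<in> K \<Longrightarrow> total_Gr_closed d Z" for K
    using that by (rule total_Gr_closed_Inter)
qed (rule total_Gr_closed_empty)

lemma openin_total_Gr:
  "openin (total_Gr_topology d) U \<longleftrightarrow> U \<subseteq> total_Gr d \<and> total_Gr_closed d (total_Gr d - U)"
  unfolding total_Gr_topology_def using topology_inverse'[OF istopology_total_Gr] by simp

lemma topspace_total_Gr: "topspace (total_Gr_topology d) = total_Gr d"
proof
  show "topspace (total_Gr_topology d) \<subseteq> total_Gr d"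
    using openin_topspace[of "total_Gr_topology d"] openin_total_Gr by blast
  have "openin (total_Gr_topology d) (total_Gr d)"
    by (simp add: openin_total_Gr total_Gr_closed_empty)
  then show "total_Gr d \<subseteq> topspace (total_Gr_topology d)" by (rule openin_subset)
qed

end

theory Submission
  imports Defs "HOL-Library.Product_Lexorder" "Jordan_Normal_Form.Char_Poly"
begin

text \<open>
  Let \<open>r\<close> be the largest size of a minor of the generic matrix \<open>(x\<^sub>i\<^sub>j)\<close> outside a GL-prime \<open>P\<close>, and
  let \<open>\<Delta>\<^sub>L\<close> be the minor with rows \<open>L\<close> in \<open>r\<close> fixed columns. Modulo the \<open>(r + 1)\<close>-minors, Cramer's rule
  reads \<open>\<Delta>\<^sub>L x\<^sub>i\<^sub>j = \<Sum>\<^sub>k \<Delta>\<^bsub>L[k := i]\<^esub> x\<^bsub>L ! k, j\<^esub>\<close>, so \<open>P\<close> is determined by the set \<open>p\<close> of relations among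
  the \<open>\<Delta>\<^sub>L\<close> modulo \<open>P\<close>. Since columns can be moved independently by \<open>GL\<close>, a product of polynomials in
  disjoint columns lies in \<open>P\<close> only if a factor does. Products of the \<open>\<Delta>\<^sub>L\<close> can be spread over disjoint
  columns at the cost of powers of minors, which stay outside \<open>P\<close> by a polarisation argument;
  hence \<open>p\<close> is prime. Conversely, the image of \<open>p\<close> under the canonical map is a GL-prime because a
  polynomial ring over a domain is a domain.

  The canonical map is continuous because the kernel of \<open>A \<rightarrow> Sym(Q \<otimes> V)\<close> grows when \<open>Q\<close> is replaced
  by a quotient of \<open>Q\<close>, which on Pluecker coordinates is an exchange relation. It is closed because
  flag varieties are proper: if no flag over a given point of the smaller Grassmannian has its larger
  quotient in the closed set \<open>Z\<close>, then by Nakayama's lemma some form vanishes on the image of \<open>Z\<close> but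
  not at that point.
\<close>

section \<open>Subrings, ideals and prime ideals as sets\<close>

text \<open>The obstacle is that a GL-prime is not known to be prime as an ordinary ideal until it
  has been identified as the kernel of a map into a polynomial ring over a domain. Before that, only
  two kinds of cancellation are available: between factors in disjoint columns
  (\<open>disjoint_prime\<close>), and of powers of minors, whose non-membership needs an argument
  of its own. All constructions therefore avoid division: Cramer's rule keeps its denominator, and
  points are defined through a saturation of \<open>P\<close>.

  Stability under \<open>GL_inf\<close> only gives invertible scalar substitutions. Since the base
  field is infinite, interpolation extends it to all column operations with coefficients in A
  (\<open>colsub_closed\<close>): repeating a column, scaling columns by a minor, inserting an
  adjugate matrix. That there are infinitely many columns guarantees fresh ones whenever factors
  have to be made disjoint.

  Nakayama's lemma applies to flags because, over the coordinates of the smaller quotient, the forms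
  of degree n in those of the larger one are generated by finitely many monomials.\<close>

definition is_subring :: "'a::comm_ring_1 set \<Rightarrow> bool" where
  "is_subring C \<longleftrightarrow> 0 \<in> C \<and> 1 \<in> C \<and> (\<forall>a\<in>C. - a \<in> C) \<and> (\<forall>a\<in>C. \<forall>b\<in>C. a + b \<in> C \<and> a * b \<in> C)"

definition is_ideal :: "'a::comm_ring_1 set \<Rightarrow> 'a set \<Rightarrow> bool" where
  "is_ideal C I \<longleftrightarrow> is_subring C \<and> I \<subseteq> C \<and> 0 \<in> I \<and> (\<forall>a\<in>I. \<forall>b\<in>I. a + b \<in> I) \<and>
     (\<forall>a\<in>C. \<forall>b\<in>I. a * b \<in> I)"

definition is_prime :: "'a::comm_ring_1 set \<Rightarrow> 'a set \<Rightarrow> bool" where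
  "is_prime C I \<longleftrightarrow> is_ideal C I \<and> 1 \<notin> I \<and> (\<forall>a\<in>C. \<forall>b\<in>C. a * b \<in> I \<longrightarrow> a \<in> I \<or> b \<in> I)"

lemma subring_closed:
  assumes "is_subring C"
  shows "0 \<in> C" "1 \<in> C" "a \<in> C \<Longrightarrow> - a \<in> C" "a \<in> C \<Longrightarrow> b \<in> C \<Longrightarrow> a + b \<in> C"
    "a \<in> C \<Longrightarrow> b \<in> C \<Longrightarrow> a * b \<in> C" "a \<in> C \<Longrightarrow> b \<in> C \<Longrightarrow> a - b \<in> C"
  using assms unfolding is_subring_def by (auto simp: diff_conv_add_uminus simp del: add_uminus_conv_diff)

lemma subring_sum: "is_subring C \<Longrightarrow> (\<And>x. x \<in> S \<Longrightarrow> f x \<in> C) \<Longrightarrow> sum f S \<in> C"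
  by (induction S rule: infinite_finite_induct) (auto intro: subring_closed)

lemma subring_prod: "is_subring C \<Longrightarrow> (\<And>x. x \<in> S \<Longrightarrow> f x \<in> C) \<Longrightarrow> prod f S \<in> C"
  by (induction S rule: infinite_finite_induct) (auto intro: subring_closed)

lemma subring_power: "is_subring C \<Longrightarrow> a \<in> C \<Longrightarrow> a ^ n \<in> C"
  by (induction n) (auto intro: subring_closed)

lemma subring_det:
  assumes C: "is_subring C" and A: "A \<in> carrier_mat n n"
    and c: "\<And>i j. i < n \<Longrightarrow> j < n \<Longrightarrow> A $$ (i, j) \<in> C"
  shows "det A \<in> C"
  unfolding det_def'[OF A]
proof (intro subring_sum[OF C] subring_closed(5)[OF C] subring_prod[OF C])
  fix \<pi> assume p: "\<pi> \<in> {\<pi>. \<pi> permutes {0..<n}}"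
  show "signof \<pi> \<in> C"
    using subring_closed(2,3)[OF C] by (cases rule: sign_cases[of \<pi>]) auto
  show "A $$ (i, \<pi> i) \<in> C" if "i \<in> {0..<n}" for i
    using c[of i "\<pi> i"] that p permutes_in_image[of \<pi> "{0..<n}" i] by auto
qed

lemma idealD:
  assumes "is_ideal C I"
  shows "is_subring C" "a \<in> I \<Longrightarrow> a \<in> C" "0 \<in> I" "a \<in> I \<Longrightarrow> b \<in> I \<Longrightarrow> a + b \<in> I"
    "a \<in> C \<Longrightarrow> b \<in> I \<Longrightarrow> a * b \<in> I" "b \<in> C \<Longrightarrow> a \<in> I \<Longrightarrow> a * b \<in> I" "a \<in> I \<Longrightarrow> - a \<in> I"
    "a \<in> I \<Longrightarrow> b \<in> I \<Longrightarrow> a - b \<in> I"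
proof -
  show C: "is_subring C" and "a \<in> I \<Longrightarrow> a \<in> C" and "0 \<in> I"
    and add: "\<And>a b. a \<in> I \<Longrightarrow> b \<in> I \<Longrightarrow> a + b \<in> I"
    and mult: "\<And>a b. a \<in> C \<Longrightarrow> b \<in> I \<Longrightarrow> a * b \<in> I"
    using assms unfolding is_ideal_def by auto
  show "b \<in> C \<Longrightarrow> a \<in> I \<Longrightarrow> a * b \<in> I" using mult[of b a] by (simp add: mult.commute)
  have neg: "- a \<in> I" if "a \<in> I" for a
    using mult[of "- 1" a] that subring_closed(2,3)[OF C] by simp
  then show "a \<in> I \<Longrightarrow> - a \<in> I" .
  show "a \<in> I \<Longrightarrow> b \<in> I \<Longrightarrow> a - b \<in> I" using add[of a "- b"] neg by simp
qed

lemma ideal_sum: "is_ideal C I \<Longrightarrow> (\<And>x. x \<in> S \<Longrightarrow> f x \<in> I) \<Longrightarrow> sum f S \<in> I"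
  by (induction S rule: infinite_finite_induct) (auto intro: idealD)

lemma ideal_diff_cong: "is_ideal C I \<Longrightarrow> a - b \<in> I \<Longrightarrow> a \<in> I \<longleftrightarrow> b \<in> I"
  using idealD(4)[of C I "a - b" b] idealD(8)[of C I a "a - b"] by auto

lemma ideal_cong_mult:
  assumes I: "is_ideal C I" and "a - a' \<in> I" "b - b' \<in> I" "a' \<in> C" "b \<in> C"
  shows "a * b - a' * b' \<in> I"
proof -
  have "a * b - a' * b' = (a - a') * b + a' * (b - b')" by (simp add: algebra_simps)
  then show ?thesis using idealD[OF I] assms by simp
qed

lemma ideal_cong_power:
  assumes I: "is_ideal C I" and "a - b \<in> I" "a \<in> C" "b \<in> C"
  shows "a ^ n - b ^ n \<in> I"
proof (induction n)
  case (Suc n)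
  then show ?case
    using ideal_cong_mult[OF I assms(2) Suc assms(4) subring_power[OF idealD(1)[OF I] assms(3)]]
    by simp
qed (simp add: idealD(3)[OF I])

lemma ideal_cong_prod:
  assumes I: "is_ideal C I" and "\<And>x. x \<in> S \<Longrightarrow> f x - g x \<in> I" "\<And>x. x \<in> S \<Longrightarrow> f x \<in> C"
    "\<And>x. x \<in> S \<Longrightarrow> g x \<in> C"
  shows "prod f S - prod g S \<in> I"
  using assms(2-)
proof (induction S rule: infinite_finite_induct)
  case (insert x S)
  then show ?case
    using ideal_cong_mult[OF I, of "f x" "g x" "prod f S" "prod g S"]
      subring_prod[OF idealD(1)[OF I], of S f] by simp
qed (simp_all add: idealD(3)[OF I])

lemma primeD:
  assumes "is_prime C I"
  shows "is_ideal C I" "1 \<notin> I" "a \<in> C \<Longrightarrow> b \<in> C \<Longrightarrow> a * b \<in> I \<Longrightarrow> a \<in> I \<or> b \<in> I"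
  using assms unfolding is_prime_def by auto

lemma prime_power: "is_prime C I \<Longrightarrow> a \<in> C \<Longrightarrow> a ^ n \<in> I \<Longrightarrow> a \<in> I"
proof (induction n)
  case (Suc n)
  then show ?case using primeD(3)[of C I a "a ^ n"] subring_power[OF idealD(1)[OF primeD(1)], of C I a n]
    by auto
qed (use primeD(2) in auto)

lemma prime_prod:
  assumes P: "is_prime C I" and "finite S" "\<And>x. x \<in> S \<Longrightarrow> f x \<in> C" "\<And>x. x \<in> S \<Longrightarrow> f x \<notin> I"
  shows "prod f S \<notin> I"
  using assms(2-)
proof (induction S rule: finite_induct)
  case (insert x S)
  then show ?case
    using primeD(3)[OF P, of "f x" "prod f S"] subring_prod[OF idealD(1)[OF primeD(1)[OF P]], of S f]
    by auto
qed (use primeD(2)[OF P] in simp)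

lemma is_subring_poly: "is_subring (carrier (poly_ring X))"
  by (simp add: is_subring_def poly_ring_closed) (simp add: carrier_poly_ring)

text \<open>The bridge between the ideals of the statement and ideals as plain subsets, whose
  arithmetic is that of the type class.\<close>

lemma is_ideal_poly: "ideal I (poly_ring X) \<longleftrightarrow> is_ideal (carrier (poly_ring X)) I"
proof
  assume "ideal I (poly_ring X)"
  then interpret ideal I "poly_ring X" .
  show "is_ideal (carrier (poly_ring X)) I"
    unfolding is_ideal_def
    using is_subring_poly Icarr additive_subgroup.a_closed[OF is_additive_subgroup]
      I_l_closed additive_subgroup.zero_closed[OF is_additive_subgroup] by auto
next
  assume I: "is_ideal (carrier (poly_ring X)) I"
  interpret cring "poly_ring X" by (rule cring_poly_ring)
  show "ideal I (poly_ring X)"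
  proof (rule idealI[OF ring_axioms])
    show "subgroup I (add_monoid (poly_ring X))"
    proof (rule group.subgroupI)
      show "Group.group (add_monoid (poly_ring X))" by (rule a_group)
      show "I \<subseteq> carrier (add_monoid (poly_ring X))" "I \<noteq> {}"
        using idealD(2,3)[OF I] by auto
      show "inv\<^bsub>add_monoid (poly_ring X)\<^esub> a \<in> I" if "a \<in> I" for a
      proof -
        have "\<ominus>\<^bsub>poly_ring X\<^esub> a = - a"
          using minus_equality[of "- a" a] idealD(2,7)[OF I] that by simp
        then show ?thesis using idealD(7)[OF I that] by (simp add: a_inv_def)
      qed
    qed (use idealD[OF I] in auto)
  qed (use idealD[OF I] in auto)
qed

lemma is_prime_poly: "primeideal I (poly_ring X) \<longleftrightarrow> is_prime (carrier (poly_ring X)) I"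
proof
  assume "primeideal I (poly_ring X)"
  then interpret primeideal I "poly_ring X" .
  have "is_ideal (carrier (poly_ring X)) I" using is_ideal by (simp add: is_ideal_poly)
  moreover have "1 \<notin> I"
  proof
    assume "1 \<in> I"
    then have "I = carrier (poly_ring X)"
      using I_l_closed[of 1] Icarr by fastforce
    then show False using I_notcarr by simp
  qed
  ultimately show "is_prime (carrier (poly_ring X)) I"
    unfolding is_prime_def using I_prime by auto
next
  assume I: "is_prime (carrier (poly_ring X)) I"
  show "primeideal I (poly_ring X)"
  proof (rule primeidealI)
    show "ideal I (poly_ring X)" using primeD(1)[OF I] by (simp add: is_ideal_poly)
    show "carrier (poly_ring X) \<noteq> I"
      using primeD(2)[OF I] subring_closed(2)[OF is_subring_poly] by blast
  qed (use primeD(3)[OF I] cring_poly_ring in auto)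
qed

section \<open>Substitution homomorphisms\<close>

text \<open>Unlike in \<open>poly_subst\<close>, the coefficient ring is arbitrary: chart
  substitutions produce polynomials whose coefficients are again polynomials, and these are
  substituted into in turn.\<close>

definition gsubst ::
    "('a::comm_ring_1 \<Rightarrow> 'b::comm_ring_1) \<Rightarrow> ('v \<Rightarrow> 'b) \<Rightarrow> (('v \<Rightarrow>\<^sub>0 nat) \<Rightarrow>\<^sub>0 'a) \<Rightarrow> 'b" where
  "gsubst \<phi> \<sigma> f = (\<Sum>m\<in>Poly_Mapping.keys f. \<phi> (Poly_Mapping.lookup f m) * mon_value \<sigma> m)"

definition gvars :: "(('v \<Rightarrow>\<^sub>0 nat) \<Rightarrow>\<^sub>0 'a::zero) \<Rightarrow> 'v set" where
  "gvars f = (\<Union>m\<in>Poly_Mapping.keys f. Poly_Mapping.keys m)"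

lemma poly_vars_gvars: "poly_vars f = gvars f"
  by (simp add: poly_vars_def gvars_def)

lemma poly_subst_gsubst: "poly_subst \<phi> \<sigma> f = gsubst \<phi> \<sigma> f"
  by (simp add: poly_subst_def gsubst_def mon_value_def)

lemma mon_value_0 [simp]: "mon_value \<sigma> 0 = 1"
  by (simp add: mon_value_def)

lemma mon_value_single [simp]: "mon_value \<sigma> (Poly_Mapping.single v n) = \<sigma> v ^ n"
  by (simp add: mon_value_def)

lemma comm_ring_hom_PConst: "comm_ring_hom (PConst :: 'a::comm_ring_1 \<Rightarrow> _)"
  by unfold_locales (simp_all add: PConst_def single_add mult_single)

lemma comm_ring_hom_comp: "comm_ring_hom f \<Longrightarrow> comm_ring_hom g \<Longrightarrow> comm_ring_hom (\<lambda>x. f (g x))"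
  by (simp add: comm_ring_hom_def ring_hom_def semiring_hom_def comm_monoid_add_hom_def
      monoid_add_hom_def zero_hom_def semigroup_add_hom_def plus_hom_def monoid_mult_hom_def
      one_hom_def semigroup_mult_hom_def times_hom_def)

lemma comm_ring_hom_id: "comm_ring_hom (\<lambda>x. x)"
  by unfold_locales simp_all

lemma gsubst_superset:
  assumes "comm_ring_hom \<phi>" "finite S" "Poly_Mapping.keys f \<subseteq> S"
  shows "gsubst \<phi> \<sigma> f = (\<Sum>m\<in>S. \<phi> (Poly_Mapping.lookup f m) * mon_value \<sigma> m)"
proof -
  interpret comm_ring_hom \<phi> by (rule assms)
  show ?thesis unfolding gsubst_def
    by (rule sum.mono_neutral_left) (use assms in \<open>auto simp: in_keys_iff\<close>)
qed

lemma gsubst_single: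
  "comm_ring_hom \<phi> \<Longrightarrow> gsubst \<phi> \<sigma> (Poly_Mapping.single m c) = \<phi> c * mon_value \<sigma> m"
  by (subst gsubst_superset[of \<phi> "{m}"]) auto

lemma gsubst_add:
  assumes "comm_ring_hom \<phi>"
  shows "gsubst \<phi> \<sigma> (f + g) = gsubst \<phi> \<sigma> f + gsubst \<phi> \<sigma> g"
proof -
  interpret comm_ring_hom \<phi> by (rule assms)
  let ?S = "Poly_Mapping.keys f \<union> Poly_Mapping.keys g"
  show ?thesis
    using Poly_Mapping.keys_add[of f g]
    by (simp add: gsubst_superset[OF assms, of ?S] lookup_add hom_distribs distrib_right sum.distrib)
qed

lemma gsubst_sum:
  "comm_ring_hom \<phi> \<Longrightarrow> gsubst \<phi> \<sigma> (\<Sum>x\<in>S. f x) = (\<Sum>x\<in>S. gsubst \<phi> \<sigma> (f x))"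
  by (induction S rule: infinite_finite_induct) (simp_all add: gsubst_add, simp_all add: gsubst_def)

lemma gpoly_sum_single:
  "f = (\<Sum>m\<in>Poly_Mapping.keys f. Poly_Mapping.single m (Poly_Mapping.lookup f m))"
  by (rule poly_mapping_eqI) (simp add: lookup_sum lookup_single when_def in_keys_iff)

lemma gsubst_mult:
  assumes "comm_ring_hom \<phi>"
  shows "gsubst \<phi> \<sigma> (f * g) = gsubst \<phi> \<sigma> f * gsubst \<phi> \<sigma> g"
proof -
  interpret comm_ring_hom \<phi> by (rule assms)
  let ?f = "\<lambda>m. Poly_Mapping.single m (Poly_Mapping.lookup f m)"
  let ?g = "\<lambda>m. Poly_Mapping.single m (Poly_Mapping.lookup g m)"
  have 1: "gsubst \<phi> \<sigma> (?f a * ?g b) = gsubst \<phi> \<sigma> (?f a) * gsubst \<phi> \<sigma> (?g b)" for a b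
    by (simp add: mult_single gsubst_single[OF assms] mon_value_add hom_distribs ac_simps)
  have "gsubst \<phi> \<sigma> (f * g) = gsubst \<phi> \<sigma>
      ((\<Sum>a\<in>Poly_Mapping.keys f. ?f a) * (\<Sum>b\<in>Poly_Mapping.keys g. ?g b))"
    by (simp flip: gpoly_sum_single)
  also have "\<dots> = (\<Sum>a\<in>Poly_Mapping.keys f. gsubst \<phi> \<sigma> (?f a)) *
      (\<Sum>b\<in>Poly_Mapping.keys g. gsubst \<phi> \<sigma> (?g b))"
    unfolding sum_product gsubst_sum[OF assms] 1 ..
  also have "\<dots> = gsubst \<phi> \<sigma> f * gsubst \<phi> \<sigma> g"
    unfolding gsubst_sum[OF assms, symmetric] by (simp flip: gpoly_sum_single)
  finally show ?thesis .
qed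

lemma gsubst_PConst [simp]: "comm_ring_hom \<phi> \<Longrightarrow> gsubst \<phi> \<sigma> (PConst c) = \<phi> c"
  unfolding PConst_def by (simp add: gsubst_single)

lemma gsubst_PVar [simp]: "comm_ring_hom \<phi> \<Longrightarrow> gsubst \<phi> \<sigma> (PVar v) = \<sigma> v"
proof -
  assume a: "comm_ring_hom \<phi>"
  then interpret comm_ring_hom \<phi> .
  show ?thesis unfolding PVar_def by (simp add: gsubst_single[OF a])
qed

lemma comm_ring_hom_gsubst:
  assumes "comm_ring_hom \<phi>" shows "comm_ring_hom (gsubst \<phi> \<sigma>)"
proof -
  interpret comm_ring_hom \<phi> by (rule assms)
  have "gsubst \<phi> \<sigma> 1 = 1"
    using gsubst_single[OF assms, of \<sigma> 0 1] by simp
  then show ?thesis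
    by unfold_locales (simp_all add: gsubst_add gsubst_mult assms, simp add: gsubst_def)
qed

lemma hom_mon_value: "comm_ring_hom h \<Longrightarrow> h (mon_value \<sigma> m) = mon_value (\<lambda>v. h (\<sigma> v)) m"
proof -
  assume "comm_ring_hom h"
  then interpret comm_ring_hom h .
  show ?thesis by (simp add: mon_value_def hom_distribs)
qed

text \<open>Together with \<open>gsubst_cong\<close> this reduces an identity between composed
  substitutions to a check on constants and single variables.\<close>

lemma hom_gsubst:
  assumes "comm_ring_hom h"
  shows "h (gsubst \<phi> \<sigma> f) = gsubst (\<lambda>c. h (\<phi> c)) (\<lambda>v. h (\<sigma> v)) f"
proof -
  interpret comm_ring_hom h by (rule assms)
  show ?thesis by (simp add: gsubst_def hom_distribs hom_mon_value[OF assms])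
qed

lemma mon_value_PVar: "mon_value PVar m = Poly_Mapping.single m (1::'a::comm_ring_1)"
proof -
  have pow: "PVar v ^ n = (Poly_Mapping.single (Poly_Mapping.single v n) 1 :: _ \<Rightarrow>\<^sub>0 'a)" for v :: 'b and n
    by (induction n) (simp_all add: PVar_def mult_single flip: single_add)
  have prod: "(\<Prod>x\<in>S. Poly_Mapping.single (k x) 1 :: _ \<Rightarrow>\<^sub>0 'a) = Poly_Mapping.single (\<Sum>x\<in>S. k x) 1"
    for S :: "'b set" and k :: "'b \<Rightarrow> 'b \<Rightarrow>\<^sub>0 nat"
    by (induction S rule: infinite_finite_induct) (simp_all add: mult_single)
  have "(\<Sum>v\<in>Poly_Mapping.keys m. Poly_Mapping.single v (Poly_Mapping.lookup m v)) = m"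
    by (rule poly_mapping_eqI) (simp add: lookup_sum lookup_single when_def in_keys_iff)
  then show ?thesis by (simp add: mon_value_def pow prod)
qed

lemma gsubst_ident: "gsubst PConst PVar f = f"
  unfolding gsubst_def mon_value_PVar
  by (subst (3) gpoly_sum_single[of f]) (simp add: PConst_def mult_single)

lemma gsubst_cong:
  assumes "\<And>m. m \<in> Poly_Mapping.keys f \<Longrightarrow> \<phi> (Poly_Mapping.lookup f m) = \<phi>' (Poly_Mapping.lookup f m)"
    "\<And>v. v \<in> gvars f \<Longrightarrow> \<sigma> v = \<sigma>' v"
  shows "gsubst \<phi> \<sigma> f = gsubst \<phi>' \<sigma>' f"
proof -
  have "mon_value \<sigma> m = mon_value \<sigma>' m" if "m \<in> Poly_Mapping.keys f" for m
    unfolding mon_value_def using assms(2)[of v for v] that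
    by (intro prod.cong refl arg_cong[where f = "\<lambda>x. x ^ _"]) (auto simp: gvars_def)
  then show ?thesis unfolding gsubst_def using assms(1) by (intro sum.cong) auto
qed

lemma mon_value_in:
  assumes "is_subring C" "\<And>v. v \<in> Poly_Mapping.keys m \<Longrightarrow> \<sigma> v \<in> C"
  shows "mon_value \<sigma> m \<in> C"
  unfolding mon_value_def using assms by (intro subring_prod subring_power)

lemma gsubst_in:
  assumes "is_subring C" "\<And>m. m \<in> Poly_Mapping.keys f \<Longrightarrow> \<phi> (Poly_Mapping.lookup f m) \<in> C"
    "\<And>v. v \<in> gvars f \<Longrightarrow> \<sigma> v \<in> C"
  shows "gsubst \<phi> \<sigma> f \<in> C"
  unfolding gsubst_def using assms
  by (intro subring_sum subring_closed(5) mon_value_in) (auto simp: gvars_def)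

lemma gsubst_in_ideal:
  assumes "is_ideal C I" "\<And>m. m \<in> Poly_Mapping.keys f \<Longrightarrow> \<phi> (Poly_Mapping.lookup f m) \<in> I"
    "\<And>v. v \<in> gvars f \<Longrightarrow> \<sigma> v \<in> C"
  shows "gsubst \<phi> \<sigma> f \<in> I"
  unfolding gsubst_def using assms
  by (intro ideal_sum idealD(6)[OF assms(1)] mon_value_in idealD(1)[OF assms(1)]) (auto simp: gvars_def)

lemma gsubst_cong_ideal:
  assumes I: "is_ideal C I" and "\<And>m. m \<in> Poly_Mapping.keys f \<Longrightarrow> \<phi> (Poly_Mapping.lookup f m) \<in> C"
    and s: "\<And>v. v \<in> gvars f \<Longrightarrow> \<sigma> v \<in> C" "\<And>v. v \<in> gvars f \<Longrightarrow> \<sigma>' v \<in> C"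
      "\<And>v. v \<in> gvars f \<Longrightarrow> \<sigma> v - \<sigma>' v \<in> I"
  shows "gsubst \<phi> \<sigma> f - gsubst \<phi> \<sigma>' f \<in> I"
proof -
  have "mon_value \<sigma> m - mon_value \<sigma>' m \<in> I" if m: "m \<in> Poly_Mapping.keys f" for m
    unfolding mon_value_def
    by (intro ideal_cong_prod[OF I] ideal_cong_power[OF I] subring_power[OF idealD(1)[OF I]] s)
      (use m in \<open>auto simp: gvars_def\<close>)
  then show ?thesis
    unfolding gsubst_def sum_subtractf[symmetric] right_diff_distrib[symmetric]
    using assms(2) by (intro ideal_sum[OF I] idealD(5)[OF I])
qed

section \<open>Polynomials with coefficients in an ideal\<close>

text \<open>For a subring this is the polynomial ring over it, for an ideal its extension to that
  polynomial ring.\<close>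

definition coeffs_in :: "'a::zero set \<Rightarrow> ('m \<Rightarrow>\<^sub>0 'a) set" where
  "coeffs_in C = {F. \<forall>m. Poly_Mapping.lookup F m \<in> C}"

lemma coeffs_inD: "F \<in> coeffs_in C \<Longrightarrow> Poly_Mapping.lookup F m \<in> C"
  by (simp add: coeffs_in_def)

lemma lookup_mult_keys:
  fixes F G :: "'m::cancel_comm_monoid_add \<Rightarrow>\<^sub>0 'a::comm_ring_1"
  shows "Poly_Mapping.lookup (F * G) n =
    (\<Sum>(a, b) \<in> {(a, b). a \<in> Poly_Mapping.keys F \<and> b \<in> Poly_Mapping.keys G \<and> a + b = n}.
      Poly_Mapping.lookup F a * Poly_Mapping.lookup G b)"
proof -
  let ?s = "\<lambda>F a. Poly_Mapping.single a (Poly_Mapping.lookup F a)"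
  let ?K = "Poly_Mapping.keys F \<times> Poly_Mapping.keys G"
  have "F * G = (\<Sum>a\<in>Poly_Mapping.keys F. ?s F a) * (\<Sum>b\<in>Poly_Mapping.keys G. ?s G b)"
    by (simp flip: gpoly_sum_single)
  also have "\<dots> = (\<Sum>(a, b)\<in>?K. Poly_Mapping.single (a + b) (Poly_Mapping.lookup F a * Poly_Mapping.lookup G b))"
    by (simp add: sum_product sum.cartesian_product mult_single)
  also have "Poly_Mapping.lookup \<dots> n =
      (\<Sum>(a, b)\<in>?K. if a + b = n then Poly_Mapping.lookup F a * Poly_Mapping.lookup G b else 0)"
    unfolding lookup_sum by (intro sum.cong) (auto simp: lookup_single when_def)
  also have "\<dots> = (\<Sum>(a, b) \<in> ?K \<inter> {(a, b). a + b = n}. Poly_Mapping.lookup F a * Poly_Mapping.lookup G b)"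
    by (subst sum.inter_restrict) (auto intro!: sum.cong)
  also have "?K \<inter> {(a, b). a + b = n} = {(a, b). a \<in> Poly_Mapping.keys F \<and> b \<in> Poly_Mapping.keys G \<and> a + b = n}"
    by auto
  finally show ?thesis .
qed

lemma is_subring_coeffs_in:
  assumes "is_subring C"
  shows "is_subring (coeffs_in C :: ('m::cancel_comm_monoid_add \<Rightarrow>\<^sub>0 'a::comm_ring_1) set)"
  unfolding is_subring_def
proof (intro conjI ballI)
  fix F G :: "'m \<Rightarrow>\<^sub>0 'a" assume FG: "F \<in> coeffs_in C" "G \<in> coeffs_in C"
  then show "F * G \<in> coeffs_in C"
    by (auto simp: coeffs_in_def lookup_mult_keys intro!: subring_sum[OF assms] subring_closed(5)[OF assms])
qed (use subring_closed[OF assms] in \<open>auto simp: coeffs_in_def lookup_add lookup_one when_def\<close>)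

lemma is_ideal_coeffs_in:
  assumes "is_ideal C I"
  shows "is_ideal (coeffs_in C) (coeffs_in I :: ('m::cancel_comm_monoid_add \<Rightarrow>\<^sub>0 'a::comm_ring_1) set)"
  unfolding is_ideal_def
proof (intro conjI ballI)
  show "is_subring (coeffs_in C :: ('m \<Rightarrow>\<^sub>0 'a) set)"
    by (rule is_subring_coeffs_in[OF idealD(1)[OF assms]])
  fix F G :: "'m \<Rightarrow>\<^sub>0 'a" assume FG: "F \<in> coeffs_in C" "G \<in> coeffs_in I"
  then show "F * G \<in> coeffs_in I"
    by (auto simp: coeffs_in_def lookup_mult_keys intro!: ideal_sum[OF assms] idealD(5)[OF assms])
qed (use idealD[OF assms] in \<open>auto simp: coeffs_in_def lookup_add\<close>)

text \<open>The top monomials with coefficient outside \<open>I\<close>, in a monomial order, multiply without cancellation.\<close>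

lemma is_prime_coeffs_in:
  assumes P: "is_prime C I"
  shows "is_prime (coeffs_in C) (coeffs_in I :: (('y::linorder \<Rightarrow>\<^sub>0 nat) \<Rightarrow>\<^sub>0 'a::comm_ring_1) set)"
  unfolding is_prime_def
proof (intro conjI ballI impI)
  note I = primeD(1)[OF P]
  show "is_ideal (coeffs_in C) (coeffs_in I :: (('y \<Rightarrow>\<^sub>0 nat) \<Rightarrow>\<^sub>0 'a) set)"
    by (rule is_ideal_coeffs_in[OF I])
  have "Poly_Mapping.lookup (1 :: ('y \<Rightarrow>\<^sub>0 nat) \<Rightarrow>\<^sub>0 'a) 0 \<notin> I" using primeD(2)[OF P] by simp
  then show "(1 :: ('y \<Rightarrow>\<^sub>0 nat) \<Rightarrow>\<^sub>0 'a) \<notin> coeffs_in I" unfolding coeffs_in_def by blast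
  fix F G :: "('y \<Rightarrow>\<^sub>0 nat) \<Rightarrow>\<^sub>0 'a"
  assume F: "F \<in> coeffs_in C" and G: "G \<in> coeffs_in C" and FG: "F * G \<in> coeffs_in I"
  show "F \<in> coeffs_in I \<or> G \<in> coeffs_in I"
  proof (rule ccontr)
    assume none: "\<not> ?thesis"
    define top where "top = (\<lambda>H :: ('y \<Rightarrow>\<^sub>0 nat) \<Rightarrow>\<^sub>0 'a. Max {m \<in> Poly_Mapping.keys H. Poly_Mapping.lookup H m \<notin> I})"
    have top: "Poly_Mapping.lookup H (top H) \<notin> I" "\<And>m. top H < m \<Longrightarrow> Poly_Mapping.lookup H m \<in> I"
      if H: "H \<notin> coeffs_in I" for H
    proof -
      let ?S = "{m \<in> Poly_Mapping.keys H. Poly_Mapping.lookup H m \<notin> I}"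
      obtain m where "Poly_Mapping.lookup H m \<notin> I" using H by (auto simp: coeffs_in_def)
      moreover from this have "m \<in> Poly_Mapping.keys H"
        using idealD(3)[OF I] by (auto simp: in_keys_iff)
      ultimately have "?S \<noteq> {}" by auto
      then have "top H \<in> ?S" unfolding top_def by (intro Max_in) auto
      then show "Poly_Mapping.lookup H (top H) \<notin> I" by simp
      show "Poly_Mapping.lookup H m \<in> I" if "top H < m" for m
      proof (rule ccontr)
        assume "Poly_Mapping.lookup H m \<notin> I"
        then have "m \<in> ?S" using idealD(3)[OF I] by (auto simp: in_keys_iff)
        then have "m \<le> top H" unfolding top_def by (intro Max_ge) auto
        then show False using that by simp
      qed
    qed
    have F': "F \<notin> coeffs_in I" and G': "G \<notin> coeffs_in I" using none by auto
    let ?a = "top F" and ?b = "top G"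
    let ?S = "{(a, b). a \<in> Poly_Mapping.keys F \<and> b \<in> Poly_Mapping.keys G \<and> a + b = ?a + ?b}"
    have fin: "finite ?S"
      by (rule finite_subset[of _ "Poly_Mapping.keys F \<times> Poly_Mapping.keys G"]) auto
    have mem: "(?a, ?b) \<in> ?S"
      using top(1)[OF F'] top(1)[OF G'] idealD(3)[OF I] by (auto simp: in_keys_iff)
    have rest: "(\<Sum>(a, b)\<in>?S - {(?a, ?b)}. Poly_Mapping.lookup F a * Poly_Mapping.lookup G b) \<in> I"
    proof (rule ideal_sum[OF I])
      fix x assume x: "x \<in> ?S - {(?a, ?b)}"
      obtain a b where xab: "x = (a, b)" by (cases x)
      have ab: "a + b = ?a + ?b" and ne: "\<not> (a = ?a \<and> b = ?b)" using x xab by auto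
      consider "?a < a" | "?b < b"
      proof -
        have "a \<le> ?a \<Longrightarrow> b \<le> ?b \<Longrightarrow> False"
        proof -
          assume le: "a \<le> ?a" "b \<le> ?b"
          show False
          proof (cases "a = ?a")
            case True then show False using ab(1) ne by simp
          next
            case False
            \<comment> \<open>Addition is strictly monotone for the linear order on exponents that
              comes from the order on the variables.\<close>
            then have "a + b < ?a + ?b" using le by (intro add_less_le_mono) auto
            then show False using ab(1) by simp
          qed
        qed
        then show ?thesis using that by (meson not_le)
      qed
      then have "Poly_Mapping.lookup F a * Poly_Mapping.lookup G b \<in> I"
      proof cases
        case 1
        then show ?thesis using top(2)[OF F'] idealD(6)[OF I] coeffs_inD[OF G] by blast
      next
        case 2
        then show ?thesis using top(2)[OF G'] idealD(5)[OF I] coeffs_inD[OF F] by blast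
      qed
      then show "(case x of (a, b) \<Rightarrow> Poly_Mapping.lookup F a * Poly_Mapping.lookup G b) \<in> I"
        by (simp add: xab)
    qed
    have "Poly_Mapping.lookup (F * G) (?a + ?b) = Poly_Mapping.lookup F ?a * Poly_Mapping.lookup G ?b +
        (\<Sum>(a, b)\<in>?S - {(?a, ?b)}. Poly_Mapping.lookup F a * Poly_Mapping.lookup G b)"
      unfolding lookup_mult_keys by (subst sum.remove[OF fin mem]) simp
    then have "Poly_Mapping.lookup F ?a * Poly_Mapping.lookup G ?b \<in> I"
      using idealD(8)[OF I coeffs_inD[OF FG, of "?a + ?b"] rest] by simp
    then show False
      using primeD(3)[OF P] coeffs_inD[OF F] coeffs_inD[OF G] top(1)[OF F'] top(1)[OF G'] by blast
  qed
qed

lemma PConst_coeffs_in: "a \<in> C \<Longrightarrow> 0 \<in> C \<Longrightarrow> PConst a \<in> coeffs_in C"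
  by (auto simp: coeffs_in_def PConst_def lookup_single when_def)

lemma PConst_coeffs_in_iff: "0 \<in> C \<Longrightarrow> PConst a \<in> coeffs_in C \<longleftrightarrow> a \<in> C"
  using PConst_coeffs_in[of a C] coeffs_inD[of "PConst a" C 0] by (auto simp: PConst_def)

lemma PVar_coeffs_in: "is_subring C \<Longrightarrow> PVar v \<in> coeffs_in C"
  using subring_closed(1,2)[of C] by (auto simp: coeffs_in_def PVar_def lookup_single when_def)

lemma lookup_gsubst_coeff:
  fixes F :: "('v \<Rightarrow>\<^sub>0 nat) \<Rightarrow>\<^sub>0 'a::comm_ring_1"
  assumes "comm_ring_hom h"
  shows "Poly_Mapping.lookup (gsubst (\<lambda>c. PConst (h c)) PVar F) m = h (Poly_Mapping.lookup F m)"
proof -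
  interpret comm_ring_hom h by (rule assms)
  show ?thesis
    unfolding gsubst_def mon_value_PVar
    by (simp add: PConst_def mult_single lookup_sum lookup_single when_def in_keys_iff)
qed

lemma mon_deg_1: "mon_value (\<lambda>_. a) m = a ^ mon_deg (\<lambda>_. 1) m"
  by (simp add: mon_value_def mon_deg_def power_sum)

lemma mon_value_mult: "mon_value (\<lambda>v. \<sigma> v * \<tau> v) m = mon_value \<sigma> m * mon_value \<tau> m"
  by (simp add: mon_value_def power_mult_distrib prod.distrib)

text \<open>Scaling all variables acts diagonally on coefficients, so the powers left behind by
  omitted denominators can be cancelled coefficient by coefficient.\<close>

lemma lookup_gsubst_scale:
  fixes F :: "('v \<Rightarrow>\<^sub>0 nat) \<Rightarrow>\<^sub>0 'a::comm_ring_1"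
  shows "Poly_Mapping.lookup (gsubst PConst (\<lambda>v. PConst a * PVar v) F) m =
    a ^ mon_deg (\<lambda>_. 1) m * Poly_Mapping.lookup F m"
proof -
  interpret comm_ring_hom "PConst :: 'a \<Rightarrow> ('v \<Rightarrow>\<^sub>0 nat) \<Rightarrow>\<^sub>0 'a" by (rule comm_ring_hom_PConst)
  have "gsubst PConst (\<lambda>v. PConst a * PVar v) F =
      (\<Sum>m\<in>Poly_Mapping.keys F. Poly_Mapping.single m (a ^ mon_deg (\<lambda>_. 1) m * Poly_Mapping.lookup F m))"
    unfolding gsubst_def mon_value_mult mon_deg_1 mon_value_PVar hom_power[symmetric]
    by (simp add: PConst_def mult_single ac_simps)
  then show ?thesis by (simp add: lookup_sum lookup_single when_def in_keys_iff)
qed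

section \<open>Determinant identities\<close>

text \<open>The columns are given by a list, possibly with repetitions, so that exchanging a column
  is a list update, as for Pluecker coordinates.\<close>

definition dt :: "(nat \<Rightarrow> 'i \<Rightarrow> 'a::comm_ring_1) \<Rightarrow> 'i list \<Rightarrow> 'a" where
  "dt a L = det (mat (length L) (length L) (\<lambda>(k, l). a k (L ! l)))"

lemma hom_det_mat:
  assumes "comm_ring_hom h"
  shows "h (det (mat n n f)) = det (mat n n (\<lambda>x. h (f x)))"
proof -
  interpret comm_ring_hom h by (rule assms)
  have "map_mat h (mat n n f) = mat n n (\<lambda>x. h (f x))" by (intro eq_matI) auto
  then show ?thesis using hom_det[of "mat n n f"] by simp
qed

lemma hom_dt: "comm_ring_hom h \<Longrightarrow> h (dt a L) = dt (\<lambda>k i. h (a k i)) L"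
  by (simp add: dt_def hom_det_mat case_prod_unfold)

lemma dt_cong:
  assumes "\<And>k l. k < length L \<Longrightarrow> l < length L \<Longrightarrow> a k (L ! l) = b k (L ! l)"
  shows "dt a L = dt b L"
  unfolding dt_def using assms by (intro arg_cong[where f = det] eq_matI) auto

lemma dt_map: "dt a (map f L) = dt (\<lambda>k i. a k (f i)) L"
  unfolding dt_def by (intro arg_cong[where f = det] eq_matI) auto

lemma dt_repeated_entry:
  assumes "\<not> distinct L" shows "dt a L = 0"
proof -
  obtain p q where pq: "p < length L" "q < length L" "p \<noteq> q" "L ! p = L ! q"
    using assms by (auto simp: distinct_conv_nth)
  show ?thesis unfolding dt_def
    by (rule det_identical_columns[of _ "length L" p q]) (use pq in auto)
qed

lemma dt_repeated_row:
  assumes "p < length L" "q < length L" "p \<noteq> q" "\<And>i. a p i = a q i"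
  shows "dt a L = 0"
  unfolding dt_def
  by (rule det_identical_rows[of _ "length L" p q]) (use assms in auto)

lemma dt_swap:
  assumes "p < length L" "q < length L" "p \<noteq> q"
  shows "dt a (L[p := L ! q, q := L ! p]) = - dt a L"
proof -
  let ?A = "mat (length L) (length L) (\<lambda>(k, l). a k (L ! l))"
  have "mat (length L) (length L) (\<lambda>(k, l). a k (L[p := L ! q, q := L ! p] ! l)) = swapcols p q ?A"
    using assms by (intro eq_matI) (auto simp: nth_list_update)
  then show ?thesis unfolding dt_def using det_swapcols[OF assms, of ?A] by simp
qed

text \<open>Each entry of \<open>zs\<close> that \<open>u\<close> passes costs one
  transposition.\<close>

lemma dt_move_last: "dt a (xs @ u # zs) = (- 1) ^ length zs * dt a (xs @ zs @ [u])"
proof (induction zs arbitrary: xs)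
  case (Cons v zs)
  have "(xs @ u # v # zs)[length xs := v, Suc (length xs) := u] = xs @ v # u # zs"
    by (simp add: list_update_append)
  then have "dt a (xs @ u # v # zs) = - dt a ((xs @ [v]) @ u # zs)"
    using dt_swap[of "length xs" "xs @ u # v # zs" "Suc (length xs)" a] by (simp add: nth_append)
  then show ?case unfolding Cons.IH by simp
qed simp

text \<open>Laplace expansion along the last row; moving \<open>i\<close> into the place of the deleted entry gives the signs.\<close>

lemma dt_snoc:
  fixes a :: "nat \<Rightarrow> 'i \<Rightarrow> 'a::comm_ring_1"
  shows "dt a (L @ [i]) = a (length L) i * dt a L - (\<Sum>k<length L. a (length L) (L ! k) * dt a (L[k := i]))"
proof -
  define r where "r = length L"
  let ?A = "mat (Suc r) (Suc r) (\<lambda>(k, l). a k ((L @ [i]) ! l))"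
  have cof_last: "cofactor ?A r r = dt a L"
  proof -
    have "mat_delete ?A r r = mat r r (\<lambda>(k, l). a k (L ! l))"
      by (intro eq_matI) (auto simp: mat_delete_def nth_append r_def)
    then show ?thesis by (simp add: cofactor_def dt_def r_def)
  qed
  have cof: "cofactor ?A r k = - dt a (L[k := i])" if k: "k < r" for k
  proof -
    let ?zs = "drop (Suc k) L"
    have "mat_delete ?A r k = mat r r (\<lambda>(p, q). a p ((take k L @ ?zs @ [i]) ! q))"
    proof (intro eq_matI)
      fix p q assume "p < dim_row (mat r r (\<lambda>(p, q). a p ((take k L @ ?zs @ [i]) ! q)))"
        "q < dim_col (mat r r (\<lambda>(p, q). a p ((take k L @ ?zs @ [i]) ! q)))"
      then have pq: "p < r" "q < r" by auto
      have "(take k L @ ?zs @ [i]) ! q = (L @ [i]) ! (if q < k then q else Suc q)"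
        using k pq by (auto simp: nth_append r_def min_def)
      then show "mat_delete ?A r k $$ (p, q) = mat r r (\<lambda>(p, q). a p ((take k L @ ?zs @ [i]) ! q)) $$ (p, q)"
        using k pq by (auto simp: mat_delete_def)
    qed (auto simp: mat_delete_def)
    moreover have "length (take k L @ ?zs @ [i]) = r" using k by (simp add: r_def)
    ultimately have del: "det (mat_delete ?A r k) = dt a (take k L @ ?zs @ [i])"
      by (simp add: dt_def)
    have "L[k := i] = take k L @ i # ?zs" using k by (simp add: upd_conv_take_nth_drop r_def)
    then have 1: "dt a (L[k := i]) = (- 1) ^ (r - Suc k) * det (mat_delete ?A r k)"
      unfolding del by (simp add: dt_move_last r_def)
    have "(- 1 :: 'a) ^ (r + k) = - ((- 1) ^ (r - Suc k))"
    proof -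
      obtain t where "r = Suc (k + t)" using k less_imp_Suc_add by auto
      then show ?thesis by (simp add: minus_one_power_iff)
    qed
    then show ?thesis unfolding cofactor_def 1 by simp
  qed
  have "dt a (L @ [i]) = (\<Sum>k<Suc r. ?A $$ (r, k) * cofactor ?A r k)"
    unfolding dt_def using laplace_expansion_row[of ?A "Suc r" r] by (simp add: r_def)
  also have "\<dots> = (\<Sum>k<r. ?A $$ (r, k) * cofactor ?A r k) + ?A $$ (r, r) * cofactor ?A r r"
    by (rule sum.lessThan_Suc)
  also have "(\<Sum>k<r. ?A $$ (r, k) * cofactor ?A r k) = (\<Sum>k<r. a r (L ! k) * - dt a (L[k := i]))"
    by (intro sum.cong refl arg_cong2[where f = "(*)"]) (simp_all only: cof lessThan_iff, simp add: nth_append r_def)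
  also have "?A $$ (r, r) * cofactor ?A r r = a r i * dt a L"
    unfolding cof_last by (simp add: r_def)
  finally show ?thesis by (simp add: r_def sum_negf)
qed

lemma dt_cramer:
  assumes "m < length L"
  shows "dt a L * a m i = (\<Sum>k<length L. a m (L ! k) * dt a (L[k := i]))"
proof -
  \<comment> \<open>Row \<open>m\<close> is repeated as an additional last row; the larger
    determinant vanishes, and its expansion is Cramer's rule.\<close>
  define b where "b = a(length L := a m)"
  have "dt b (L @ [i]) = 0"
    by (rule dt_repeated_row[of m _ "length L"]) (use assms in \<open>auto simp: b_def\<close>)
  moreover have "dt b L' = dt a L'" if "length L' = length L" for L'
    by (rule dt_cong) (use that in \<open>auto simp: b_def\<close>)
  ultimately show ?thesis
    using dt_snoc[of b L i] by (simp add: b_def mult.commute)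
qed

text \<open>Laplace expansion along column \<open>k\<close>: the cofactors do not see the entries of
  that column, so the same \<open>c\<close> serves all \<open>i\<close>.\<close>

lemma dt_update_linear:
  assumes "k < length L"
  obtains c where "\<And>i. dt a (L[k := i]) = (\<Sum>m<length L. a m i * c m)"
proof
  let ?r = "length L"
  let ?A = "\<lambda>i. mat ?r ?r (\<lambda>(p, l). a p (L[k := i] ! l))"
  fix i
  have "mat_delete (?A i) m k = mat_delete (?A (L ! k)) m k" for m
    using assms by (intro eq_matI) (auto simp: mat_delete_def nth_list_update)
  then have "cofactor (?A i) m k = cofactor (?A (L ! k)) m k" for m
    unfolding cofactor_def by simp
  then show "dt a (L[k := i]) = (\<Sum>m<length L. a m i * cofactor (?A (L ! k)) m k)"
    unfolding dt_def using laplace_expansion_column[of "?A i" ?r k] assms by simp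
qed

text \<open>The Pluecker relation of a flag: row \<open>m < r\<close> of the matrix is a combination of the columns of \<open>M\<close>.\<close>

lemma dt_exchange:
  assumes "length L \<le> length M" "k < length L"
  shows "dt a M * dt a (L[k := i]) = (\<Sum>l<length M. dt a (L[k := M ! l]) * dt a (M[l := i]))"
proof -
  obtain c where c: "\<And>i. dt a (L[k := i]) = (\<Sum>m<length L. a m i * c m)"
    using dt_update_linear[OF assms(2)] by blast
  have "dt a M * dt a (L[k := i]) = (\<Sum>m<length L. (dt a M * a m i) * c m)"
    unfolding c by (simp add: sum_distrib_left mult.assoc)
  also have "\<dots> = (\<Sum>m<length L. (\<Sum>l<length M. a m (M ! l) * dt a (M[l := i])) * c m)"
    by (intro sum.cong arg_cong2[where f = "(*)"] refl dt_cramer) (use assms(1) in auto)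
  also have "\<dots> = (\<Sum>l<length M. \<Sum>m<length L. a m (M ! l) * c m * dt a (M[l := i]))"
    unfolding sum_distrib_right by (subst sum.swap) (simp add: ac_simps)
  also have "\<dots> = (\<Sum>l<length M. dt a (L[k := M ! l]) * dt a (M[l := i]))"
    unfolding c by (simp add: sum_distrib_right)
  finally show ?thesis .
qed

lemma mat_mult_explicit:
  "mat n n (\<lambda>(m, l). \<Sum>k<n. b m k * c k l) = mat n n (\<lambda>(m, k). b m k) * mat n n (\<lambda>(k, l). c k l)"
  by (intro eq_matI) (auto simp: scalar_prod_def lessThan_atLeast0)

lemma det_mult_explicit:
  fixes b c :: "nat \<Rightarrow> nat \<Rightarrow> 'a::comm_ring_1"
  shows "det (mat n n (\<lambda>(m, l). \<Sum>k<n. b m k * c k l)) = det (mat n n (\<lambda>(m, k). b m k)) * det (mat n n (\<lambda>(k, l). c k l))"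
  unfolding mat_mult_explicit by (rule det_mult) auto

text \<open>Padding the left factor with zero columns makes both factors square, and the padded one
  has determinant 0.\<close>

lemma det_low_rank:
  fixes b c :: "nat \<Rightarrow> nat \<Rightarrow> 'a::comm_ring_1"
  assumes "r < n"
  shows "det (mat n n (\<lambda>(m, l). \<Sum>k<r. b m k * c k l)) = 0"
proof -
  let ?b = "\<lambda>m k. if k < r then b m k else 0"
  have "(\<Sum>k<r. b m k * c k l) = (\<Sum>k<n. ?b m k * c k l)" for m l
    by (rule sum.mono_neutral_cong_left) (use assms in auto)
  then have "det (mat n n (\<lambda>(m, l). \<Sum>k<r. b m k * c k l)) =
      det (mat n n (\<lambda>(m, k). ?b m k)) * det (mat n n (\<lambda>(k, l). c k l))"
    by (simp flip: det_mult_explicit)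
  also have "det (mat n n (\<lambda>(m, k). ?b m k)) = 0"
    by (subst laplace_expansion_column[of _ n r]) (use assms in auto)
  finally show ?thesis by simp
qed

text \<open>Cramer's rule for all rows and all columns of \<open>T\<close> at once is an identity of
  matrix products; this is its determinant. One factor \<open>dt a L\<close> stays on each side
  because it may be a zero divisor.\<close>

lemma dt_compound:
  assumes "length T = length L"
  shows "dt a L * det (mat (length L) (length L) (\<lambda>(m, l). dt a (L[m := T ! l]))) =
    dt a L ^ length L * dt a T"
proof -
  let ?r = "length L"
  have "mat ?r ?r (\<lambda>(m, l). \<Sum>k<?r. a m (L ! k) * dt a (L[k := T ! l])) =
      dt a L \<cdot>\<^sub>m mat ?r ?r (\<lambda>(m, l). a m (T ! l))"
    by (intro eq_matI) (simp_all add: dt_cramer)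
  then have "det (mat ?r ?r (\<lambda>(m, l). \<Sum>k<?r. a m (L ! k) * dt a (L[k := T ! l]))) =
      dt a L ^ ?r * dt a T"
    using assms by (simp add: dt_def)
  then show ?thesis by (simp add: det_mult_explicit dt_def)
qed

lemma adj_mat_sum:
  fixes A :: "'a::comm_ring_1 mat"
  assumes "A \<in> carrier_mat n n" "i < n" "j < n"
  shows "(\<Sum>k<n. A $$ (i, k) * adj_mat A $$ (k, j)) = (if i = j then det A else 0)"
proof -
  have "(A * adj_mat A) $$ (i, j) = (\<Sum>k<n. A $$ (i, k) * adj_mat A $$ (k, j))"
    using assms adj_mat(1)[OF assms(1)] by (simp add: scalar_prod_def lessThan_atLeast0)
  then show ?thesis using adj_mat(2)[OF assms(1)] assms by (cases "i = j") simp_all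
qed

lemma det_diagonal: "det (mat n n (\<lambda>(k, l). if k = l then c else 0)) = (c::'a::comm_ring_1) ^ n"
proof -
  have "mat n n (\<lambda>(k, l). if k = l then c else 0) = c \<cdot>\<^sub>m 1\<^sub>m n" by (intro eq_matI) auto
  then show ?thesis by simp
qed

section \<open>Interpolation\<close>

definition is_subspace :: "'v cpoly set \<Rightarrow> bool" where
  "is_subspace W \<longleftrightarrow> 0 \<in> W \<and> (\<forall>a\<in>W. \<forall>b\<in>W. a + b \<in> W) \<and> (\<forall>c. \<forall>a\<in>W. PConst c * a \<in> W)"

lemma subspaceD:
  assumes "is_subspace W"
  shows "0 \<in> W" "a \<in> W \<Longrightarrow> b \<in> W \<Longrightarrow> a + b \<in> W" "a \<in> W \<Longrightarrow> PConst c * a \<in> W"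
  using assms by (simp_all add: is_subspace_def)

lemma subspace_diff:
  assumes W: "is_subspace W" and "a \<in> W" "b \<in> W" shows "a - b \<in> W"
proof -
  interpret comm_ring_hom "PConst :: complex \<Rightarrow> 'a cpoly" by (rule comm_ring_hom_PConst)
  have "a + PConst (- 1) * b \<in> W" by (intro subspaceD[OF W] assms)
  then show ?thesis by (simp only: hom_uminus hom_one) simp
qed

text \<open>Induction on the degree: subtracting the value at one good scalar \<open>t0\<close> and
  dividing by the linear factor keeps all other good scalars, since there the factor is an
  invertible constant.\<close>

lemma interpolation:
  fixes q :: "'v cpoly poly"
  assumes W: "is_subspace W" and inf: "infinite {t. poly q (PConst t) \<in> W}"
  shows "coeff q n \<in> W"
  using inf
proof (induction "degree q" arbitrary: q n rule: less_induct)
  case less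
  let ?S = "{t. poly q (PConst t) \<in> W}"
  obtain t0 where t0: "t0 \<in> ?S" using less.prems infinite_imp_nonempty by blast
  define q1 where "q1 = synthetic_div q (PConst t0)"
  have q: "q = [:- PConst t0, 1:] * q1 + [:poly q (PConst t0):]"
    unfolding q1_def by (rule synthetic_div_correct'[symmetric])
  show ?case
  proof (cases "degree q = 0")
    case True
    then obtain a where a: "q = [:a:]" by (rule degree_eq_zeroE)
    then have "a \<in> W" using t0 by (simp split: if_splits)
    then show ?thesis using a subspaceD(1)[OF W] by (cases n) simp_all
  next
    case False
    have "?S - {t0} \<subseteq> {t. poly q1 (PConst t) \<in> W}"
    proof
      fix t assume t: "t \<in> ?S - {t0}"
      interpret comm_ring_hom "PConst :: complex \<Rightarrow> 'v cpoly" by (rule comm_ring_hom_PConst)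
      have "poly q (PConst t) = PConst (t - t0) * poly q1 (PConst t) + poly q (PConst t0)"
        by (subst q) (simp add: hom_minus algebra_simps)
      then have "PConst (t - t0) * poly q1 (PConst t) \<in> W"
        using t t0 subspace_diff[OF W, of "poly q (PConst t)" "poly q (PConst t0)"] by simp
      then have "PConst (1 / (t - t0)) * (PConst (t - t0) * poly q1 (PConst t)) \<in> W"
        by (rule subspaceD(3)[OF W])
      moreover have "PConst (1 / (t - t0)) * PConst (t - t0) = (1 :: 'v cpoly)"
        using t by (simp add: PConst_hom(4)[symmetric] del: PConst_hom(4))
      ultimately show "t \<in> {t. poly q1 (PConst t) \<in> W}" by (simp flip: mult.assoc)
    qed
    then have "infinite {t. poly q1 (PConst t) \<in> W}"
      using less.prems by (meson finite_subset infinite_remove)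
    moreover have "degree q1 < degree q" using False by (simp add: q1_def degree_synthetic_div)
    ultimately have q1W: "coeff q1 k \<in> W" for k using less.hyps by blast
    have "coeff q n = coeff (pCons 0 q1) n - PConst t0 * coeff q1 n + coeff [:poly q (PConst t0):] n"
      by (subst q) (simp add: algebra_simps, simp add: coeff_pCons split: nat.split)
    also have "\<dots> \<in> W"
    proof (intro subspaceD(2)[OF W] subspace_diff[OF W])
      show "coeff (pCons 0 q1) n \<in> W"
        using q1W subspaceD(1)[OF W] by (cases n) simp_all
      show "coeff [:poly q (PConst t0):] n \<in> W"
        using t0 subspaceD(1)[OF W] by (cases n) simp_all
    qed (rule subspaceD(3)[OF W q1W])
    finally show ?thesis .
  qed
qed

text \<open>One variable at a time, each by \<open>interpolation\<close>. Exponents that agree on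
  \<open>S\<close> cannot be told apart by evaluation, hence the sum over them.\<close>

lemma interpolation_monomials:
  fixes f :: "('s \<Rightarrow> nat) \<Rightarrow> 'v cpoly"
  assumes W: "is_subspace W" and "finite S" "finite K"
    and "\<And>c. (\<Sum>\<alpha>\<in>K. (\<Prod>v\<in>S. PConst (c v) ^ \<alpha> v) * f \<alpha>) \<in> W"
  shows "(\<Sum>\<alpha>\<in>{\<alpha>\<in>K. \<forall>v\<in>S. \<alpha> v = \<gamma> v}. f \<alpha>) \<in> W"
  using assms(2-)
proof (induction S arbitrary: K rule: finite_induct)
  case empty
  then show ?case by simp
next
  case (insert x S)
  let ?K = "{\<alpha>\<in>K. \<alpha> x = \<gamma> x}"
  have "(\<Sum>\<alpha>\<in>?K. (\<Prod>v\<in>S. PConst (c v) ^ \<alpha> v) * f \<alpha>) \<in> W" for c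
  proof -
    define q where "q = (\<Sum>\<alpha>\<in>K. monom ((\<Prod>v\<in>S. PConst (c v) ^ \<alpha> v) * f \<alpha>) (\<alpha> x))"
    have "poly q (PConst t) \<in> W" for t
    proof -
      have "poly q (PConst t) = (\<Sum>\<alpha>\<in>K. (\<Prod>v\<in>insert x S. PConst ((c(x := t)) v) ^ \<alpha> v) * f \<alpha>)"
        unfolding q_def poly_sum poly_monom
      proof (rule sum.cong[OF refl])
        fix \<alpha>
        have "(\<Prod>v\<in>S. PConst ((c(x := t)) v) ^ \<alpha> v) = (\<Prod>v\<in>S. PConst (c v) ^ \<alpha> v :: 'v cpoly)"
          by (rule prod.cong) (use insert.hyps in auto)
        then show "(\<Prod>v\<in>S. PConst (c v) ^ \<alpha> v) * f \<alpha> * PConst t ^ \<alpha> x =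
            (\<Prod>v\<in>insert x S. PConst ((c(x := t)) v) ^ \<alpha> v) * f \<alpha>"
          using insert.hyps by (simp add: ac_simps)
      qed
      then show ?thesis using insert.prems(2)[of "c(x := t)"] by simp
    qed
    then have "coeff q (\<gamma> x) \<in> W"
      by (intro interpolation[OF W]) (simp add: infinite_UNIV_char_0)
    also have "coeff q (\<gamma> x) = (\<Sum>\<alpha>\<in>?K. (\<Prod>v\<in>S. PConst (c v) ^ \<alpha> v) * f \<alpha>)"
      unfolding q_def coeff_sum coeff_monom
      by (rule sum.mono_neutral_cong_right) (use insert.prems in auto)
    finally show ?thesis .
  qed
  then have "(\<Sum>\<alpha>\<in>{\<alpha>\<in>?K. \<forall>v\<in>S. \<alpha> v = \<gamma> v}. f \<alpha>) \<in> W"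
    using insert.IH[of ?K] insert.prems by simp
  moreover have "{\<alpha>\<in>?K. \<forall>v\<in>S. \<alpha> v = \<gamma> v} = {\<alpha>\<in>K. \<forall>v\<in>insert x S. \<alpha> v = \<gamma> v}" by auto
  ultimately show ?case by simp
qed

lemma interpolation_poly:
  fixes U :: "('s \<Rightarrow>\<^sub>0 nat) \<Rightarrow>\<^sub>0 'v cpoly"
  assumes W: "is_subspace W" and "\<And>c. gsubst (\<lambda>x. x) (\<lambda>v. PConst (c v)) U \<in> W"
  shows "Poly_Mapping.lookup U \<alpha> \<in> W"
proof (cases "\<alpha> \<in> Poly_Mapping.keys U")
  case False
  then show ?thesis using subspaceD(1)[OF W] by (simp add: in_keys_iff)
next
  case True
  let ?S = "gvars U" and ?K = "Poly_Mapping.lookup ` Poly_Mapping.keys U"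
  have inj: "inj_on Poly_Mapping.lookup (Poly_Mapping.keys U)"
    by (rule inj_onI) (rule poly_mapping_eqI, simp)
  define f where "f = (\<lambda>a. Poly_Mapping.lookup U (Abs_poly_mapping a))"
  have f: "f (Poly_Mapping.lookup \<beta>) = Poly_Mapping.lookup U \<beta>" for \<beta>
    by (simp add: f_def Poly_Mapping.lookup_inverse)
  have fin: "finite ?S" by (auto simp: gvars_def)
  have *: "(\<Sum>a\<in>{a\<in>?K. \<forall>v\<in>?S. a v = Poly_Mapping.lookup \<alpha> v}. f a) \<in> W"
  proof (rule interpolation_monomials[OF W fin])
    fix c :: "'s \<Rightarrow> complex"
    have "(\<Sum>a\<in>?K. (\<Prod>v\<in>?S. PConst (c v) ^ a v) * f a) =
        (\<Sum>\<beta>\<in>Poly_Mapping.keys U. (\<Prod>v\<in>?S. PConst (c v) ^ Poly_Mapping.lookup \<beta> v) * Poly_Mapping.lookup U \<beta>)"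
      unfolding sum.reindex[OF inj] o_def f ..
    also have "\<dots> = gsubst (\<lambda>x. x) (\<lambda>v. PConst (c v)) U"
      unfolding gsubst_def
    proof (rule sum.cong[OF refl])
      fix \<beta> assume "\<beta> \<in> Poly_Mapping.keys U"
      then have "mon_value (\<lambda>v. PConst (c v)) \<beta> =
          (\<Prod>v\<in>?S. (PConst (c v) :: 'v cpoly) ^ Poly_Mapping.lookup \<beta> v)"
        by (intro mon_value_superset[OF fin]) (auto simp: gvars_def)
      then show "(\<Prod>v\<in>?S. PConst (c v) ^ Poly_Mapping.lookup \<beta> v) * Poly_Mapping.lookup U \<beta> =
          Poly_Mapping.lookup U \<beta> * mon_value (\<lambda>v. PConst (c v)) \<beta>" by simp
    qed
    finally show "(\<Sum>a\<in>?K. (\<Prod>v\<in>?S. PConst (c v) ^ a v) * f a) \<in> W" using assms(2) by simp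
  qed simp
  have "{a\<in>?K. \<forall>v\<in>?S. a v = Poly_Mapping.lookup \<alpha> v} = {Poly_Mapping.lookup \<alpha>}"
  proof -
    have "Poly_Mapping.lookup \<beta> = Poly_Mapping.lookup \<alpha>" (is "?b = ?a")
      if b: "\<beta> \<in> Poly_Mapping.keys U" "\<forall>v\<in>?S. Poly_Mapping.lookup \<beta> v = Poly_Mapping.lookup \<alpha> v" for \<beta>
    proof
      fix v
      show "Poly_Mapping.lookup \<beta> v = Poly_Mapping.lookup \<alpha> v"
      proof (cases "v \<in> ?S")
        case False
        then have "v \<notin> Poly_Mapping.keys \<beta>" "v \<notin> Poly_Mapping.keys \<alpha>"
          using b(1) True by (auto simp: gvars_def)
        then show ?thesis by (simp add: in_keys_iff)
      qed (use b in simp)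
    qed
    then show ?thesis using True by blast
  qed
  from *[unfolded this] show ?thesis by (simp add: f)
qed

section \<open>Column substitutions\<close>

abbreviation tca_carrier :: "nat \<Rightarrow> (nat \<times> nat) cpoly set" where
  "tca_carrier d \<equiv> carrier (tca_A d)"

lemma tca_carrier_iff: "f \<in> tca_carrier d \<longleftrightarrow> gvars f \<subseteq> {..<d} \<times> UNIV"
  by (simp add: tca_A_def carrier_poly_ring poly_vars_gvars)

lemma is_subring_tca: "is_subring (tca_carrier d)"
  unfolding tca_A_def by (rule is_subring_poly)

lemma PVar_tca: "i < d \<Longrightarrow> PVar (i, j) \<in> tca_carrier d"
  by (simp add: tca_A_def carrier_poly_ring)

lemma PConst_tca: "PConst c \<in> tca_carrier d"
  by (simp add: tca_A_def carrier_poly_ring)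

text \<open>The \<open>A\<close>-span of the columns \<open>(x\<^sub>i\<^sub>k)\<^sub>i\<close> of the generic matrix.\<close>

inductive_set colspan :: "nat \<Rightarrow> (nat \<Rightarrow> (nat \<times> nat) cpoly) set" for d where
  zero: "(\<lambda>i. 0) \<in> colspan d"
| base: "(\<lambda>i. PVar (i, k)) \<in> colspan d"
| add: "w \<in> colspan d \<Longrightarrow> w' \<in> colspan d \<Longrightarrow> (\<lambda>i. w i + w' i) \<in> colspan d"
| smult: "a \<in> tca_carrier d \<Longrightarrow> w \<in> colspan d \<Longrightarrow> (\<lambda>i. a * w i) \<in> colspan d"

text \<open>These are the substitutions of x_ij by finite sums over k of s_jk x_ik with s_jk in A:
  column operations of the generic matrix, not necessarily invertible.\<close>

definition colsub :: "nat \<Rightarrow> (nat \<times> nat \<Rightarrow> (nat \<times> nat) cpoly) \<Rightarrow> bool" where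
  "colsub d \<tau> \<longleftrightarrow> (\<forall>j. (\<lambda>i. \<tau> (i, j)) \<in> colspan d)"

lemma colspan_sum: "(\<And>k. k \<in> S \<Longrightarrow> w k \<in> colspan d) \<Longrightarrow> (\<lambda>i. \<Sum>k\<in>S. w k i) \<in> colspan d"
  by (induction S rule: infinite_finite_induct) (simp_all add: colspan.zero colspan.add)

text \<open>The expression is valid for every large \<open>n\<close>, so that finitely many columns
  can share the same number of terms.\<close>

lemma colspan_explicit:
  assumes "w \<in> colspan d"
  shows "\<exists>N s. (\<forall>k. s k \<in> tca_carrier d) \<and> (\<forall>n\<ge>N. \<forall>i. w i = (\<Sum>k<n. s k * PVar (i, k)))"
  using assms
proof induction
  case zero
  then show ?case by (intro exI[of _ 0] exI[of _ "\<lambda>k. 0"]) (simp add: subring_closed[OF is_subring_tca])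
next
  case (base k)
  have "PVar (i, k) = (\<Sum>l<n. (if l = k then 1 else 0) * PVar (i, l) :: _ cpoly)" if "n \<ge> Suc k" for n and i :: nat
    using that by (subst sum.remove[of _ k]) auto
  then show ?case
    by (intro exI[of _ "Suc k"] exI[of _ "\<lambda>l. if l = k then 1 else 0"])
      (simp add: subring_closed[OF is_subring_tca])
next
  case (add w w')
  then obtain N s N' s' where *: "\<forall>k. s k \<in> tca_carrier d" "\<forall>n\<ge>N. \<forall>i. w i = (\<Sum>k<n. s k * PVar (i, k))"
    "\<forall>k. s' k \<in> tca_carrier d" "\<forall>n\<ge>N'. \<forall>i. w' i = (\<Sum>k<n. s' k * PVar (i, k))" by blast
  moreover have "w i + w' i = (\<Sum>k<n. (s k + s' k) * PVar (i, k))" if "max N N' \<le> n" for n i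
  proof -
    have "w i = (\<Sum>k<n. s k * PVar (i, k))" "w' i = (\<Sum>k<n. s' k * PVar (i, k))"
      using * that by auto
    then show ?thesis by (simp add: distrib_right sum.distrib)
  qed
  ultimately show ?case
    by (intro exI[of _ "max N N'"] exI[of _ "\<lambda>k. s k + s' k"])
      (simp add: subring_closed[OF is_subring_tca])
next
  case (smult a w)
  then obtain N s where *: "\<forall>k. s k \<in> tca_carrier d" "\<forall>n\<ge>N. \<forall>i. w i = (\<Sum>k<n. s k * PVar (i, k))" by blast
  moreover have "a * w i = (\<Sum>k<n. (a * s k) * PVar (i, k))" if "N \<le> n" for n i
  proof -
    have "w i = (\<Sum>k<n. s k * PVar (i, k))" using * that by auto
    then show ?thesis by (simp add: sum_distrib_left mult.assoc)
  qed
  ultimately show ?case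
    by (intro exI[of _ N] exI[of _ "\<lambda>k. a * s k"])
      (simp add: subring_closed[OF is_subring_tca] smult)
qed

lemma colspan_in: "w \<in> colspan d \<Longrightarrow> i < d \<Longrightarrow> w i \<in> tca_carrier d"
  by (induction rule: colspan.induct) (auto intro: subring_closed[OF is_subring_tca] PVar_tca)

lemma colsub_in: "colsub d \<tau> \<Longrightarrow> v \<in> {..<d} \<times> UNIV \<Longrightarrow> \<tau> v \<in> tca_carrier d"
  unfolding colsub_def using colspan_in by fastforce

lemma comm_ring_hom_subst: "comm_ring_hom (poly_subst PConst \<sigma>)"
  unfolding poly_subst_gsubst[abs_def] by (rule comm_ring_hom_gsubst[OF comm_ring_hom_PConst])

lemma subst_tca: "colsub d \<tau> \<Longrightarrow> f \<in> tca_carrier d \<Longrightarrow> poly_subst PConst \<tau> f \<in> tca_carrier d"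
  unfolding poly_subst_gsubst
  by (rule gsubst_in[OF is_subring_tca, OF PConst_tca colsub_in]) (auto simp: tca_carrier_iff)

lemma colspan_subst:
  assumes t: "colsub d \<tau>" and "w \<in> colspan d"
  shows "(\<lambda>i. poly_subst PConst \<tau> (w i)) \<in> colspan d"
  using assms(2)
proof induction
  case (base k)
  then show ?case using t by (simp add: poly_subst_PVar colsub_def)
next
  case (smult a w)
  then show ?case unfolding poly_subst_mult by (intro colspan.smult subst_tca[OF t])
qed (simp_all add: poly_subst_add colspan.zero colspan.add)

lemma colsub_comp: "colsub d \<tau> \<Longrightarrow> colsub d \<sigma> \<Longrightarrow> colsub d (\<lambda>v. poly_subst PConst \<tau> (\<sigma> v))"
  using colspan_subst by (simp add: colsub_def)

lemma colsub_ident: "colsub d PVar"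
  by (simp add: colsub_def colspan.base)

section \<open>Closure properties of GL-primes\<close>

definition cols :: "(nat \<times> nat) cpoly \<Rightarrow> nat set" where
  "cols f = snd ` gvars f"

lemma finite_gvars: "finite (gvars f)"
  by (auto simp: gvars_def)

lemma finite_cols: "finite (cols f)"
  by (simp add: cols_def finite_gvars)

lemma subst_ident: "poly_subst PConst PVar f = f"
  by (simp add: poly_subst_gsubst gsubst_ident)

lemma subst_cong: "(\<And>v. v \<in> gvars f \<Longrightarrow> \<sigma> v = \<tau> v) \<Longrightarrow> poly_subst PConst \<sigma> f = poly_subst PConst \<tau> f"
  unfolding poly_subst_gsubst by (rule gsubst_cong) auto

lemma GL_act_colsub: "colsub d (\<lambda>(i, j). \<Sum>k\<in>{k. g k j \<noteq> 0}. PConst (g k j) * PVar (i, k))"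
  unfolding colsub_def prod.case
  by (intro allI colspan_sum colspan.smult colspan.base PConst_tca)

text \<open>For invertible \<open>c\<close> this is the action of an element of
  \<open>GL_inf\<close>; dropping invertibility is the first extension of the stability of
  \<open>P\<close>.\<close>

definition mat_sub :: "nat \<Rightarrow> (nat \<Rightarrow> nat \<Rightarrow> complex) \<Rightarrow> nat \<times> nat \<Rightarrow> (nat \<times> nat) cpoly" where
  "mat_sub N c = (\<lambda>(i, j). if j < N then \<Sum>k<N. PConst (c k j) * PVar (i, k) else PVar (i, j))"

lemma comm_ring_hom_poly: "comm_ring_hom (\<lambda>q. poly q (a::'a::comm_ring_1))"
  by unfold_locales simp_all

lemma mon_value_monom:
  "mon_value (\<lambda>v. monom (f v) (w v)) m = monom (mon_value f m :: 'a::comm_ring_1) (mon_deg w m)"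
proof -
  have "monom a k ^ n = monom (a ^ n) (k * n)" for a :: 'a and k n
    by (induction n) (simp_all add: mult_monom one_pCons monom_0)
  moreover have "(\<Prod>v\<in>S. monom (g v) (h v)) = monom (\<Prod>v\<in>S. g v) (\<Sum>v\<in>S. h v)"
    for g :: "_ \<Rightarrow> 'a" and h and S :: "'b set"
    by (induction S rule: infinite_finite_induct) (simp_all add: mult_monom one_pCons monom_0)
  ultimately show ?thesis by (simp add: mon_value_def mon_deg_def)
qed

text \<open>The variable of the outer polynomial records the degree, so its coefficients separate
  the homogeneous components of \<open>f\<close>.\<close>

lemma coeff_gsubst_monom:
  fixes f :: "'v cpoly"
  shows "coeff (gsubst (\<lambda>c. [:PConst c:]) (\<lambda>v. monom (a * PVar v) 1) f) n = a ^ n * hom_component (\<lambda>_. 1) n f"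
proof -
  have "[:PConst c:] * mon_value (\<lambda>v. monom (a * PVar v) 1) m =
      monom (a ^ mon_deg (\<lambda>_. 1) m * Poly_Mapping.single m c) (mon_deg (\<lambda>_. 1) m)" for c m
    unfolding mon_value_monom mon_value_mult mon_deg_1 mon_value_PVar
    by (simp add: smult_monom PConst_def) (simp add: mult_single flip: mult.assoc mult.commute)
  then have "gsubst (\<lambda>c. [:PConst c:]) (\<lambda>v. monom (a * PVar v) 1) f = (\<Sum>m\<in>Poly_Mapping.keys f.
      monom (a ^ mon_deg (\<lambda>_. 1) m * Poly_Mapping.single m (Poly_Mapping.lookup f m)) (mon_deg (\<lambda>_. 1) m))"
    unfolding gsubst_def by (intro sum.cong refl)
  then have "coeff (gsubst (\<lambda>c. [:PConst c:]) (\<lambda>v. monom (a * PVar v) 1) f) n = (\<Sum>m\<in>Poly_Mapping.keys f.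
      if mon_deg (\<lambda>_. 1) m = n then a ^ mon_deg (\<lambda>_. 1) m * Poly_Mapping.single m (Poly_Mapping.lookup f m) else 0)"
    by (simp only: coeff_sum coeff_monom)
  also have "\<dots> = (\<Sum>m\<in>{m\<in>Poly_Mapping.keys f. mon_deg (\<lambda>_. 1) m = n}. a ^ n * Poly_Mapping.single m (Poly_Mapping.lookup f m))"
    by (rule sum.mono_neutral_cong_right) auto
  finally show ?thesis unfolding hom_component_def sum_distrib_left .
qed

lemma hom_component_decomp:
  assumes "\<And>m. m \<in> Poly_Mapping.keys f \<Longrightarrow> mon_deg w m \<le> N"
  shows "f = (\<Sum>n\<le>N. hom_component w n f)"
proof (rule poly_mapping_eqI)
  fix m
  show "Poly_Mapping.lookup f m = Poly_Mapping.lookup (\<Sum>n\<le>N. hom_component w n f) m"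
    using assms[of m] by (auto simp: lookup_sum lookup_hom_component in_keys_iff)
qed

lemma ex_mon_deg_bound: "\<exists>N. \<forall>m\<in>Poly_Mapping.keys f. mon_deg w m \<le> N"
  by (rule exI[of _ "Max (mon_deg w ` Poly_Mapping.keys f)"]) auto

lemma ideal_of_components:
  assumes "is_ideal C I" "\<And>n. hom_component w n f \<in> I" shows "f \<in> I"
proof -
  obtain N where "\<forall>m\<in>Poly_Mapping.keys f. mon_deg w m \<le> N" using ex_mon_deg_bound by blast
  then have "f = (\<Sum>n\<le>N. hom_component w n f)" by (intro hom_component_decomp) blast
  also have "\<dots> \<in> I" by (rule ideal_sum[OF assms])
  finally show ?thesis .
qed

locale gl_prime =
  fixes d :: nat and P :: "(nat \<times> nat) cpoly set"
  assumes gl_prime: "GL_prime d P"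
begin

lemma P_ideal: "is_ideal (tca_carrier d) P"
  using gl_prime by (simp add: GL_prime_def GL_ideal_def tca_A_def is_ideal_poly)

lemma one_notin: "1 \<notin> P"
proof
  assume "1 \<in> P"
  then have "tca_carrier d \<subseteq> P" using idealD(6)[OF P_ideal, of _ 1] by auto
  then show False using gl_prime idealD(2)[OF P_ideal] by (auto simp: GL_prime_def)
qed

lemma P_subspace: "is_subspace P"
  unfolding is_subspace_def
  using idealD(3,4)[OF P_ideal] idealD(5)[OF P_ideal PConst_tca] by simp

lemma mat_sub_nonsing:
  assumes f: "f \<in> P" and c: "det (mat N N (\<lambda>(k, j). c k j)) \<noteq> 0"
  shows "poly_subst PConst (mat_sub N c) f \<in> P"
proof -
  let ?M = "mat N N (\<lambda>(k, j). c k j)"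
  define g where "g = (\<lambda>k j. if k < N \<and> j < N then ?M $$ (k, j) else if k = j then 1 else 0)"
  have M: "?M \<in> carrier_mat N N" by simp
  have "inverts_mat ?M ((1 / det ?M) \<cdot>\<^sub>m adj_mat ?M)" "inverts_mat ((1 / det ?M) \<cdot>\<^sub>m adj_mat ?M) ?M"
    using adj_mat[OF M] c
    by (auto simp: inverts_mat_def mult_smult_distrib[OF M] mult_smult_assoc_mat[OF _ M])
  then have "invertible_mat ?M" by (auto simp: invertible_mat_def square_mat.simps)
  then have "g \<in> GL_inf" unfolding GL_inf_def g_def by (intro UN_I[of N] imageI) auto
  then have "GL_act g f \<in> P" using gl_prime f by (simp add: GL_prime_def GL_ideal_def)
  moreover have "(\<lambda>(i, j). \<Sum>k\<in>{k. g k j \<noteq> 0}. PConst (g k j) * PVar (i, k)) = mat_sub N c"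
  proof (intro ext, clarify)
    fix i j
    show "(\<Sum>k\<in>{k. g k j \<noteq> 0}. PConst (g k j) * PVar (i, k)) = mat_sub N c (i, j)"
    proof (cases "j < N")
      case True
      have "(\<Sum>k\<in>{k. g k j \<noteq> 0}. PConst (g k j) * PVar (i, k)) = (\<Sum>k<N. PConst (g k j) * PVar (i, k) :: _ cpoly)"
        by (rule sum.mono_neutral_left) (use True in \<open>auto simp: g_def split: if_splits\<close>)
      then show ?thesis using True by (simp add: mat_sub_def g_def)
    next
      case False
      then have "{k. g k j \<noteq> 0} = {j}" by (auto simp: g_def)
      then show ?thesis using False by (simp add: mat_sub_def g_def)
    qed
  qed
  ultimately show ?thesis by (simp add: GL_act_def)
qed

text \<open>The matrix \<open>\<lambda> + c\<close> is invertible for almost all scalars \<open>\<lambda>\<close>, so we can interpolate to \<open>\<lambda> = 0\<close>.\<close>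

lemma mat_sub_closed:
  assumes f: "f \<in> P"
  shows "poly_subst PConst (mat_sub N c) f \<in> P"
proof -
  define c' where "c' = (\<lambda>t k j. c k j + (if k = j then t else 0))"
  define q where "q = gsubst (\<lambda>a. [:PConst a:]) (\<lambda>(i, j). if j < N
    then [:\<Sum>k<N. PConst (c k j) * PVar (i, k), PVar (i, j):] else [:PVar (i, j):]) f"
  have q: "poly q (PConst t) = poly_subst PConst (mat_sub N (c' t)) f" for t
    unfolding q_def hom_gsubst[OF comm_ring_hom_poly] poly_subst_gsubst
  proof (rule gsubst_cong)
    fix v :: "nat \<times> nat"
    obtain i j where v: "v = (i, j)" by (cases v)
    have "(\<Sum>k<N. PConst (c' t k j) * PVar (i, k)) =
        (\<Sum>k<N. PConst (c k j) * PVar (i, k)) + (\<Sum>k<N. if k = j then PConst t * PVar (i, k) else 0 :: _ cpoly)"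
      unfolding sum.distrib[symmetric] by (rule sum.cong) (simp_all add: c'_def distrib_right)
    then show "poly ((\<lambda>(i, j). if j < N then [:\<Sum>k<N. PConst (c k j) * PVar (i, k), PVar (i, j):]
        else [:PVar (i, j):]) v) (PConst t) = mat_sub N (c' t) v"
      by (simp add: v mat_sub_def)
  qed simp
  let ?B = "mat N N (\<lambda>(k, j). - c k j)"
  have B: "?B \<in> carrier_mat N N" by simp
  let ?C = "\<lambda>t. mat N N (\<lambda>(k, j). c' t k j)"
  have "det (?C t) = 0 \<longleftrightarrow> poly (char_poly ?B) t = 0" for t
  proof -
    \<comment> \<open>The determinant of c + t is, up to sign, the characteristic polynomial of -c
      at t, so it has finitely many zeros.\<close>
    have "?C t = (- 1) \<cdot>\<^sub>m char_matrix ?B t"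
      by (intro eq_matI) (auto simp: c'_def char_matrix_def)
    then have "det (?C t) = 0 \<longleftrightarrow> det (char_matrix ?B t) = 0" by simp
    then show ?thesis using eigenvalue_det[OF B] eigenvalue_root_char_poly[OF B] by simp
  qed
  moreover have "char_poly ?B \<noteq> 0" using degree_monic_char_poly[OF B] by auto
  ultimately have "finite {t. det (?C t) = 0}" using poly_roots_finite[of "char_poly ?B"] by simp
  then have "infinite (UNIV - {t. det (?C t) = 0})"
    by (intro Diff_infinite_finite infinite_UNIV_char_0)
  moreover have "UNIV - {t. det (?C t) = 0} \<subseteq> {t. poly q (PConst t) \<in> P}"
    unfolding q using mat_sub_nonsing[OF f] by auto
  ultimately have "infinite {t. poly q (PConst t) \<in> P}" using infinite_super by blast
  then have "coeff q 0 \<in> P" by (rule interpolation[OF P_subspace])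
  moreover have "coeff q 0 = poly q (PConst 0)" by (simp add: poly_0_coeff_0)
  moreover have "c' 0 = c" by (auto simp: c'_def)
  ultimately show ?thesis using q[of 0] by simp
qed

text \<open>Let the column operation have indeterminate coefficients y_kj. Every scalar
  specialisation lies in \<open>P\<close>, so by interpolation every coefficient with respect to the
  y_kj does; the y_kj can then be specialised to arbitrary elements of A.\<close>

lemma colsub_closed:
  assumes f: "f \<in> P" and t: "colsub d \<tau>"
  shows "poly_subst PConst \<tau> f \<in> P"
proof -
  let ?Q = "\<lambda>j N s. (\<forall>k. s k \<in> tca_carrier d) \<and> (\<forall>n\<ge>N. \<forall>i. \<tau> (i, j) = (\<Sum>k<n. s k * PVar (i, k)))"
  have "\<forall>j. \<exists>N s. ?Q j N s"
    using t colspan_explicit unfolding colsub_def by blast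
  from choice[OF this] obtain N where "\<forall>j. \<exists>s. ?Q j (N j) s" ..
  from choice[OF this] obtain s where Q: "\<forall>j. ?Q j (N j) (s j)" ..
  have s: "s j k \<in> tca_carrier d" for j k using Q by simp
  have N: "\<tau> (i, j) = (\<Sum>k<n. s j k * PVar (i, k))" if "n \<ge> N j" for j n i
    using Q[rule_format, of j] that by simp
  \<comment> \<open>Large enough that \<open>mat_sub n\<close> moves every column of
    \<open>f\<close>, and that \<open>n\<close> terms suffice for each of their images.\<close>
  define n where "n = Max (insert 0 (Suc ` cols f \<union> N ` cols f))"
  have n: "j < n" "N j \<le> n" if "j \<in> cols f" for j
  proof -
    have "Suc j \<le> n" "N j \<le> n"
      unfolding n_def using that finite_cols by (auto intro!: Max_ge)
    then show "j < n" "N j \<le> n" by auto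
  qed
  define U :: "(nat \<times> nat \<Rightarrow>\<^sub>0 nat) \<Rightarrow>\<^sub>0 (nat \<times> nat) cpoly" where
    "U = gsubst (\<lambda>a. PConst (PConst a)) (\<lambda>(i, j). \<Sum>k<n. PVar (k, j) * PConst (PVar (i, k))) f"
  have hom_id: "comm_ring_hom (\<lambda>x. x :: (nat \<times> nat) cpoly)" by (rule comm_ring_hom_id)
  have ev: "gsubst (\<lambda>x. x) c U = gsubst PConst (\<lambda>(i, j). \<Sum>k<n. c (k, j) * PVar (i, k)) f" for c
  proof -
    interpret comm_ring_hom "gsubst (\<lambda>x. x) c" by (rule comm_ring_hom_gsubst[OF hom_id])
    show ?thesis
      unfolding U_def hom_gsubst[OF comm_ring_hom_axioms]
      by (rule gsubst_cong) (auto simp: hom_id hom_distribs)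
  qed
  have "gsubst (\<lambda>x. x) (\<lambda>v. PConst (c v)) U \<in> P" for c
  proof -
    have "gsubst (\<lambda>x. x) (\<lambda>v. PConst (c v)) U = poly_subst PConst (mat_sub n (\<lambda>k j. c (k, j))) f"
      unfolding ev poly_subst_gsubst
    proof (rule gsubst_cong)
      fix v assume "v \<in> gvars f"
      then have "snd v < n" by (intro n(1)) (simp add: cols_def)
      then show "(case v of (i, j) \<Rightarrow> \<Sum>k<n. PConst (c (k, j)) * PVar (i, k)) = mat_sub n (\<lambda>k j. c (k, j)) v"
        by (simp add: mat_sub_def case_prod_unfold)
    qed simp
    then show ?thesis using mat_sub_closed[OF f] by simp
  qed
  then have "Poly_Mapping.lookup U \<alpha> \<in> P" for \<alpha> by (rule interpolation_poly[OF P_subspace])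
  then have "gsubst (\<lambda>x. x) (\<lambda>(k, j). s j k) U \<in> P"
    by (intro gsubst_in_ideal[OF P_ideal]) (auto simp: s)
  also have "gsubst (\<lambda>x. x) (\<lambda>(k, j). s j k) U = poly_subst PConst \<tau> f"
    unfolding ev poly_subst_gsubst
  proof (rule gsubst_cong)
    fix v assume "v \<in> gvars f"
    then have "snd v \<in> cols f" by (simp add: cols_def)
    then have "\<tau> (fst v, snd v) = (\<Sum>k<n. s (snd v) k * PVar (fst v, k))" by (intro N n(2))
    then show "(case v of (i, j) \<Rightarrow> \<Sum>k<n. (case (k, j) of (k, j) \<Rightarrow> s j k) * PVar (i, k)) = \<tau> v"
      by (simp add: case_prod_unfold)
  qed simp
  finally show ?thesis .
qed

text \<open>Since \<open>f\<close> and \<open>g\<close> can be moved independently, \<open>f * g \<in> P\<close> implies that \<open>P\<close> contains the product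
  of the GL-ideals that they generate.\<close>

lemma disjoint_prime:
  assumes f: "f \<in> tca_carrier d" and g: "g \<in> tca_carrier d" and fg: "f * g \<in> P"
    and disj: "cols f \<inter> cols g = {}"
  shows "f \<in> P \<or> g \<in> P"
proof -
  let ?S = "poly_subst PConst"
  note sub = subring_closed[OF is_subring_tca]
  \<comment> \<open>\<open>T\<close> says that all column substitutes of two polynomials multiply
    into \<open>P\<close>. \<open>I\<close> is the annihilator of \<open>g\<close> in this sense,
    \<open>J\<close> the annihilator of \<open>I\<close>.\<close>
  define T where "T = (\<lambda>h' h. \<forall>\<sigma> \<tau>. colsub d \<sigma> \<longrightarrow> colsub d \<tau> \<longrightarrow> ?S \<sigma> h * ?S \<tau> h' \<in> P)"
  define I where "I = {h \<in> tca_carrier d. T g h}"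
  define J where "J = {h \<in> tca_carrier d. \<forall>h'\<in>I. T h h'}"
  have comm: "T h h' \<Longrightarrow> T h' h" for h h' unfolding T_def by (metis mult.commute)
  have Tc: "T h 0" "T h a \<Longrightarrow> T h b \<Longrightarrow> T h (a + b)" if "h \<in> tca_carrier d" for a b h
    using idealD(3,4)[OF P_ideal] by (auto simp: T_def poly_subst_add distrib_right)
  have Tm: "T h (a * b)" if "T h b" "a \<in> tca_carrier d" for a b h
    unfolding T_def
  proof (intro allI impI)
    fix \<sigma> \<tau> assume "colsub d \<sigma>" "colsub d \<tau>"
    moreover from this have "?S \<sigma> b * ?S \<tau> h \<in> P" using that(1) by (simp add: T_def)
    moreover from \<open>colsub d \<sigma>\<close> that(2) have "?S \<sigma> a \<in> tca_carrier d" by (rule subst_tca)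
    ultimately have "?S \<sigma> a * (?S \<sigma> b * ?S \<tau> h) \<in> P"
      using idealD(5)[OF P_ideal] by blast
    then show "?S \<sigma> (a * b) * ?S \<tau> h \<in> P" by (simp add: poly_subst_mult mult.assoc)
  qed
  have Tg: "T h (GL_act x a)" if "T h a" for x a h
    using that colsub_comp[OF _ GL_act_colsub] unfolding T_def GL_act_def poly_subst_subst by blast
  have ideal: "GL_ideal d {h \<in> tca_carrier d. \<forall>h'\<in>H. T h' h}" if H: "H \<subseteq> tca_carrier d" for H
    unfolding GL_ideal_def tca_A_def is_ideal_poly unfolding tca_A_def[symmetric] is_ideal_def
  proof (intro conjI ballI)
    show "is_subring (tca_carrier d)" by (rule is_subring_tca)
    show "{h \<in> tca_carrier d. \<forall>h'\<in>H. T h' h} \<subseteq> tca_carrier d" by blast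
    show "0 \<in> {h \<in> tca_carrier d. \<forall>h'\<in>H. T h' h}" using Tc(1) H sub(1) by blast
  next
    fix a b assume "a \<in> {h \<in> tca_carrier d. \<forall>h'\<in>H. T h' h}" "b \<in> {h \<in> tca_carrier d. \<forall>h'\<in>H. T h' h}"
    then show "a + b \<in> {h \<in> tca_carrier d. \<forall>h'\<in>H. T h' h}" using Tc(2) H sub(4) by blast
  next
    fix a b assume "a \<in> tca_carrier d" "b \<in> {h \<in> tca_carrier d. \<forall>h'\<in>H. T h' h}"
    then show "a * b \<in> {h \<in> tca_carrier d. \<forall>h'\<in>H. T h' h}" using Tm sub(5) by blast
  next
    fix g a assume "g \<in> GL_inf" "a \<in> {h \<in> tca_carrier d. \<forall>h'\<in>H. T h' h}"
    then show "GL_act g a \<in> {h \<in> tca_carrier d. \<forall>h'\<in>H. T h' h}" using Tg GL_act_closed by blast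
  qed
  have I: "GL_ideal d I" using ideal[of "{g}"] g by (simp add: I_def)
  have "J = {h \<in> tca_carrier d. \<forall>h'\<in>I. T h' h}" unfolding J_def using comm by blast
  then have J: "GL_ideal d J" using ideal[of I] by (auto simp: I_def)
  have "ideal_prod (tca_A d) I J \<subseteq> P"
  proof
    fix x assume "x \<in> ideal_prod (tca_A d) I J"
    then show "x \<in> P"
    proof induction
      case (prod i j)
      then have "?S PVar i * ?S PVar j \<in> P" using colsub_ident by (auto simp: J_def T_def)
      then show ?case by (simp add: subst_ident tca_A_def)
    qed (use idealD(4)[OF P_ideal] in \<open>simp add: tca_A_def\<close>)
  qed
  then have "I \<subseteq> P \<or> J \<subseteq> P" using gl_prime I J unfolding GL_prime_def by blast
  moreover have "f \<in> I"
    unfolding I_def T_def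
  proof (intro CollectI conjI allI impI f)
    fix \<sigma> \<tau> assume st: "colsub d \<sigma>" "colsub d \<tau>"
    \<comment> \<open>Disjointness of the columns allows one substitution to act as
      \<open>\<sigma>\<close> on \<open>f\<close> and as \<open>\<tau>\<close> on
      \<open>g\<close>.\<close>
    define \<rho> where "\<rho> = (\<lambda>v. if snd v \<in> cols f then \<sigma> v else \<tau> v)"
    have "colsub d \<rho>"
      unfolding colsub_def
    proof
      fix j
      show "(\<lambda>i. \<rho> (i, j)) \<in> colspan d"
        using st by (cases "j \<in> cols f") (simp_all add: colsub_def \<rho>_def)
    qed
    then have "?S \<rho> (f * g) \<in> P" by (rule colsub_closed[OF fg])
    moreover have "?S \<rho> f = ?S \<sigma> f" by (rule subst_cong) (auto simp: \<rho>_def cols_def)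
    moreover have "?S \<rho> g = ?S \<tau> g"
      by (rule subst_cong) (use disj in \<open>auto simp: \<rho>_def cols_def\<close>)
    ultimately show "?S \<sigma> f * ?S \<tau> g \<in> P" by (simp add: poly_subst_mult)
  qed
  moreover have "g \<in> J" using g by (simp add: J_def I_def)
  ultimately show ?thesis by blast
qed

text \<open>Scaling only the columns of \<open>f\<close> by a scalar t leaves \<open>a\<close> fixed
  and multiplies the component of degree n by the n-th power of t, so interpolation isolates the
  components.\<close>

lemma scaled_components:
  assumes disj: "cols a \<inter> cols f = {}"
    and f: "a ^ k * poly_subst PConst (\<lambda>v. a * PVar v) f \<in> P"
  shows "a ^ (k + n) * hom_component (\<lambda>_. 1) n f \<in> P"
proof -
  let ?g = "gsubst (\<lambda>c. [:PConst c:]) (\<lambda>v. monom (a * PVar v) 1) f"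
  let ?q = "smult (a ^ k) ?g"
  have "poly ?q (PConst t) \<in> P" for t
  proof -
    define \<tau> where "\<tau> = (\<lambda>v. if snd v \<in> cols f then PConst t * PVar v else PVar v :: (nat \<times> nat) cpoly)"
    have "colsub d \<tau>"
      unfolding colsub_def
    proof
      fix j
      have "(\<lambda>i. \<tau> (i, j)) = (if j \<in> cols f then (\<lambda>i. PConst t * PVar (i, j)) else (\<lambda>i. PVar (i, j)))"
        by (auto simp: \<tau>_def)
      then show "(\<lambda>i. \<tau> (i, j)) \<in> colspan d" by (simp add: colspan.intros PConst_tca)
    qed
    then have "poly_subst PConst \<tau> (a ^ k * poly_subst PConst (\<lambda>v. a * PVar v) f) \<in> P"
      by (rule colsub_closed[OF f])
    moreover have \<tau>a: "poly_subst PConst \<tau> a = a"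
    proof -
      have "poly_subst PConst \<tau> a = poly_subst PConst PVar a"
        by (rule subst_cong) (use disj in \<open>auto simp: \<tau>_def cols_def\<close>)
      then show ?thesis by (simp add: subst_ident)
    qed
    then have "poly_subst PConst \<tau> (poly_subst PConst (\<lambda>v. a * PVar v) f) = poly ?g (PConst t)"
      unfolding poly_subst_subst hom_gsubst[OF comm_ring_hom_poly] unfolding poly_subst_gsubst[of PConst _ f]
      by (intro gsubst_cong)
        (auto simp: poly_subst_mult poly_subst_PVar \<tau>_def cols_def poly_monom ac_simps)
    ultimately show ?thesis unfolding poly_subst_mult poly_subst_power \<tau>a by simp
  qed
  then have "coeff ?q n \<in> P"
    by (intro interpolation[OF P_subspace]) (simp add: infinite_UNIV_char_0)
  then show ?thesis unfolding coeff_smult coeff_gsubst_monom by (simp add: power_add mult.assoc)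
qed

text \<open>Removes the denominators that Cramer's rule introduces: after splitting into components,
  the power of \<open>a\<close> and the component are in disjoint columns.\<close>

lemma cancel_scale:
  assumes a: "a \<in> tca_carrier d" "\<And>n. a ^ n \<notin> P" and disj: "cols a \<inter> cols f = {}"
    and f: "f \<in> tca_carrier d" "a ^ k * poly_subst PConst (\<lambda>v. a * PVar v) f \<in> P"
  shows "f \<in> P"
proof (rule ideal_of_components[OF P_ideal])
  fix n
  let ?h = "hom_component (\<lambda>_. 1) n f"
  have "cols (a ^ (k + n)) \<subseteq> cols a"
    using poly_vars_power[of a "k + n"] unfolding cols_def poly_vars_gvars by (rule image_mono)
  moreover have "Poly_Mapping.keys ?h \<subseteq> Poly_Mapping.keys f"
    by (rule subsetI) (simp add: in_keys_iff lookup_hom_component split: if_splits)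
  then have "gvars ?h \<subseteq> gvars f" unfolding gvars_def by blast
  then have "cols ?h \<subseteq> cols f" unfolding cols_def by (rule image_mono)
  ultimately have "cols (a ^ (k + n)) \<inter> cols ?h = {}" using disj by blast
  moreover have "?h \<in> tca_carrier d"
    using f(1) unfolding tca_A_def by (rule hom_component_closed)
  ultimately have "a ^ (k + n) \<in> P \<or> ?h \<in> P"
    by (intro disjoint_prime subring_power[OF is_subring_tca a(1)] scaled_components[OF disj f(2)])
  then show "?h \<in> P" using a(2) by simp
qed

end

section \<open>Minors of the generic matrix\<close>

text \<open>The minor of (x_ij) with rows \<open>T\<close> and columns \<open>J\<close>. It is
  transposed with respect to \<open>dt\<close>, so that \<open>T\<close> is the list on which
  Pluecker exchanges act.\<close>

definition Delta :: "nat list \<Rightarrow> nat list \<Rightarrow> (nat \<times> nat) cpoly" where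
  "Delta T J = dt (\<lambda>k i. PVar (i, J ! k)) T"

lemma Delta_transpose:
  assumes "length T = length J" shows "Delta T J = dt (\<lambda>l j. PVar (T ! l, j)) J"
proof -
  let ?A = "mat (length T) (length T) (\<lambda>(k, l). PVar (T ! l, J ! k) :: (nat \<times> nat) cpoly)"
  have "transpose_mat ?A = mat (length J) (length J) (\<lambda>(k, l). PVar (T ! k, J ! l))"
    using assms by (intro eq_matI) auto
  then show ?thesis
    unfolding Delta_def dt_def using det_transpose[of ?A "length T"] by simp
qed

lemma Delta_subst: "poly_subst PConst \<tau> (Delta T J) = dt (\<lambda>k i. \<tau> (i, J ! k)) T"
  unfolding Delta_def hom_dt[OF comm_ring_hom_subst] by (simp add: poly_subst_PVar)

lemma Delta_rename:
  "length T = length J \<Longrightarrow> poly_subst PConst (\<lambda>(i, j). PVar (i, \<pi> j)) (Delta T J) = Delta T (map \<pi> J)"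
  unfolding Delta_subst unfolding Delta_def by (rule dt_cong) simp

lemma dt_in:
  assumes "is_subring C" "\<And>k l. k < length L \<Longrightarrow> l < length L \<Longrightarrow> a k (L ! l) \<in> C"
  shows "dt a L \<in> C"
  unfolding dt_def by (rule subring_det[OF assms(1)]) (use assms(2) in auto)

lemma Delta_tca: "set T \<subseteq> {..<d} \<Longrightarrow> Delta T J \<in> tca_carrier d"
  unfolding Delta_def by (intro dt_in is_subring_tca PVar_tca) (use nth_mem in fastforce)

lemma cols_Delta: "length T = length J \<Longrightarrow> cols (Delta T J) \<subseteq> set J"
proof -
  assume "length T = length J"
  then have "Delta T J \<in> carrier (poly_ring (UNIV \<times> set J))"
    unfolding Delta_def by (intro dt_in is_subring_poly) (simp add: carrier_poly_ring)
  then show ?thesis by (auto simp: cols_def carrier_poly_ring poly_vars_gvars)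
qed

lemma Delta_snoc:
  assumes "length J = length L"
  shows "Delta L J * PVar (i, j) - (\<Sum>k<length L. Delta (L[k := i]) J * PVar (L ! k, j)) =
    Delta (L @ [i]) (J @ [j])"
proof -
  have "dt (\<lambda>k i. PVar (i, (J @ [j]) ! k) :: _ cpoly) L' = Delta L' J" if "length L' = length J" for L'
    unfolding Delta_def by (rule dt_cong) (use that in \<open>auto simp: nth_append\<close>)
  then show ?thesis
    unfolding Delta_def[of "L @ [i]"] dt_snoc using assms by (simp add: ac_simps nth_append)
qed

lemma dt_col_add:
  fixes a :: "nat \<Rightarrow> 'i \<Rightarrow> 'a::comm_ring_1"
  assumes k: "k < length J" and e: "J ! k = e" "\<And>l. l < length J \<Longrightarrow> l \<noteq> k \<Longrightarrow> J ! l \<noteq> e"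
  shows "dt (\<lambda>l j. if j = e then a l e + t * a l c else a l j) J = dt a J + t * dt a (J[k := c])"
proof -
  \<comment> \<open>\<open>None\<close> is a formal extra column, the sum of the two, so that
    linearity in one list entry applies.\<close>
  define b where "b = (\<lambda>l j. case j of None \<Rightarrow> a l e + t * a l c | Some j \<Rightarrow> a l j)"
  let ?J = "map Some J"
  obtain cf where cf: "\<And>i. dt b (?J[k := i]) = (\<Sum>m<length J. b m i * cf m)"
    using dt_update_linear[of k ?J b] k by auto
  have Some: "dt b (map Some L) = dt a L" for L
    by (simp add: dt_map b_def)
  have "dt (\<lambda>l j. if j = e then a l e + t * a l c else a l j) J = dt b (?J[k := None])"
    unfolding dt_def
    by (intro arg_cong[where f = det] eq_matI) (use k e in \<open>auto simp: b_def nth_list_update\<close>)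
  also have "\<dots> = dt b (?J[k := Some e]) + t * dt b (?J[k := Some c])"
    unfolding cf by (simp add: b_def sum.distrib sum_distrib_left algebra_simps)
  also have "\<dots> = dt a J + t * dt a (J[k := c])"
    using e(1) by (simp add: Some flip: map_update) (simp add: list_update_same_conv[OF k, THEN iffD2])
  finally show ?thesis .
qed

lemma coeff_linear_power:
  "coeff ([:a, b:] ^ m) 0 = (a::'a::comm_ring_1) ^ m" "coeff ([:a, b:] ^ m) 1 = of_nat m * a ^ (m - 1) * b"
proof -
  show 0: "coeff ([:a, b:] ^ m) 0 = a ^ m" for m by (induction m) simp_all
  show "coeff ([:a, b:] ^ m) 1 = of_nat m * a ^ (m - 1) * b"
  proof (induction m)
    case (Suc m)
    show ?case using Suc 0[of m] by (cases m) (simp_all add: algebra_simps)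
  qed simp
qed

context gl_prime
begin

text \<open>Renaming columns is a column substitution, well defined as \<open>J'\<close> has no
  repetitions.\<close>

lemma Delta_cols:
  assumes "length L = length J" "length J' = length J" "distinct J'" "Delta L J \<notin> P"
  shows "Delta L J' \<notin> P"
proof
  assume "Delta L J' \<in> P"
  define \<rho> where "\<rho> = (\<lambda>j. the (map_of (zip J' J) j))"
  have "map \<rho> J' = J"
    by (rule nth_equalityI) (use assms in \<open>auto simp: \<rho>_def map_of_zip_nth\<close>)
  moreover have "colsub d (\<lambda>(i, j). PVar (i, \<rho> j))"
    by (simp add: colsub_def colspan.base)
  from colsub_closed[OF \<open>Delta L J' \<in> P\<close> this] have "Delta L (map \<rho> J') \<in> P"
    using Delta_rename[of L J' \<rho>] assms by simp
  ultimately show False using assms by simp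
qed

text \<open>Polarising \<open>\<phi>\<^sup>m \<psi>\<close> along the column \<open>J ! k\<close> and using that \<open>\<phi> \<psi>\<close> is a sum of products of minors with exchanged
  columns produces \<open>(m + k + 1) \<phi>\<^sup>m \<psi>'\<close>, where \<open>\<psi>'\<close> has one column of \<open>\<phi>\<close> fewer than \<open>\<psi>\<close>.\<close>

lemma Delta_power_step:
  assumes L: "set L \<subseteq> {..<d}" "length L = length J" and J: "distinct J" and k: "k < length J"
    and IH: "\<And>c. length c = length J \<Longrightarrow> (\<And>p. p < k \<Longrightarrow> c ! p \<notin> set J) \<Longrightarrow>
      (\<And>p. k \<le> p \<Longrightarrow> p < length J \<Longrightarrow> c ! p = J ! p) \<Longrightarrow> Delta L J ^ m * Delta L c \<in> P"
    and c: "length c = length J" "\<And>p. p < Suc k \<Longrightarrow> c ! p \<notin> set J"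
      "\<And>p. Suc k \<le> p \<Longrightarrow> p < length J \<Longrightarrow> c ! p = J ! p"
  shows "Delta L J ^ m * Delta L c \<in> P"
proof -
  define e where "e = J ! k"
  define D where "D = (\<lambda>c. dt (\<lambda>l j. PVar (L ! l, j) :: (nat \<times> nat) cpoly) c)"
  have D: "Delta L c = D c" if "length c = length J" for c
    unfolding D_def using L that by (intro Delta_transpose) simp
  have DA: "D c \<in> tca_carrier d" if "length c = length J" for c
    using Delta_tca[OF L(1)] D[OF that] by metis
  let ?\<phi> = "D J" and ?\<psi> = "D c"
  \<comment> \<open>Since \<open>J[k := e]\<close> is \<open>J\<close>, the exchange relation swaps
    the column \<open>e\<close> of the first minor with one column of \<open>c\<close> at a
    time.\<close>
  have exch: "D c * D J = (\<Sum>b<length J. D (J[k := c ! b]) * D (c[b := e]))"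
    using dt_exchange[of J c k _ e] k c(1) unfolding D_def e_def by simp
  \<comment> \<open>Beyond position \<open>k\<close> the lists \<open>c\<close> and \<open>J\<close>
    agree, so inserting \<open>c ! b\<close> into \<open>J\<close> repeats a column.\<close>
  have zero: "D (J[k := c ! b]) = 0" if "b \<in> {..<length J} - {..k}" for b
  proof -
    have "J[k := c ! b] ! b = J[k := c ! b] ! k" "b \<noteq> k" "b < length J"
      using that k c(3)[of b] by auto
    then have "\<not> distinct (J[k := c ! b])"
      using k by (metis length_list_update nth_eq_iff_index_eq)
    then show ?thesis unfolding D_def by (rule dt_repeated_entry)
  qed
  have "D c * D J = (\<Sum>b\<le>k. D (J[k := c ! b]) * D (c[b := e]))"
    unfolding exch by (rule sum.mono_neutral_right) (use k zero in auto)
  then have exch': "(\<Sum>b\<le>k. D (J[k := c ! b]) * D (c[b := e])) = ?\<phi> * ?\<psi>" by (simp add: mult.commute)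
  \<comment> \<open>This is the coefficient of t after replacing x_ie by x_ie + t x_ij, with j =
    \<open>c ! b\<close>, in \<open>?\<phi> ^ m * D (c[b := e])\<close>.\<close>
  have step: "of_nat m * ?\<phi> ^ (m - 1) * D (J[k := c ! b]) * D (c[b := e]) + ?\<phi> ^ m * ?\<psi> \<in> P" if b: "b \<le> k" for b
  proof -
    \<comment> \<open>The induction hypothesis wants \<open>e\<close> at position \<open>k\<close>,
      where \<open>J\<close> has it; for smaller \<open>b\<close> a transposition brings it there at
      the cost of a sign.\<close>
    have mem: "?\<phi> ^ m * D (c[b := e]) \<in> P"
    proof (cases "b = k")
      case True
      have "Delta L J ^ m * Delta L (c[b := e]) \<in> P"
        by (rule IH) (use True c k in \<open>auto simp: nth_list_update e_def\<close>)
      then show ?thesis using c by (simp add: D)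
    next
      case False
      let ?c = "c[b := e]"
      let ?c' = "?c[b := ?c ! k, k := ?c ! b]"
      have "D ?c' = - D ?c"
        unfolding D_def by (rule dt_swap) (use b False k c in auto)
      moreover have "Delta L J ^ m * Delta L ?c' \<in> P"
        by (rule IH) (use b False c k in \<open>auto simp: nth_list_update e_def\<close>)
      ultimately show ?thesis
        using idealD(7)[OF P_ideal] c by (fastforce simp: D)
    qed
    define q where "q = [:?\<phi>, D (J[k := c ! b]):] ^ m * [:D (c[b := e]), ?\<psi>:]"
    have "poly q (PConst t) \<in> P" for t
    proof -
      define \<tau> where "\<tau> = (\<lambda>(i, j). if j = e then PVar (i, e) + PConst t * PVar (i, c ! b) else PVar (i, j) :: (nat \<times> nat) cpoly)"
      have "colsub d \<tau>"
        unfolding colsub_def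
      proof
        fix j
        have "(\<lambda>i. \<tau> (i, j)) = (if j = e then (\<lambda>i. PVar (i, e) + PConst t * PVar (i, c ! b)) else (\<lambda>i. PVar (i, j)))"
          by (auto simp: \<tau>_def)
        then show "(\<lambda>i. \<tau> (i, j)) \<in> colspan d"
          by (simp add: colspan.add colspan.smult colspan.base PConst_tca)
      qed
      then have *: "poly_subst PConst \<tau> (?\<phi> ^ m * D (c[b := e])) \<in> P" by (rule colsub_closed[OF mem])
      have subst: "poly_subst PConst \<tau> (D c') = D c' + PConst t * D (c'[k' := c ! b])"
        if "length c' = length J" "k' < length J" "c' ! k' = e" "\<And>l. l < length J \<Longrightarrow> l \<noteq> k' \<Longrightarrow> c' ! l \<noteq> e" for c' k'
      proof -
        have "poly_subst PConst \<tau> (D c') = dt (\<lambda>l j. \<tau> (L ! l, j)) c'"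
          unfolding D_def hom_dt[OF comm_ring_hom_subst] by (simp add: poly_subst_PVar)
        also have "\<dots> = D c' + PConst t * D (c'[k' := c ! b])"
          unfolding D_def \<tau>_def prod.case by (rule dt_col_add) (use that in auto)
        finally show ?thesis .
      qed
      have "poly_subst PConst \<tau> ?\<phi> = ?\<phi> + PConst t * D (J[k := c ! b])"
        by (rule subst) (use k J in \<open>auto simp: e_def nth_eq_iff_index_eq\<close>)
      moreover have "poly_subst PConst \<tau> (D (c[b := e])) = D (c[b := e]) + PConst t * ?\<psi>"
      proof -
        have other: "c[b := e] ! l \<noteq> e" if "l < length J" "l \<noteq> b" for l
        proof (cases "l \<le> k")
          case True
          then show ?thesis using c(2)[of l] that k by (auto simp: e_def)
        next
          case False
          then show ?thesis using c(1) c(3)[of l] that k J by (auto simp: e_def nth_eq_iff_index_eq)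
        qed
        have "poly_subst PConst \<tau> (D (c[b := e])) = D (c[b := e]) + PConst t * D ((c[b := e])[b := c ! b])"
          by (rule subst) (use b k c other in auto)
        then show ?thesis by simp
      qed
      ultimately have "poly_subst PConst \<tau> (?\<phi> ^ m * D (c[b := e])) = poly q (PConst t)"
        unfolding q_def poly_subst_mult poly_subst_power by (simp add: poly_mult poly_power algebra_simps)
      then show ?thesis using * by simp
    qed
    then have "coeff q 1 \<in> P"
      by (intro interpolation[OF P_subspace]) (simp add: infinite_UNIV_char_0)
    moreover have "coeff q 1 = of_nat m * ?\<phi> ^ (m - 1) * D (J[k := c ! b]) * D (c[b := e]) + ?\<phi> ^ m * ?\<psi>"
      unfolding q_def using coeff_linear_power[of ?\<phi> _ m] by (simp add: coeff_mult)
    ultimately show ?thesis by simp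
  qed
  \<comment> \<open>By \<open>exch'\<close> the mixed terms add up to m times the wanted product,
    and each of the k + 1 values of \<open>b\<close> contributes one more copy.\<close>
  have "(\<Sum>b\<le>k. of_nat m * ?\<phi> ^ (m - 1) * D (J[k := c ! b]) * D (c[b := e]) + ?\<phi> ^ m * ?\<psi>) \<in> P"
    by (rule ideal_sum[OF P_ideal]) (use step in auto)
  also have "(\<Sum>b\<le>k. of_nat m * ?\<phi> ^ (m - 1) * D (J[k := c ! b]) * D (c[b := e]) + ?\<phi> ^ m * ?\<psi>) =
      of_nat m * ?\<phi> ^ (m - 1) * (\<Sum>b\<le>k. D (J[k := c ! b]) * D (c[b := e])) + of_nat (Suc k) * (?\<phi> ^ m * ?\<psi>)"
    by (simp add: sum.distrib sum_distrib_left mult.assoc)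
  also have "\<dots> = of_nat (m + Suc k) * (?\<phi> ^ m * ?\<psi>)"
    unfolding exch' by (cases m) (simp_all add: algebra_simps)
  also have "of_nat (m + Suc k) = (PConst (of_nat (m + Suc k)) :: (nat \<times> nat) cpoly)"
    by (metis PConst_def single_of_nat)
  \<comment> \<open>Characteristic zero enters here: m + k + 1 is invertible.\<close>
  finally have "PConst (1 / of_nat (m + Suc k)) * (PConst (of_nat (m + Suc k)) * (?\<phi> ^ m * ?\<psi>)) \<in> P"
    by (rule subspaceD(3)[OF P_subspace])
  moreover have "PConst (1 / of_nat (m + Suc k)) * PConst (of_nat (m + Suc k)) = (1 :: (nat \<times> nat) cpoly)"
    unfolding PConst_hom(4)[symmetric] by (simp del: of_nat_Suc of_nat_add)
  ultimately show ?thesis using c(1) by (simp add: D flip: mult.assoc)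
qed

text \<open>Suppose the power m + 1 is in \<open>P\<close>. \<open>Delta_power_step\<close> replaces
  the columns of one factor one by one until they are disjoint from \<open>J\<close>; then
  \<open>disjoint_prime\<close> splits that factor off, it is outside \<open>P\<close> by renaming,
  and the power m would be in \<open>P\<close>.\<close>

lemma Delta_power_notin:
  assumes L: "set L \<subseteq> {..<d}" "length L = length J" and J: "distinct J" and nz: "Delta L J \<notin> P"
  shows "Delta L J ^ n \<notin> P"
proof (induction n)
  case 0
  then show ?case using one_notin by simp
next
  case (Suc m)
  show ?case
  proof
    assume power: "Delta L J ^ Suc m \<in> P"
    have step: "Delta L J ^ m * Delta L c \<in> P"
      if "k \<le> length J" "length c = length J" "\<And>p. p < k \<Longrightarrow> c ! p \<notin> set J"
        "\<And>p. k \<le> p \<Longrightarrow> p < length J \<Longrightarrow> c ! p = J ! p" for k c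
      using that
    proof (induction k arbitrary: c)
      case 0
      then have "c = J" by (intro nth_equalityI) auto
      then show ?case using power by (simp add: mult.commute)
    next
      case (Suc k)
      show ?case
        by (rule Delta_power_step[OF L J, of k]) (use Suc in auto)
    qed
    define N where "N = Suc (Max (insert 0 (set J)))"
    define c where "c = [N..<N + length J]"
    have fresh: "j < N" if "j \<in> set J" for j
      using that by (simp add: N_def less_Suc_eq_le)
    have disj: "set c \<inter> set J = {}" using fresh by (fastforce simp: c_def)
    have "Delta L J ^ m * Delta L c \<in> P"
    proof (rule step[of "length J"])
      show "c ! p \<notin> set J" if "p < length J" for p
        using fresh[of "c ! p"] that by (auto simp: c_def)
    qed (auto simp: c_def)
    moreover have "cols (Delta L J ^ m) \<inter> cols (Delta L c) = {}"
    proof -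
      have "cols (Delta L J ^ m) \<subseteq> cols (Delta L J)"
        using poly_vars_power[of "Delta L J" m] by (auto simp: cols_def poly_vars_gvars)
      then show ?thesis
        using disj cols_Delta[of L J] cols_Delta[of L c] L by (auto simp: c_def)
    qed
    ultimately have "Delta L J ^ m \<in> P \<or> Delta L c \<in> P"
      by (intro disjoint_prime subring_power[OF is_subring_tca] Delta_tca[OF L(1)])
    moreover have "Delta L c \<notin> P"
      by (rule Delta_cols[OF L(2) _ _ nz]) (simp_all add: c_def)
    ultimately show False using Suc.IH by simp
  qed
qed

end

section \<open>Gradings\<close>

definition homdeg :: "('v \<Rightarrow> nat) \<Rightarrow> nat \<Rightarrow> 'v cpoly \<Rightarrow> bool" where
  "homdeg w n f \<longleftrightarrow> (\<forall>m\<in>Poly_Mapping.keys f. mon_deg w m = n)"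

lemma homogeneous_homdeg: "homogeneous w f \<longleftrightarrow> (\<exists>n. homdeg w n f)"
  by (simp add: homogeneous_def homdeg_def)

lemma homdeg_lookup: "homdeg w n f \<longleftrightarrow> (\<forall>m. Poly_Mapping.lookup f m \<noteq> 0 \<longrightarrow> mon_deg w m = n)"
  by (auto simp: homdeg_def in_keys_iff)

lemma hom_component_homdeg: "homdeg w n f \<Longrightarrow> hom_component w k f = (if k = n then f else 0)"
  by (rule poly_mapping_eqI) (auto simp: lookup_hom_component homdeg_lookup)

lemma homdeg_hom_component: "homdeg w n (hom_component w n f)"
  by (auto simp: homdeg_lookup lookup_hom_component split: if_splits)

lemma homdeg_zero: "homdeg w n 0"
  by (simp add: homdeg_def)

lemma homdeg_one: "homdeg w 0 1"
  by (simp add: homdeg_def mon_deg_def)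

lemma homdeg_PConst: "homdeg w 0 (PConst c)"
  by (simp add: homdeg_def mon_deg_def PConst_def)

lemma homdeg_PVar: "homdeg w (w v) (PVar v)"
  by (simp add: homdeg_def mon_deg_def PVar_def)

lemma homdeg_add: "homdeg w n f \<Longrightarrow> homdeg w n g \<Longrightarrow> homdeg w n (f + g)"
  using Poly_Mapping.keys_add[of f g] by (auto simp: homdeg_def)

lemma homdeg_uminus: "homdeg w n f \<Longrightarrow> homdeg w n (- f)"
  by (simp add: homdeg_def)

lemma homdeg_diff: "homdeg w n f \<Longrightarrow> homdeg w n g \<Longrightarrow> homdeg w n (f - g)"
  using homdeg_add[of w n f "- g"] homdeg_uminus by auto

lemma homdeg_mult: "homdeg w n f \<Longrightarrow> homdeg w k g \<Longrightarrow> homdeg w (n + k) (f * g)"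
  using keys_mult[of f g] by (fastforce simp: homdeg_def mon_deg_add)

lemma homdeg_sum: "(\<And>x. x \<in> S \<Longrightarrow> homdeg w n (f x)) \<Longrightarrow> homdeg w n (sum f S)"
  by (induction S rule: infinite_finite_induct) (auto intro: homdeg_zero homdeg_add)

lemma homdeg_prod: "(\<And>x. x \<in> S \<Longrightarrow> homdeg w k (f x)) \<Longrightarrow> homdeg w (card S * k) (prod f S)"
  by (induction S rule: infinite_finite_induct) (auto intro: homdeg_one homdeg_mult)

lemma homdeg_power: "homdeg w k f \<Longrightarrow> homdeg w (n * k) (f ^ n)"
  by (induction n) (auto intro: homdeg_one homdeg_mult)

lemma homdeg_det:
  assumes "A \<in> carrier_mat n n" "\<And>i j. i < n \<Longrightarrow> j < n \<Longrightarrow> homdeg w 1 (A $$ (i, j))"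
  shows "homdeg w n (det A)"
  unfolding det_def'[OF assms(1)]
proof (rule homdeg_sum)
  fix \<pi> assume p: "\<pi> \<in> {\<pi>. \<pi> permutes {0..<n}}"
  have "homdeg w (card {0..<n} * 1) (\<Prod>i = 0..<n. A $$ (i, \<pi> i))"
    using assms(2) p permutes_in_image[of \<pi> "{0..<n}"] by (intro homdeg_prod) auto
  then have "homdeg w (0 + n) (signof \<pi> * (\<Prod>i = 0..<n. A $$ (i, \<pi> i)))"
    using homdeg_one[of w] homdeg_uminus[OF homdeg_one[of w]]
    by (intro homdeg_mult) (cases rule: sign_cases[of \<pi>], auto)
  then show "homdeg w n (signof \<pi> * (\<Prod>i = 0..<n. A $$ (i, \<pi> i)))" by simp
qed

lemma hom_component_mult:
  "hom_component w n (f * g) = (\<Sum>i\<le>n. hom_component w i f * hom_component w (n - i) g)"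
proof -
  let ?s = "\<lambda>f m. Poly_Mapping.single m (Poly_Mapping.lookup f m)"
  have single: "hom_component w n (?s f a * ?s g b) =
      (\<Sum>i\<le>n. hom_component w i (?s f a) * hom_component w (n - i) (?s g b))" for a b
  proof -
    have "(\<Sum>i\<le>n. hom_component w i (?s f a) * hom_component w (n - i) (?s g b)) =
        (\<Sum>i\<le>n. if i = mon_deg w a then (if mon_deg w a + mon_deg w b = n then ?s f a * ?s g b else 0) else 0)"
      by (rule sum.cong) (auto simp: hom_component_single)
    then show ?thesis by (auto simp: mult_single hom_component_single mon_deg_add)
  qed
  have "hom_component w n (f * g) = hom_component w n
      ((\<Sum>a\<in>Poly_Mapping.keys f. ?s f a) * (\<Sum>b\<in>Poly_Mapping.keys g. ?s g b))"
    by (simp flip: gpoly_sum_single)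
  also have "\<dots> = (\<Sum>a\<in>Poly_Mapping.keys f. \<Sum>b\<in>Poly_Mapping.keys g. \<Sum>i\<le>n.
      hom_component w i (?s f a) * hom_component w (n - i) (?s g b))"
    unfolding sum_product hom_component_sum single ..
  also have "\<dots> = (\<Sum>i\<le>n. \<Sum>a\<in>Poly_Mapping.keys f. \<Sum>b\<in>Poly_Mapping.keys g.
      hom_component w i (?s f a) * hom_component w (n - i) (?s g b))"
    by (subst sum.swap, subst (2) sum.swap) (rule refl)
  also have "\<dots> = (\<Sum>i\<le>n. hom_component w i f * hom_component w (n - i) g)"
    unfolding sum_product[symmetric] hom_component_sum[symmetric] by (simp flip: gpoly_sum_single)
  finally show ?thesis .
qed

text \<open>Modulo \<open>I\<close> the highest components of f and g outside \<open>I\<close>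
  multiply to a component of f g, so primality need only be tested on homogeneous elements.\<close>

lemma graded_primeI:
  assumes I: "is_ideal C I" and C: "\<And>f n. f \<in> C \<Longrightarrow> hom_component w n f \<in> C"
    and gr: "\<And>f n. f \<in> I \<Longrightarrow> hom_component w n f \<in> I" and one: "1 \<notin> I"
    and prime: "\<And>F G n k. F \<in> C \<Longrightarrow> G \<in> C \<Longrightarrow> homdeg w n F \<Longrightarrow> homdeg w k G \<Longrightarrow> F * G \<in> I \<Longrightarrow> F \<in> I \<or> G \<in> I"
  shows "is_prime C I"
  unfolding is_prime_def
proof (intro conjI ballI impI I one)
  fix f g assume f: "f \<in> C" and g: "g \<in> C" and fg: "f * g \<in> I"
  show "f \<in> I \<or> g \<in> I"
  proof (rule ccontr)
    assume none: "\<not> (f \<in> I \<or> g \<in> I)"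
    have top: "\<exists>n. hom_component w n h \<notin> I \<and> (\<forall>k>n. hom_component w k h \<in> I)" if h: "h \<notin> I" for h
    proof -
      obtain N where N: "\<forall>m\<in>Poly_Mapping.keys h. mon_deg w m \<le> N" using ex_mon_deg_bound by blast
      have zero: "hom_component w k h = 0" if "k > N" for k
      proof (rule poly_mapping_eqI)
        fix m
        show "Poly_Mapping.lookup (hom_component w k h) m = Poly_Mapping.lookup 0 m"
        proof (cases "m \<in> Poly_Mapping.keys h")
          case True
          then have "mon_deg w m \<noteq> k" using N that by auto
          then show ?thesis by (simp add: lookup_hom_component)
        qed (simp add: lookup_hom_component in_keys_iff)
      qed
      have fin: "{n. hom_component w n h \<notin> I} \<subseteq> {..N}"
      proof
        fix n assume "n \<in> {n. hom_component w n h \<notin> I}"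
        then show "n \<in> {..N}" using zero[of n] idealD(3)[OF I] by (cases "n \<le> N") auto
      qed
      have ne: "{n. hom_component w n h \<notin> I} \<noteq> {}" using ideal_of_components[OF I, of w h] h by blast
      have fin': "finite {n. hom_component w n h \<notin> I}" using finite_subset[OF fin] by simp
      let ?M = "Max {n. hom_component w n h \<notin> I}"
      have above: "hom_component w k h \<in> I" if "?M < k" for k
        using Max_ge[OF fin', of k] that by (cases "hom_component w k h \<in> I") auto
      have "hom_component w ?M h \<notin> I" by (rule CollectD[OF Max_in[OF fin' ne]])
      then show ?thesis using above by blast
    qed
    obtain n k where n: "hom_component w n f \<notin> I" "\<And>i. i > n \<Longrightarrow> hom_component w i f \<in> I"
      and k: "hom_component w k g \<notin> I" "\<And>i. i > k \<Longrightarrow> hom_component w i g \<in> I"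
      using top none by blast
    have sum: "(\<Sum>i\<le>n + k. hom_component w i f * hom_component w (n + k - i) g) =
        hom_component w n f * hom_component w k g +
        (\<Sum>i\<in>{..n + k} - {n}. hom_component w i f * hom_component w (n + k - i) g)"
      by (subst sum.remove[of _ n]) auto
    have rest: "(\<Sum>i\<in>{..n + k} - {n}. hom_component w i f * hom_component w (n + k - i) g) \<in> I"
    proof (rule ideal_sum[OF I])
      fix i assume i: "i \<in> {..n + k} - {n}"
      show "hom_component w i f * hom_component w (n + k - i) g \<in> I"
      proof (cases "i > n")
        case True
        then show ?thesis using n(2) C[OF g] idealD(6)[OF I] by blast
      next
        case False
        then have "n + k - i > k" using i by auto
        then show ?thesis using k(2) C[OF f] idealD(5)[OF I] by blast
      qed
    qed
    have "(\<Sum>i\<le>n + k. hom_component w i f * hom_component w (n + k - i) g) \<in> I"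
      using gr[OF fg, of "n + k"] unfolding hom_component_mult .
    from idealD(8)[OF I this rest] have "hom_component w n f * hom_component w k g \<in> I"
      unfolding sum by simp
    then show False
      using prime[OF C[OF f] C[OF g] homdeg_hom_component homdeg_hom_component] n(1) k(1) by blast
  qed
qed

lemma gsubst_scale_homdeg:
  "homdeg (\<lambda>_. 1) n F \<Longrightarrow> gsubst \<phi> (\<lambda>v. a * \<sigma> v) F = a ^ n * gsubst \<phi> \<sigma> F"
  unfolding gsubst_def mon_value_mult mon_deg_1 sum_distrib_left
  by (rule sum.cong) (auto simp: homdeg_def ac_simps)

lemma det_cong_ideal:
  assumes I: "is_ideal C I" and A: "A \<in> carrier_mat n n" "B \<in> carrier_mat n n"
    and c: "\<And>i j. i < n \<Longrightarrow> j < n \<Longrightarrow> A $$ (i, j) \<in> C" "\<And>i j. i < n \<Longrightarrow> j < n \<Longrightarrow> B $$ (i, j) \<in> C"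
      "\<And>i j. i < n \<Longrightarrow> j < n \<Longrightarrow> A $$ (i, j) - B $$ (i, j) \<in> I"
  shows "det A - det B \<in> I"
  unfolding det_def'[OF A(1)] det_def'[OF A(2)] sum_subtractf[symmetric] right_diff_distrib[symmetric]
proof (intro ideal_sum[OF I] idealD(5)[OF I] ideal_cong_prod[OF I])
  fix \<pi> assume p: "\<pi> \<in> {\<pi>. \<pi> permutes {0..<n}}"
  show "signof \<pi> \<in> C"
    using subring_closed(2,3)[OF idealD(1)[OF I]] by (cases rule: sign_cases[of \<pi>]) auto
  fix i assume i: "i \<in> {0..<n}"
  then have "\<pi> i < n" using p permutes_in_image[of \<pi> "{0..<n}" i] by auto
  then show "A $$ (i, \<pi> i) - B $$ (i, \<pi> i) \<in> I" "A $$ (i, \<pi> i) \<in> C" "B $$ (i, \<pi> i) \<in> C"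
    using i c by auto
qed

section \<open>The coefficients of the chart substitutions\<close>

lemma gvars_mult: "gvars (f * g) \<subseteq> gvars f \<union> (gvars (g :: ('v \<Rightarrow>\<^sub>0 nat) \<Rightarrow>\<^sub>0 'a::comm_ring_1))"
proof
  fix v assume "v \<in> gvars (f * g)"
  then obtain m where m: "m \<in> Poly_Mapping.keys (f * g)" "v \<in> Poly_Mapping.keys m"
    by (auto simp: gvars_def)
  then obtain a b where "m = a + b" "a \<in> Poly_Mapping.keys f" "b \<in> Poly_Mapping.keys g"
    using keys_mult[of f g] by fastforce
  then show "v \<in> gvars f \<union> gvars g"
    using m(2) Poly_Mapping.keys_add[of a b] by (auto simp: gvars_def)
qed

lemma is_subring_gvars: "is_subring {F :: ('v \<Rightarrow>\<^sub>0 nat) \<Rightarrow>\<^sub>0 'a::comm_ring_1. gvars F \<subseteq> X}"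
  unfolding is_subring_def
proof (intro conjI ballI)
  fix F G :: "('v \<Rightarrow>\<^sub>0 nat) \<Rightarrow>\<^sub>0 'a"
  assume FG: "F \<in> {F. gvars F \<subseteq> X}" "G \<in> {F. gvars F \<subseteq> X}"
  have "gvars (F + G) \<subseteq> gvars F \<union> gvars G"
    using Poly_Mapping.keys_add[of F G] unfolding gvars_def by blast
  then show "F + G \<in> {F. gvars F \<subseteq> X}" using FG by blast
  show "F * G \<in> {F. gvars F \<subseteq> X}" using gvars_mult[of F G] FG by blast
qed (auto simp: gvars_def)

lemma gvars_PConst: "gvars (PConst c) = {}"
  by (simp add: gvars_def PConst_def)

lemma gvars_PVar: "gvars (PVar v :: _ \<Rightarrow>\<^sub>0 'a::comm_ring_1) = {v}"
  by (simp add: gvars_def PVar_def)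

lemma comm_ring_hom_PConst2: "comm_ring_hom (\<lambda>c. PConst (PConst c))"
  by (rule comm_ring_hom_comp[OF comm_ring_hom_PConst comm_ring_hom_PConst])

lemma chart_subst_gsubst: "chart_subst L f = gsubst (\<lambda>c. PConst (PConst c))
    (\<lambda>(i, j). \<Sum>k<length L. PConst (PVar (L[k := i])) * PVar (k, j)) f"
  by (simp add: chart_subst_def poly_subst_gsubst)

lemma comm_ring_hom_chart: "comm_ring_hom (chart_subst L)"
  unfolding chart_subst_gsubst[abs_def] by (rule comm_ring_hom_gsubst[OF comm_ring_hom_PConst2])

lemma chart_subst_in:
  assumes C: "is_subring C" and "\<And>c. PConst (PConst c) \<in> C"
    "\<And>k i j. k < length L \<Longrightarrow> (i, j) \<in> gvars f \<Longrightarrow> PConst (PVar (L[k := i])) * PVar (k, j) \<in> C"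
  shows "chart_subst L f \<in> C"
  unfolding chart_subst_gsubst
  by (rule gsubst_in[OF C]) (use assms in \<open>auto intro: subring_sum\<close>)

lemma tuples_update: "L \<in> tuples d r \<Longrightarrow> i < d \<Longrightarrow> L[k := i] \<in> tuples d r"
  using set_update_subset_insert[of L k i] by (auto simp: tuples_def)

lemma chart_subst_carrier:
  assumes "L \<in> tuples d r" "f \<in> tca_carrier d"
  shows "chart_subst L f \<in> coeffs_in (carrier (poly_ring (tuples d r)))"
proof (rule chart_subst_in)
  let ?C = "carrier (poly_ring (tuples d r))"
  show C: "is_subring (coeffs_in ?C :: (((nat \<times> nat) \<Rightarrow>\<^sub>0 nat) \<Rightarrow>\<^sub>0 nat list cpoly) set)"
    by (rule is_subring_coeffs_in[OF is_subring_poly])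
  have 0: "0 \<in> ?C" by (rule subring_closed(1)[OF is_subring_poly])
  show "PConst (PConst c) \<in> coeffs_in ?C" for c
    by (rule PConst_coeffs_in[OF _ 0]) (simp add: carrier_poly_ring)
  show "PConst (PVar (L[k := i])) * PVar (k, j) \<in> coeffs_in ?C" if "(i, j) \<in> gvars f" for k i j
    using that assms tuples_update[OF assms(1)]
    by (intro subring_closed(5)[OF C] PConst_coeffs_in[OF _ 0] PVar_coeffs_in is_subring_poly)
      (auto simp: carrier_poly_ring tca_carrier_iff)
qed

lemma chart_subst_gvars: "gvars (chart_subst L f) \<subseteq> {..<length L} \<times> cols f"
proof -
  have "chart_subst L f \<in> {F. gvars F \<subseteq> {..<length L} \<times> cols f}"
  proof (rule chart_subst_in[OF is_subring_gvars])
    fix k i j assume "k < length L" "(i, j) \<in> gvars f"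
    moreover from this have "j \<in> cols f" unfolding cols_def by force
    ultimately show "PConst (PVar (L[k := i])) * PVar (k, j) \<in>
        {F :: ((nat \<times> nat) \<Rightarrow>\<^sub>0 nat) \<Rightarrow>\<^sub>0 nat list cpoly. gvars F \<subseteq> {..<length L} \<times> cols f}"
      by (intro subring_closed(5)[OF is_subring_gvars]) (simp_all add: gvars_PConst gvars_PVar)
  qed (simp add: gvars_PConst)
  then show ?thesis by simp
qed

text \<open>Each term of the substitution has degree 1 both in the Pluecker coordinates and in the
  y_kj, and equality of the two degrees is preserved by sums and products. Hence the coefficients
  can be tested by criteria for forms.\<close>

lemma chart_subst_homdeg: "homdeg (\<lambda>_. 1) (mon_deg (\<lambda>_. 1) \<beta>) (Poly_Mapping.lookup (chart_subst L f) \<beta>)"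
proof -
  define C where "C = {G :: ((nat \<times> nat) \<Rightarrow>\<^sub>0 nat) \<Rightarrow>\<^sub>0 nat list cpoly.
    \<forall>\<beta>. homdeg (\<lambda>_. 1) (mon_deg (\<lambda>_. 1) \<beta>) (Poly_Mapping.lookup G \<beta>)}"
  have C: "is_subring C"
    unfolding is_subring_def
  proof (intro conjI ballI)
    show "1 \<in> C" by (auto simp: C_def lookup_one when_def homdeg_zero homdeg_one mon_deg_def)
    fix F G assume "F \<in> C" "G \<in> C"
    then have FG: "homdeg (\<lambda>_. 1) (mon_deg (\<lambda>_. 1) \<beta>) (Poly_Mapping.lookup F \<beta>)"
      "homdeg (\<lambda>_. 1) (mon_deg (\<lambda>_. 1) \<beta>) (Poly_Mapping.lookup G \<beta>)" for \<beta> unfolding C_def by blast+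
    show "F + G \<in> C" unfolding C_def by (simp add: lookup_add homdeg_add FG del: One_nat_def)
    have mult: "homdeg (\<lambda>_. 1) (mon_deg (\<lambda>_. 1) (a + b)) (Poly_Mapping.lookup F a * Poly_Mapping.lookup G b)" for a b
      unfolding mon_deg_add by (rule homdeg_mult[OF FG])
    show "F * G \<in> C"
      unfolding C_def mem_Collect_eq lookup_mult_keys
    proof (intro allI homdeg_sum)
      fix \<beta> x
      assume "x \<in> {(a, b). a \<in> Poly_Mapping.keys F \<and> b \<in> Poly_Mapping.keys G \<and> a + b = \<beta>}"
      then show "homdeg (\<lambda>_. 1) (mon_deg (\<lambda>_. 1) \<beta>)
          (case x of (a, b) \<Rightarrow> Poly_Mapping.lookup F a * Poly_Mapping.lookup G b)"
        using mult by (auto simp del: One_nat_def)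
    qed
  qed (auto simp: C_def homdeg_zero homdeg_uminus)
  have "chart_subst L f \<in> C"
  proof (rule chart_subst_in[OF C])
    show "PConst (PConst c) \<in> C" for c
      by (auto simp: C_def PConst_def[of "PConst c"] lookup_single when_def homdeg_zero homdeg_PConst mon_deg_def)
    show "PConst (PVar (L[k := i])) * PVar (k, j) \<in> C" for k i j
      using homdeg_PVar[of "\<lambda>_. 1" "L[k := i]"]
      by (auto simp: C_def PConst_def PVar_def[of "(k, j)"] mult_single lookup_single when_def homdeg_zero mon_deg_def)
  qed
  then show ?thesis by (simp add: C_def)
qed

section \<open>Every GL-prime comes from the total Grassmannian\<close>

text \<open>The Pluecker coordinates are read as the minors in the columns \<open>J\<close> of the
  generic matrix; the forms that become zero modulo \<open>P\<close> will define the point.\<close>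

definition ev :: "nat list \<Rightarrow> nat list cpoly \<Rightarrow> (nat \<times> nat) cpoly" where
  "ev J = gsubst PConst (\<lambda>T. Delta T J)"

lemma comm_ring_hom_ev: "comm_ring_hom (ev J)"
  unfolding ev_def by (rule comm_ring_hom_gsubst[OF comm_ring_hom_PConst])

lemma ev_PVar: "ev J (PVar T) = Delta T J"
  by (simp add: ev_def comm_ring_hom_PConst)

lemma ev_PConst: "ev J (PConst c) = PConst c"
  by (simp add: ev_def comm_ring_hom_PConst)

lemma carrier_tuples: "F \<in> carrier (poly_ring (tuples d r)) \<longleftrightarrow> gvars F \<subseteq> tuples d r"
  by (simp add: carrier_poly_ring poly_vars_gvars)

lemma tuples_length: "L \<in> tuples d r \<Longrightarrow> length L = r"
  by (simp add: tuples_def)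

lemma tuples_set: "L \<in> tuples d r \<Longrightarrow> set L \<subseteq> {..<d}"
  by (simp add: tuples_def)

lemma tuples_nth: "L \<in> tuples d r \<Longrightarrow> k < r \<Longrightarrow> L ! k < d"
  by (simp add: tuples_def) (meson lessThan_iff nth_mem subsetD)

lemma ev_carrier:
  assumes "F \<in> carrier (poly_ring (tuples d r))" "length J = r"
  shows "ev J F \<in> carrier (poly_ring ({..<d} \<times> set J))"
  unfolding ev_def
proof (rule gsubst_in[OF is_subring_poly])
  fix T assume "T \<in> gvars F"
  then have T: "T \<in> tuples d r" using assms(1) by (auto simp: carrier_tuples)
  then show "Delta T J \<in> carrier (poly_ring ({..<d} \<times> set J))"
    unfolding Delta_def using assms(2) tuples_nth[OF T] tuples_length[OF T]
    by (intro dt_in is_subring_poly) (auto simp: carrier_poly_ring)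
qed (simp add: carrier_poly_ring)

lemma carrier_cols: "f \<in> carrier (poly_ring ({..<d} \<times> S)) \<longleftrightarrow> f \<in> tca_carrier d \<and> cols f \<subseteq> S"
  by (auto simp: carrier_poly_ring poly_vars_gvars tca_carrier_iff cols_def)

lemma ev_tca: "F \<in> carrier (poly_ring (tuples d r)) \<Longrightarrow> length J = r \<Longrightarrow> ev J F \<in> tca_carrier d"
  using ev_carrier carrier_cols by blast

lemma ev_subst:
  assumes F: "F \<in> carrier (poly_ring (tuples d r))" and "length J = r" "length J' = r"
    and \<tau>: "\<And>i k. k < r \<Longrightarrow> \<tau> (i, J ! k) = PVar (i, J' ! k)"
  shows "poly_subst PConst \<tau> (ev J F) = ev J' F"
  unfolding ev_def hom_gsubst[OF comm_ring_hom_subst]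
proof (rule gsubst_cong)
  fix T assume "T \<in> gvars F"
  then have "length T = r" using F tuples_length by (auto simp: carrier_tuples)
  then show "poly_subst PConst \<tau> (Delta T J) = Delta T J'"
    unfolding Delta_subst unfolding Delta_def by (intro dt_cong) (simp add: \<tau>)
qed (simp add: poly_subst_PConst)

lemma minor_dt: "length L = r \<Longrightarrow> minor r L = dt (\<lambda>k i. PVar (k, i)) L"
  by (simp add: minor_def dt_def)

lemma ev_minor:
  assumes "F \<in> carrier (poly_ring (tuples d r))" "length J = r"
  shows "ev J F = poly_subst PConst (\<lambda>(k, i). PVar (i, J ! k)) (poly_subst PConst (minor r) F)"
  unfolding ev_def poly_subst_gsubst[of PConst "minor r"] hom_gsubst[OF comm_ring_hom_subst]
proof (rule gsubst_cong)
  fix T assume "T \<in> gvars F"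
  then have "length T = r" using assms(1) tuples_length by (auto simp: carrier_tuples)
  then show "Delta T J = poly_subst PConst (\<lambda>(k, i). PVar (i, J ! k)) (minor r T)"
    unfolding minor_dt[OF \<open>length T = r\<close>] hom_dt[OF comm_ring_hom_subst] Delta_def
    by (simp add: poly_subst_PVar)
qed (simp add: poly_subst_PConst)

lemma Delta_length_le:
  assumes "L \<in> tuples d r" "Delta L J \<noteq> 0" shows "r \<le> d"
proof -
  have "distinct L" using assms(2) dt_repeated_entry unfolding Delta_def by blast
  then have "length L = card (set L)" by (simp add: distinct_card)
  also have "\<dots> \<le> card {..<d}" using tuples_set[OF assms(1)] by (intro card_mono) auto
  finally show ?thesis using tuples_length[OF assms(1)] by simp
qed

context gl_prime
begin

lemma disjoint_primeI:
  assumes "f \<in> carrier (poly_ring ({..<d} \<times> S))" "g \<in> carrier (poly_ring ({..<d} \<times> S'))"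
    "S \<inter> S' = {}" "f * g \<in> P"
  shows "f \<in> P \<or> g \<in> P"
  using assms disjoint_prime[of f g] unfolding carrier_cols by blast

section \<open>The rank of a GL-prime and Cramer's rule modulo it\<close>

definition rk :: nat where
  "rk = Max {r. \<exists>L\<in>tuples d r. \<exists>J. length J = r \<and> Delta L J \<notin> P}"

lemma finite_nonzero_minors: "finite {r. \<exists>L\<in>tuples d r. \<exists>J. length J = r \<and> Delta L J \<notin> P}"
proof (rule finite_subset)
  show "{r. \<exists>L\<in>tuples d r. \<exists>J. length J = r \<and> Delta L J \<notin> P} \<subseteq> {..d}"
    using Delta_length_le idealD(3)[OF P_ideal] by fastforce
qed simp

lemma rk_witness: "\<exists>L\<in>tuples d rk. \<exists>J. length J = rk \<and> Delta L J \<notin> P"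
proof -
  have "Delta [] [] = 1" by (simp add: Delta_def dt_def)
  then have "0 \<in> {r. \<exists>L\<in>tuples d r. \<exists>J. length J = r \<and> Delta L J \<notin> P}"
    using one_notin by (auto simp: tuples_def)
  then show ?thesis using Max_in[OF finite_nonzero_minors] unfolding rk_def by blast
qed

lemma rk_le: "rk \<le> d"
  using rk_witness Delta_length_le idealD(3)[OF P_ideal] by metis

lemma big_minor: "L \<in> tuples d r \<Longrightarrow> length J = r \<Longrightarrow> rk < r \<Longrightarrow> Delta L J \<in> P"
  using Max_ge[OF finite_nonzero_minors, of r] unfolding rk_def[symmetric] by fastforce

text \<open>By \<open>Delta_L0\<close> its minors are outside \<open>P\<close> for every choice of
  distinct columns, so this one chart can be used throughout.\<close>

definition L0 :: "nat list" where
  "L0 = (SOME L. L \<in> tuples d rk \<and> (\<exists>J. length J = rk \<and> Delta L J \<notin> P))"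

lemma L0: "L0 \<in> tuples d rk" "\<exists>J. length J = rk \<and> Delta L0 J \<notin> P"
  using someI_ex[OF rk_witness[unfolded Bex_def], folded L0_def] by auto

lemma Delta_L0: "length J = rk \<Longrightarrow> distinct J \<Longrightarrow> Delta L0 J \<notin> P"
  using Delta_cols[of L0 _ J] L0 tuples_length by metis

lemma Delta_power:
  "L \<in> tuples d rk \<Longrightarrow> length J = rk \<Longrightarrow> distinct J \<Longrightarrow> Delta L J \<notin> P \<Longrightarrow> Delta L J ^ n \<notin> P"
  using Delta_power_notin tuples_length tuples_set by metis

text \<open>The difference is the minor of size rk + 1 with \<open>i\<close> and \<open>j\<close>
  appended, expanded by \<open>Delta_snoc\<close>.\<close>

lemma cramer:
  assumes "L \<in> tuples d rk" "length J = rk" "i < d"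
  shows "Delta L J * PVar (i, j) - (\<Sum>k<rk. Delta (L[k := i]) J * PVar (L ! k, j)) \<in> P"
proof -
  have "L @ [i] \<in> tuples d (Suc rk)" using assms by (simp add: tuples_def)
  then have "Delta (L @ [i]) (J @ [j]) \<in> P" by (rule big_minor) (use assms in simp_all)
  then show ?thesis
    using Delta_snoc[of J L i j] assms tuples_length[OF assms(1)] by simp
qed

text \<open>Up to powers of \<open>Delta L J'\<close>, the ratio of \<open>Delta T J\<close> to
  \<open>Delta L J\<close> does not depend on the columns \<open>J\<close>. Cramer's rule for all
  entries in rows \<open>T\<close> and columns \<open>J\<close> gives a congruence of matrices; its
  determinant is rewritten by \<open>dt_compound\<close>.\<close>

lemma minor_transfer:
  assumes L: "L \<in> tuples d rk" and T: "T \<in> tuples d rk" and J: "length J = rk" "length J' = rk"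
  shows "Delta L J' ^ Suc rk * Delta T J - Delta L J' ^ rk * Delta L J * Delta T J' \<in> P"
proof -
  note lens = tuples_length[OF L] tuples_length[OF T]
  let ?D = "Delta L J'"
  let ?A = "mat rk rk (\<lambda>(k, l). ?D * PVar (T ! l, J ! k))"
  let ?B = "mat rk rk (\<lambda>(k, l). \<Sum>m<rk. PVar (L ! m, J ! k) * Delta (L[m := T ! l]) J')"
  have "det ?A - det ?B \<in> P"
  proof (rule det_cong_ideal[OF P_ideal])
    fix k l assume kl: "k < rk" "l < rk"
    have Tl: "T ! l < d" by (rule tuples_nth[OF T kl(2)])
    show "?A $$ (k, l) - ?B $$ (k, l) \<in> P"
      using cramer[OF L J(2) Tl, of "J ! k"] kl by (simp add: mult.commute)
    have "?D * PVar (T ! l, J ! k) \<in> tca_carrier d"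
      by (intro subring_closed(5)[OF is_subring_tca] PVar_tca Tl Delta_tca tuples_set[OF L])
    then show "?A $$ (k, l) \<in> tca_carrier d" using kl by simp
    have "PVar (L ! m, J ! k) * Delta (L[m := T ! l]) J' \<in> tca_carrier d" if "m < rk" for m
      using that by (intro subring_closed(5)[OF is_subring_tca] PVar_tca tuples_nth[OF L] Delta_tca
          tuples_set[OF tuples_update[OF L Tl]])
    then have "(\<Sum>m<rk. PVar (L ! m, J ! k) * Delta (L[m := T ! l]) J') \<in> tca_carrier d"
      by (intro subring_sum[OF is_subring_tca]) simp
    then show "?B $$ (k, l) \<in> tca_carrier d" using kl by simp
  qed auto
  moreover have "det ?A = ?D ^ rk * Delta T J"
  proof -
    have "?A = ?D \<cdot>\<^sub>m mat rk rk (\<lambda>(k, l). PVar (T ! l, J ! k))" by (intro eq_matI) auto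
    then show ?thesis by (simp add: Delta_def dt_def lens)
  qed
  moreover have "det ?B = Delta L J * det (mat rk rk (\<lambda>(m, l). Delta (L[m := T ! l]) J'))"
    unfolding det_mult_explicit by (simp add: Delta_def[of L J] dt_def lens)
  moreover have "?D * det (mat rk rk (\<lambda>(m, l). Delta (L[m := T ! l]) J')) = ?D ^ rk * Delta T J'"
    using dt_compound[of T L "\<lambda>k i. PVar (i, J' ! k)"] lens by (simp add: Delta_def)
  moreover have "?D \<in> tca_carrier d" by (rule Delta_tca[OF tuples_set[OF L]])
  then have "?D * (det ?A - det ?B) \<in> P" if "det ?A - det ?B \<in> P" using idealD(5)[OF P_ideal _ that] by blast
  ultimately show ?thesis by (simp add: algebra_simps)
qed

lemma ev_transfer:
  assumes L: "L \<in> tuples d rk" and F: "F \<in> carrier (poly_ring (tuples d rk))" "homdeg (\<lambda>_. 1) n F"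
    and J: "length J = rk" "length J' = rk"
  shows "(Delta L J' ^ Suc rk) ^ n * ev J F - (Delta L J' ^ rk * Delta L J) ^ n * ev J' F \<in> P"
  unfolding ev_def gsubst_scale_homdeg[OF F(2), symmetric]
proof (rule gsubst_cong_ideal[OF P_ideal])
  fix T assume "T \<in> gvars F"
  then have T: "T \<in> tuples d rk" using F(1) by (auto simp: carrier_tuples)
  show "Delta L J' ^ Suc rk * Delta T J \<in> tca_carrier d"
    "Delta L J' ^ rk * Delta L J * Delta T J' \<in> tca_carrier d"
    by (intro subring_closed(5)[OF is_subring_tca] subring_power is_subring_tca Delta_tca tuples_set[OF L] tuples_set[OF T])+
  show "Delta L J' ^ Suc rk * Delta T J - Delta L J' ^ rk * Delta L J * Delta T J' \<in> P"
    by (rule minor_transfer[OF L T J])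
qed (rule PConst_tca)

section \<open>The point of the Grassmannian attached to a GL-prime\<close>

abbreviation "J0 \<equiv> [0..<rk]"

text \<open>The kernel of passing to A/P with \<open>Delta L0 J\<close> inverted. As
  \<open>P\<close> is not yet known to be prime, powers of this minor cannot simply be
  cancelled.\<close>

definition sat :: "nat list \<Rightarrow> (nat \<times> nat) cpoly set" where
  "sat J = {x \<in> tca_carrier d. \<exists>k. Delta L0 J ^ k * x \<in> P}"

text \<open>Membership is tested on components because the transfer between sets of columns
  multiplies a form of degree n by n-th powers, and so is available for forms only.\<close>

definition Gr_point :: "nat list cpoly set" where
  "Gr_point = {F \<in> carrier (poly_ring (tuples d rk)). \<forall>n. ev J0 (hom_component (\<lambda>_. 1) n F) \<in> sat J0}"

lemma L0_tca: "Delta L0 J \<in> tca_carrier d"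
  by (rule Delta_tca[OF tuples_set[OF L0(1)]])

lemma sat_ideal: "is_ideal (tca_carrier d) (sat J)"
  unfolding is_ideal_def
proof (intro conjI ballI is_subring_tca)
  note sub = subring_closed[OF is_subring_tca] and pow = subring_power[OF is_subring_tca L0_tca]
  show "sat J \<subseteq> tca_carrier d" by (auto simp: sat_def)
  show "0 \<in> sat J" using idealD(3)[OF P_ideal] by (auto simp: sat_def sub)
  fix x y assume y: "y \<in> sat J"
  then obtain k where k: "y \<in> tca_carrier d" "Delta L0 J ^ k * y \<in> P" by (auto simp: sat_def)
  {
    assume "x \<in> sat J"
    then obtain l where l: "x \<in> tca_carrier d" "Delta L0 J ^ l * x \<in> P" by (auto simp: sat_def)
    have "Delta L0 J ^ k * (Delta L0 J ^ l * x) + Delta L0 J ^ l * (Delta L0 J ^ k * y) \<in> P"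
      by (rule idealD(4)[OF P_ideal idealD(5)[OF P_ideal pow l(2)] idealD(5)[OF P_ideal pow k(2)]])
    then have "Delta L0 J ^ (k + l) * (x + y) \<in> P" by (simp add: power_add algebra_simps)
    then show "x + y \<in> sat J" using k l by (auto simp: sat_def sub)
  }
  assume x: "x \<in> tca_carrier d"
  have "x * (Delta L0 J ^ k * y) \<in> P" by (rule idealD(5)[OF P_ideal x k(2)])
  then have "Delta L0 J ^ k * (x * y) \<in> P" by (simp add: ac_simps)
  then show "x * y \<in> sat J" using x k by (auto simp: sat_def sub)
qed

lemma Gr_point_homdeg:
  assumes "homdeg (\<lambda>_. 1) n F"
  shows "F \<in> Gr_point \<longleftrightarrow> F \<in> carrier (poly_ring (tuples d rk)) \<and> ev J0 F \<in> sat J0"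
proof -
  interpret comm_ring_hom "ev J0" by (rule comm_ring_hom_ev)
  show ?thesis
    unfolding Gr_point_def mem_Collect_eq hom_component_homdeg[OF assms] using idealD(3)[OF sat_ideal]
    by (auto split: if_splits)
qed

lemma Gr_point_ideal: "is_ideal (carrier (poly_ring (tuples d rk))) Gr_point"
  unfolding is_ideal_def
proof (intro conjI ballI is_subring_poly)
  interpret comm_ring_hom "ev J0" by (rule comm_ring_hom_ev)
  note sub = subring_closed[OF is_subring_poly]
  show "Gr_point \<subseteq> carrier (poly_ring (tuples d rk))" by (auto simp: Gr_point_def)
  show "0 \<in> Gr_point" using Gr_point_homdeg[OF homdeg_zero] idealD(3)[OF sat_ideal] by (simp add: sub)
  show "F + G \<in> Gr_point" if "F \<in> Gr_point" "G \<in> Gr_point" for F G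
    using that by (auto simp: Gr_point_def hom_component_add hom_distribs intro: idealD(4)[OF sat_ideal] sub)
  show "F * G \<in> Gr_point" if F: "F \<in> carrier (poly_ring (tuples d rk))" and G: "G \<in> Gr_point" for F G
  proof -
    have "ev J0 (hom_component (\<lambda>_. 1) n (F * G)) \<in> sat J0" for n
      unfolding hom_component_mult hom_sum hom_mult
    proof (intro ideal_sum[OF sat_ideal] idealD(5)[OF sat_ideal])
      show "ev J0 (hom_component (\<lambda>_. 1) i F) \<in> tca_carrier d" for i
        by (rule ev_tca[OF hom_component_closed[OF F]]) simp
      show "ev J0 (hom_component (\<lambda>_. 1) i G) \<in> sat J0" for i using G by (simp add: Gr_point_def)
    qed
    then show ?thesis using F G by (auto simp: Gr_point_def intro: sub)
  qed
qed

lemma rename_colsub: "colsub d (\<lambda>(i, j). PVar (i, \<pi> j))"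
  by (simp add: colsub_def colspan.base)

lemma ev_rename_in:
  assumes F: "F \<in> carrier (poly_ring (tuples d rk))" and J: "length J = rk" "distinct J" "length J' = rk"
    and mem: "Delta L0 J ^ k * ev J F \<in> P"
  shows "Delta L0 J' ^ k * ev J' F \<in> P"
proof -
  define \<pi> where "\<pi> = (\<lambda>j. the (map_of (zip J J') j))"
  have \<pi>: "\<pi> (J ! k) = J' ! k" if "k < rk" for k
    using that J by (simp add: \<pi>_def map_of_zip_nth)
  have "map \<pi> J = J'" by (rule nth_equalityI) (use J \<pi> in auto)
  then have "poly_subst PConst (\<lambda>(i, j). PVar (i, \<pi> j)) (Delta L0 J) = Delta L0 J'"
    using Delta_rename[of L0 J \<pi>] tuples_length[OF L0(1)] J by simp
  moreover have "poly_subst PConst (\<lambda>(i, j). PVar (i, \<pi> j)) (ev J F) = ev J' F"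
    by (rule ev_subst[OF F]) (use J \<pi> in auto)
  ultimately show ?thesis
    using colsub_closed[OF mem rename_colsub, of \<pi>] by (simp add: poly_subst_mult poly_subst_power)
qed

lemma fresh_columns:
  assumes "finite S" obtains N :: nat where "\<And>j. j \<in> S \<Longrightarrow> j < N"
  using assms by (metis finite_nat_set_iff_bounded)

text \<open>Moving the factors of a product to disjoint sets of columns at the cost of powers of minors.\<close>

lemma Gr_point_prime: "is_prime (carrier (poly_ring (tuples d rk))) Gr_point"
proof (rule graded_primeI[where w = "\<lambda>_. 1", OF Gr_point_ideal])
  interpret comm_ring_hom "ev J0" by (rule comm_ring_hom_ev)
  note sub = subring_closed[OF is_subring_tca] and pow = subring_power[OF is_subring_tca]
  show "hom_component (\<lambda>_. 1) n F \<in> Gr_point" if "F \<in> Gr_point" for F n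
    using that Gr_point_homdeg[OF homdeg_hom_component, of n F] hom_component_closed by (auto simp: Gr_point_def)
  show "1 \<notin> Gr_point"
    using Delta_power[OF L0(1), of J0] Delta_L0[of J0] by (auto simp: Gr_point_homdeg[OF homdeg_one] sat_def)
  fix F G n m
  assume F: "F \<in> carrier (poly_ring (tuples d rk))" "homdeg (\<lambda>_. 1) n F"
    and G: "G \<in> carrier (poly_ring (tuples d rk))" "homdeg (\<lambda>_. 1) m G"
    and FG: "F * G \<in> Gr_point"
  obtain k where k: "Delta L0 J0 ^ k * (ev J0 F * ev J0 G) \<in> P"
    using FG Gr_point_homdeg[OF homdeg_mult[OF F(2) G(2)]] by (auto simp: sat_def hom_distribs)
  \<comment> \<open>\<open>F\<close> will be moved to the columns \<open>J1\<close> and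
    \<open>G\<close> to \<open>J2\<close>, while \<open>J0\<close> keeps the minors paid for the
    moves.\<close>
  define J1 where "J1 = [rk..<rk + rk]"
  define J2 where "J2 = [rk + rk..<rk + rk + rk]"
  have len: "length J0 = rk" "length J1 = rk" "length J2 = rk" "distinct J1" "distinct J2"
    by (simp_all add: J1_def J2_def)
  define D where "D = Delta L0"
  define E where "E = (\<lambda>J. ev J F)"
  define H where "H = (\<lambda>J. ev J G)"
  have k': "D J0 ^ k * (E J0 * H J0) \<in> P" using k by (simp add: D_def E_def H_def)
  define R where "R = (\<lambda>J :: nat list. carrier (poly_ring ({..<d} \<times> set J)))"
  have subR: "is_subring (R J)" for J unfolding R_def by (rule is_subring_poly)
  have RI: "x \<in> R J \<Longrightarrow> x \<in> carrier (poly_ring ({..<d} \<times> set J))" for x J by (simp add: R_def)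
  have DR: "D J \<in> R J" and ER: "E J \<in> R J" and HR: "H J \<in> R J" if "length J = rk" for J
    using ev_carrier[OF F(1) that] ev_carrier[OF G(1) that] cols_Delta[of L0 J] tuples_length[OF L0(1)] L0_tca that
    by (simp_all add: D_def E_def H_def R_def carrier_cols)
  have RA: "x \<in> R J \<Longrightarrow> x \<in> tca_carrier d" for x J by (simp add: R_def carrier_cols)
  have A: "D J \<in> tca_carrier d" "E J \<in> tca_carrier d" "H J \<in> tca_carrier d" if "length J = rk" for J
    using RA DR[OF that] ER[OF that] HR[OF that] by blast+
  have tE: "(D J1 ^ Suc rk) ^ n * E J0 - (D J1 ^ rk * D J0) ^ n * E J1 \<in> P"
    unfolding D_def E_def by (rule ev_transfer[OF L0(1) F len(1,2)])
  have tH: "(D J2 ^ Suc rk) ^ m * H J0 - (D J2 ^ rk * D J0) ^ m * H J2 \<in> P"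
    unfolding D_def H_def by (rule ev_transfer[OF L0(1) G len(1,3)])
  have "((D J1 ^ Suc rk) ^ n * E J0) * ((D J2 ^ Suc rk) ^ m * H J0) -
      ((D J1 ^ rk * D J0) ^ n * E J1) * ((D J2 ^ rk * D J0) ^ m * H J2) \<in> P"
    by (rule ideal_cong_mult[OF P_ideal tE tH]) (intro sub(5) pow A len)+
  then have "D J0 ^ k * (((D J1 ^ Suc rk) ^ n * E J0) * ((D J2 ^ Suc rk) ^ m * H J0) -
      ((D J1 ^ rk * D J0) ^ n * E J1) * ((D J2 ^ rk * D J0) ^ m * H J2)) \<in> P"
    by (intro idealD(5)[OF P_ideal] pow A len)
  moreover have "((D J1 ^ Suc rk) ^ n * (D J2 ^ Suc rk) ^ m) * (D J0 ^ k * (E J0 * H J0)) \<in> P"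
    by (rule idealD(5)[OF P_ideal _ k']) (intro sub(5) pow A len)
  ultimately have "((D J1 ^ Suc rk) ^ n * (D J2 ^ Suc rk) ^ m) * (D J0 ^ k * (E J0 * H J0)) -
      D J0 ^ k * (((D J1 ^ Suc rk) ^ n * E J0) * ((D J2 ^ Suc rk) ^ m * H J0) -
      ((D J1 ^ rk * D J0) ^ n * E J1) * ((D J2 ^ rk * D J0) ^ m * H J2)) \<in> P"
    by (intro idealD(8)[OF P_ideal])
  also have "((D J1 ^ Suc rk) ^ n * (D J2 ^ Suc rk) ^ m) * (D J0 ^ k * (E J0 * H J0)) -
      D J0 ^ k * (((D J1 ^ Suc rk) ^ n * E J0) * ((D J2 ^ Suc rk) ^ m * H J0) -
      ((D J1 ^ rk * D J0) ^ n * E J1) * ((D J2 ^ rk * D J0) ^ m * H J2)) =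
      ((D J1 ^ rk) ^ n * E J1) * (((D J2 ^ rk) ^ m * H J2) * (D J0 ^ n * (D J0 ^ m * D J0 ^ k)))"
    unfolding power_mult_distrib by (simp only: algebra_simps)
  \<comment> \<open>The terms with \<open>E J0\<close> and \<open>H J0\<close> have cancelled; what
    remains is a product of three factors in pairwise disjoint columns.\<close>
  finally have prod: "((D J1 ^ rk) ^ n * E J1) * (((D J2 ^ rk) ^ m * H J2) * (D J0 ^ n * (D J0 ^ m * D J0 ^ k))) \<in> P" .
  have R1: "(D J1 ^ rk) ^ n * E J1 \<in> carrier (poly_ring ({..<d} \<times> set J1))"
    by (rule RI, intro subring_closed(5)[OF subR] subring_power[OF subR] DR ER len)
  have R2: "(D J2 ^ rk) ^ m * H J2 \<in> carrier (poly_ring ({..<d} \<times> set J2))"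
    by (rule RI, intro subring_closed(5)[OF subR] subring_power[OF subR] DR HR len)
  have R0: "D J0 ^ n * (D J0 ^ m * D J0 ^ k) \<in> carrier (poly_ring ({..<d} \<times> set J0))"
    by (rule RI, intro subring_closed(5)[OF subR] subring_power[OF subR] DR len)
  have R20: "((D J2 ^ rk) ^ m * H J2) * (D J0 ^ n * (D J0 ^ m * D J0 ^ k)) \<in>
      carrier (poly_ring ({..<d} \<times> (set J2 \<union> set J0)))"
    by (rule subring_closed(5)[OF is_subring_poly]) (use R2 R0 in \<open>auto simp: carrier_poly_ring\<close>)
  have "(D J1 ^ rk) ^ n * E J1 \<in> P \<or> ((D J2 ^ rk) ^ m * H J2) * (D J0 ^ n * (D J0 ^ m * D J0 ^ k)) \<in> P"
    by (rule disjoint_primeI[OF R1 R20 _ prod]) (auto simp: J1_def J2_def)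
  moreover have "(D J2 ^ rk) ^ m * H J2 \<in> P \<or> D J0 ^ n * (D J0 ^ m * D J0 ^ k) \<in> P"
    if "((D J2 ^ rk) ^ m * H J2) * (D J0 ^ n * (D J0 ^ m * D J0 ^ k)) \<in> P"
    by (rule disjoint_primeI[OF R2 R0 _ that]) (auto simp: J2_def)
  moreover have "D J0 ^ n * (D J0 ^ m * D J0 ^ k) \<notin> P"
    using Delta_power[OF L0(1), of J0] Delta_L0[of J0] unfolding D_def power_add[symmetric] by simp
  moreover have "F \<in> Gr_point" if mem: "(D J1 ^ rk) ^ n * E J1 \<in> P"
  proof -
    have "Delta L0 J0 ^ (rk * n) * ev J0 F \<in> P"
      by (rule ev_rename_in[OF F(1) len(2,4,1)]) (use mem in \<open>simp add: D_def E_def power_mult\<close>)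
    then show ?thesis
      using F(1) ev_tca[OF F(1) len(1)] by (auto simp: Gr_point_homdeg[OF F(2)] sat_def)
  qed
  moreover have "G \<in> Gr_point" if mem: "(D J2 ^ rk) ^ m * H J2 \<in> P"
  proof -
    have "Delta L0 J0 ^ (rk * m) * ev J0 G \<in> P"
      by (rule ev_rename_in[OF G(1) len(3,5,1)]) (use mem in \<open>simp add: D_def H_def power_mult\<close>)
    then show ?thesis
      using G(1) ev_tca[OF G(1) len(1)] by (auto simp: Gr_point_homdeg[OF G(2)] sat_def)
  qed
  ultimately show "F \<in> Gr_point \<or> G \<in> Gr_point" by blast
qed (rule hom_component_closed)

lemma PVar_Gr_point: "L \<in> tuples d rk \<Longrightarrow> PVar L \<notin> Gr_point \<Longrightarrow> Delta L J0 \<notin> P"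
  using Gr_point_homdeg[OF homdeg_PVar, of L] Delta_tca[OF tuples_set, of L d rk J0]
  by (auto simp: sat_def ev_PVar carrier_poly_ring dest: spec[of _ 0])

lemma PVar_L0: "PVar L0 \<notin> Gr_point"
proof
  assume "PVar L0 \<in> Gr_point"
  then obtain k where "Delta L0 J0 ^ k * Delta L0 J0 \<in> P"
    using Gr_point_homdeg[OF homdeg_PVar, of L0] by (auto simp: sat_def ev_PVar)
  then have "Delta L0 J0 ^ Suc k \<in> P" by (simp add: mult.commute)
  then show False using Delta_power[OF L0(1), of J0 "Suc k"] Delta_L0[of J0] by (simp del: power_Suc)
qed

lemma Gr_point_Gr: "Gr_point \<in> Gr d rk"
proof -
  have "pluecker_relations d rk \<subseteq> Gr_point"
  proof
    fix F assume "F \<in> pluecker_relations d rk"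
    then obtain n where F: "F \<in> carrier (poly_ring (tuples d rk))" "homdeg (\<lambda>_. 1) n F"
      "poly_subst PConst (minor rk) F = 0"
      by (auto simp: pluecker_relations_def homogeneous_homdeg)
    then have "ev J0 F = 0" using ev_minor[OF F(1), of J0] by simp
    then show "F \<in> Gr_point"
      using F idealD(3)[OF sat_ideal] by (simp add: Gr_point_homdeg[OF F(2)])
  qed
  moreover have "graded_set (\<lambda>_. 1) Gr_point"
    unfolding graded_set_def
    using Gr_point_homdeg[OF homdeg_hom_component] hom_component_closed by (auto simp: Gr_point_def)
  moreover have "\<not> {PVar v |v. v \<in> tuples d rk} \<subseteq> Gr_point"
    using PVar_L0 L0(1) by blast
  ultimately show ?thesis
    using Gr_point_prime by (simp add: Gr_def multi_Proj_def is_prime_poly)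
qed

end

section \<open>Recovering a GL-prime from its point\<close>

lemma lookup_gsubst_coeff_scale:
  fixes F :: "('v \<Rightarrow>\<^sub>0 nat) \<Rightarrow>\<^sub>0 'a::comm_ring_1"
  assumes "comm_ring_hom h"
  shows "Poly_Mapping.lookup (gsubst (\<lambda>c. PConst (h c)) (\<lambda>v. PConst a * PVar v) F) m =
    a ^ mon_deg (\<lambda>_. 1) m * h (Poly_Mapping.lookup F m)"
proof -
  have "gsubst PConst (\<lambda>v. PConst a * PVar v) (gsubst (\<lambda>c. PConst (h c)) PVar F) =
      gsubst (\<lambda>c. PConst (h c)) (\<lambda>v. PConst a * PVar v) F"
    unfolding hom_gsubst[OF comm_ring_hom_gsubst[OF comm_ring_hom_PConst]]
    by (simp add: comm_ring_hom_PConst)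
  then show ?thesis
    using lookup_gsubst_scale[of a "gsubst (\<lambda>c. PConst (h c)) PVar F" m]
    unfolding lookup_gsubst_coeff[OF assms] by simp
qed

lemma gsubst_chart_subst:
  assumes h: "comm_ring_hom h" and c: "\<And>c. h (PConst c) = \<phi> c"
  shows "gsubst h \<rho> (chart_subst L f) =
    gsubst \<phi> (\<lambda>(i, j). \<Sum>k<length L. h (PVar (L[k := i])) * \<rho> (k, j)) f"
proof -
  interpret comm_ring_hom "gsubst h \<rho>" by (rule comm_ring_hom_gsubst[OF h])
  show ?thesis
    unfolding chart_subst_gsubst hom_gsubst[OF comm_ring_hom_axioms]
    by (rule gsubst_cong) (auto simp: h c hom_distribs)
qed

context gl_prime
begin

text \<open>Cramer's rule in every variable: with the coordinates read as minors in \<open>J\<close>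
  and y_kj as the variable in row \<open>L ! k\<close>, the chart substitution only scales the
  variables of \<open>f\<close>.\<close>

lemma scaled_cong:
  assumes L: "L \<in> tuples d rk" and J: "length J = rk" and f: "f \<in> tca_carrier d"
  shows "poly_subst PConst (\<lambda>v. Delta L J * PVar v) f -
    gsubst (ev J) (\<lambda>(k, j). PVar (L ! k, j)) (chart_subst L f) \<in> P"
  unfolding gsubst_chart_subst[OF comm_ring_hom_ev ev_PConst] poly_subst_gsubst
proof (rule gsubst_cong_ideal[OF P_ideal])
  fix v assume "v \<in> gvars f"
  then obtain i j where v: "v = (i, j)" "i < d" using f by (cases v) (auto simp: tca_carrier_iff)
  note sub = subring_closed(5)[OF is_subring_tca]
  show "Delta L J * PVar v \<in> tca_carrier d"
    unfolding v(1) by (intro sub Delta_tca tuples_set[OF L] PVar_tca v(2))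
  have "(\<Sum>k<rk. Delta (L[k := i]) J * PVar (L ! k, j)) \<in> tca_carrier d"
    by (intro subring_sum[OF is_subring_tca] sub Delta_tca tuples_set[OF tuples_update[OF L v(2)]] PVar_tca tuples_nth[OF L]) simp
  then show "(case v of (i, j) \<Rightarrow> \<Sum>k<length L. ev J (PVar (L[k := i])) * (case (k, j) of (k, j) \<Rightarrow> PVar (L ! k, j)))
      \<in> tca_carrier d"
    by (simp add: v(1) ev_PVar tuples_length[OF L])
  show "Delta L J * PVar v - (case v of (i, j) \<Rightarrow> \<Sum>k<length L. ev J (PVar (L[k := i])) *
      (case (k, j) of (k, j) \<Rightarrow> PVar (L ! k, j))) \<in> P"
    using cramer[OF L J v(2), of j] by (simp add: v(1) ev_PVar tuples_length[OF L])
qed (rule PConst_tca)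

text \<open>With \<open>J\<close> beyond the columns of \<open>f\<close>, the chart puts a scaled
  copy of \<open>f\<close>, times a power of \<open>Delta L0 J\<close>, into \<open>P\<close>, and
  \<open>cancel_scale\<close> removes both factors.\<close>

lemma in_P_if_chart:
  assumes f: "f \<in> tca_carrier d" and chart: "chart_subst L0 f \<in> coeffs_in Gr_point"
  shows "f \<in> P"
proof -
  obtain N where N: "\<And>j. j \<in> cols f \<Longrightarrow> j < N" using fresh_columns[OF finite_cols] by blast
  define J where "J = [N..<N + rk]"
  have J: "length J = rk" "distinct J" by (simp_all add: J_def)
  have "gsubst (ev J) (\<lambda>(k, j). PVar (L0 ! k, j)) (chart_subst L0 f) \<in> sat J"
  proof (rule gsubst_in_ideal[OF sat_ideal])
    fix \<beta>
    let ?c = "Poly_Mapping.lookup (chart_subst L0 f) \<beta>"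
    have "?c \<in> Gr_point" using chart by (rule coeffs_inD)
    then have c: "?c \<in> carrier (poly_ring (tuples d rk))" "ev J0 ?c \<in> sat J0"
      using Gr_point_homdeg[OF chart_subst_homdeg] by blast+
    then obtain k where "Delta L0 J0 ^ k * ev J0 ?c \<in> P" by (auto simp: sat_def)
    from ev_rename_in[OF c(1) _ _ J(1) this] have "Delta L0 J ^ k * ev J ?c \<in> P" by simp
    then show "ev J ?c \<in> sat J" using ev_tca[OF c(1) J(1)] by (auto simp: sat_def)
  next
    fix v assume "v \<in> gvars (chart_subst L0 f)"
    then have "fst v < rk" using chart_subst_gvars[of L0 f] tuples_length[OF L0(1)] by auto
    then show "(case v of (k, j) \<Rightarrow> PVar (L0 ! k, j)) \<in> tca_carrier d"
      by (simp add: case_prod_unfold PVar_tca tuples_nth[OF L0(1)])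
  qed
  then obtain k where k: "Delta L0 J ^ k * gsubst (ev J) (\<lambda>(k, j). PVar (L0 ! k, j)) (chart_subst L0 f) \<in> P"
    by (auto simp: sat_def)
  have "Delta L0 J ^ k * (poly_subst PConst (\<lambda>v. Delta L0 J * PVar v) f -
      gsubst (ev J) (\<lambda>(k, j). PVar (L0 ! k, j)) (chart_subst L0 f)) \<in> P"
    by (intro idealD(5)[OF P_ideal] subring_power[OF is_subring_tca L0_tca] scaled_cong[OF L0(1) J(1) f])
  from idealD(4)[OF P_ideal this k]
  have "Delta L0 J ^ k * poly_subst PConst (\<lambda>v. Delta L0 J * PVar v) f \<in> P"
    by (simp add: right_diff_distrib)
  then show "f \<in> P"
  proof (rule cancel_scale[OF L0_tca _ _ f, rotated 2])
    show "Delta L0 J ^ n \<notin> P" for n by (intro Delta_power L0 J Delta_L0)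
    show "cols (Delta L0 J) \<inter> cols f = {}"
      using cols_Delta[of L0 J] tuples_length[OF L0(1)] J(1) N by (fastforce simp: J_def)
  qed
qed

text \<open>Substituting an adjugate matrix for the columns of \<open>f\<close> separates the monomials of the chart.\<close>

lemma chart_if_in_P:
  assumes f: "f \<in> P" and L: "L \<in> tuples d rk" "PVar L \<notin> Gr_point"
  shows "chart_subst L f \<in> coeffs_in Gr_point"
proof -
  have fA: "f \<in> tca_carrier d" by (rule idealD(2)[OF P_ideal f])
  obtain N where N: "\<And>j. j \<in> cols f \<Longrightarrow> j < N" using fresh_columns[OF finite_cols] by blast
  define J where "J = [N..<N + rk]"
  \<comment> \<open>The columns \<open>J\<close> provide the minors in the coefficients; those in
    \<open>M\<close> provide a square matrix \<open>X\<close> whose adjugate frees the variables of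
    the chart.\<close>
  define M where "M = [N + rk..<N + rk + rk]"
  have J: "length J = rk" "distinct J" and M: "length M = rk" "distinct M"
    by (simp_all add: J_def M_def)
  have Jf: "cols f \<inter> set J = {}" using N by (fastforce simp: J_def)
  let ?a = "Delta L M"
  let ?c = "\<lambda>\<beta>. Poly_Mapping.lookup (chart_subst L f) \<beta>"
  have c: "?c \<beta> \<in> carrier (poly_ring (tuples d rk))" for \<beta>
    by (rule coeffs_inD[OF chart_subst_carrier[OF L(1) fA]])
  have aA: "?a \<in> tca_carrier d" by (rule Delta_tca[OF tuples_set[OF L(1)]])
  have aP: "?a ^ n \<notin> P" for n
    using PVar_Gr_point[OF L] Delta_cols[of L J0 M] M tuples_length[OF L(1)]
    by (intro Delta_power L) auto
  define h where "h = gsubst (ev J) (\<lambda>(k, j). PVar (L ! k, j)) (chart_subst L f)"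
  have "colsub d (\<lambda>v. Delta L J * PVar v)"
    unfolding colsub_def by (intro allI colspan.smult colspan.base Delta_tca tuples_set[OF L(1)])
  then have "poly_subst PConst (\<lambda>v. Delta L J * PVar v) f \<in> P" by (rule colsub_closed[OF f])
  then have hP: "h \<in> P" using ideal_diff_cong[OF P_ideal scaled_cong[OF L(1) J(1) fA]] by (simp add: h_def)
  define X where "X = mat rk rk (\<lambda>(l, k). PVar (L ! l, M ! k) :: (nat \<times> nat) cpoly)"
  have X: "X \<in> carrier_mat rk rk" by (simp add: X_def)
  have detX: "det X = ?a"
    using Delta_transpose[of L M] det_transpose[OF X] tuples_length[OF L(1)] M
    by (simp add: dt_def X_def)
  have adjA: "adj_mat X $$ (k, l) \<in> tca_carrier d" if "k < rk" "l < rk" for k l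
  proof -
    have "det (mat_delete X l k) \<in> tca_carrier d"
    proof (rule subring_det[OF is_subring_tca, of _ "rk - 1"])
      show "mat_delete X l k \<in> carrier_mat (rk - 1) (rk - 1)" by (rule mat_delete_carrier[OF X])
      show "mat_delete X l k $$ (i, j) \<in> tca_carrier d" if "i < rk - 1" "j < rk - 1" for i j
        using that by (auto simp: mat_delete_def X_def intro!: PVar_tca tuples_nth[OF L(1)])
    qed
    moreover have "(- 1 :: (nat \<times> nat) cpoly) ^ (l + k) \<in> tca_carrier d"
      by (intro subring_power is_subring_tca subring_closed)
    ultimately show ?thesis
      using that X by (simp add: adj_mat_def cofactor_def subring_closed(5)[OF is_subring_tca])
  qed
  have sep: "gsubst (\<lambda>x. x) (\<lambda>v. PConst (t v))
      (gsubst (\<lambda>F. PConst (ev J F)) (\<lambda>v. PConst ?a * PVar v) (chart_subst L f)) \<in> P" for t :: "nat \<times> nat \<Rightarrow> complex"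
  proof -
    \<comment> \<open>As \<open>X\<close> times its adjugate is \<open>det X\<close>, these
      coefficients make the variable in row \<open>L ! l\<close> and column \<open>j\<close> equal
      to \<open>det X\<close> times the free scalar \<open>t (l, j)\<close>.\<close>
    define s where "s = (\<lambda>k j. \<Sum>l<rk. adj_mat X $$ (k, l) * PConst (t (l, j)))"
    \<comment> \<open>The columns in \<open>J\<close> stay fixed, and with them the coefficients
      \<open>ev J\<close>.\<close>
    define \<rho> where "\<rho> = (\<lambda>(i, j). if j \<in> set J then PVar (i, j) else \<Sum>k<rk. s k j * PVar (i, M ! k))"
    have sA: "s k j \<in> tca_carrier d" if "k < rk" for k j
      unfolding s_def using that
      by (intro subring_sum[OF is_subring_tca] subring_closed(5)[OF is_subring_tca] adjA PConst_tca) auto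
    have "colsub d \<rho>"
      unfolding colsub_def
    proof
      fix j
      have "(\<lambda>i. \<Sum>k<rk. s k j * PVar (i, M ! k)) \<in> colspan d"
        by (intro colspan_sum colspan.smult colspan.base sA) simp
      then show "(\<lambda>i. \<rho> (i, j)) \<in> colspan d" by (cases "j \<in> set J") (simp_all add: \<rho>_def colspan.base)
    qed
    then have "poly_subst PConst \<rho> h \<in> P" by (rule colsub_closed[OF hP])
    also have "poly_subst PConst \<rho> h = gsubst (ev J) (\<lambda>v. ?a * PConst (t v)) (chart_subst L f)"
      unfolding h_def hom_gsubst[OF comm_ring_hom_subst]
    proof (rule gsubst_cong)
      show "poly_subst PConst \<rho> (ev J (?c \<beta>)) = ev J (?c \<beta>)" for \<beta>
        by (rule ev_subst[OF c J(1) J(1)]) (simp add: \<rho>_def J(1))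
      fix v assume "v \<in> gvars (chart_subst L f)"
      then obtain l j where v: "v = (l, j)" "l < rk" "j \<in> cols f"
        using chart_subst_gvars[of L f] tuples_length[OF L(1)] by (cases v) auto
      have "\<rho> (L ! l, j) = (\<Sum>k<rk. \<Sum>l'<rk. X $$ (l, k) * adj_mat X $$ (k, l') * PConst (t (l', j)))"
        using v Jf by (auto simp: \<rho>_def s_def X_def sum_distrib_left sum_distrib_right ac_simps intro!: sum.cong)
      also have "\<dots> = (\<Sum>l'<rk. (\<Sum>k<rk. X $$ (l, k) * adj_mat X $$ (k, l')) * PConst (t (l', j)))"
        by (subst sum.swap) (simp add: sum_distrib_right)
      also have "\<dots> = (\<Sum>l'<rk. (if l = l' then det X else 0) * PConst (t (l', j)))"
        by (intro sum.cong arg_cong2[where f = "(*)"] refl adj_mat_sum[OF X v(2)]) simp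
      also have "\<dots> = (\<Sum>l'<rk. if l' = l then det X * PConst (t (l', j)) else 0)"
        by (intro sum.cong) auto
      also have "\<dots> = ?a * PConst (t (l, j))" using v(2) by (simp add: detX)
      finally show "poly_subst PConst \<rho> (case v of (k, j) \<Rightarrow> PVar (L ! k, j)) = ?a * PConst (t v)"
        by (simp add: v(1) poly_subst_PVar)
    qed
    also have "\<dots> = gsubst (\<lambda>x. x) (\<lambda>v. PConst (t v))
        (gsubst (\<lambda>F. PConst (ev J F)) (\<lambda>v. PConst ?a * PVar v) (chart_subst L f))"
    proof -
      have id: "comm_ring_hom (\<lambda>x :: (nat \<times> nat) cpoly. x)" by (rule comm_ring_hom_id)
      interpret comm_ring_hom "gsubst (\<lambda>x :: (nat \<times> nat) cpoly. x) (\<lambda>v :: nat \<times> nat. PConst (t v))"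
        by (rule comm_ring_hom_gsubst[OF id])
      show ?thesis
        unfolding hom_gsubst[OF comm_ring_hom_axioms] by (rule gsubst_cong) (simp_all add: id hom_distribs)
    qed
    finally show ?thesis .
  qed
  \<comment> \<open>Interpolation in \<open>t\<close> isolates one coefficient, multiplied by a
    power of \<open>?a\<close>; this power lives in the columns \<open>M\<close> and cancels by
    disjointness.\<close>
  have "?c \<beta> \<in> Gr_point" for \<beta>
  proof -
    have "?a ^ mon_deg (\<lambda>_. 1) \<beta> * ev J (?c \<beta>) \<in> P"
      using interpolation_poly[OF P_subspace sep, of \<beta>]
      unfolding lookup_gsubst_coeff_scale[OF comm_ring_hom_ev] .
    moreover have "?a ^ n \<in> carrier (poly_ring ({..<d} \<times> set M))" for n
      using cols_Delta[of L M] aA M tuples_length[OF L(1)]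
      by (intro subring_power is_subring_poly) (simp add: carrier_cols)
    moreover have "set M \<inter> set J = {}" by (auto simp: M_def J_def)
    ultimately have "ev J (?c \<beta>) \<in> P"
      using disjoint_primeI[OF _ ev_carrier[OF c J(1)]] aP by blast
    then have "Delta L0 J ^ 0 * ev J (?c \<beta>) \<in> P" by simp
    from ev_rename_in[OF c J _ this, of J0] have "Delta L0 J0 ^ 0 * ev J0 (?c \<beta>) \<in> P" by simp
    then have "ev J0 (?c \<beta>) \<in> sat J0" using ev_tca[OF c, of J0] unfolding sat_def by (intro CollectI conjI exI[of _ 0]) auto
    then show ?thesis using c by (simp only: Gr_point_homdeg[OF chart_subst_homdeg])
  qed
  then show ?thesis by (simp add: coeffs_in_def)
qed

end

lemma canonical_map_alt: "f \<in> canonical_map d (r, p) \<longleftrightarrow> f \<in> tca_carrier d \<and>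
    (\<forall>L\<in>tuples d r. PVar L \<notin> p \<longrightarrow> chart_subst L f \<in> coeffs_in p)"
  by (simp add: canonical_map_def coeffs_in_def)

theorem canonical_map_surj:
  assumes "GL_prime d P" shows "\<exists>x\<in>total_Gr d. canonical_map d x = P"
proof -
  interpret gl_prime d P by unfold_locales (rule assms)
  have "canonical_map d (rk, Gr_point) = P"
    using in_P_if_chart chart_if_in_P PVar_L0 L0(1) idealD(2)[OF P_ideal]
    by (auto simp: set_eq_iff canonical_map_alt)
  then show ?thesis using Gr_point_Gr rk_le by (auto simp: total_Gr_def)
qed

section \<open>The primes attached to points of the Grassmannians\<close>

text \<open>The chart substitution for coordinates \<open>u\<close> in any ring, so that both
  quotients of a flag can be treated over the coordinate ring of the flag variety.\<close>

definition gchart :: "(complex \<Rightarrow> 'c::comm_ring_1) \<Rightarrow> (nat list \<Rightarrow> 'c) \<Rightarrow> nat list \<Rightarrow>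
    (nat \<times> nat) cpoly \<Rightarrow> ((nat \<times> nat) \<Rightarrow>\<^sub>0 nat) \<Rightarrow>\<^sub>0 'c" where
  "gchart \<phi> u L f =
    gsubst (\<lambda>c. PConst (\<phi> c)) (\<lambda>(i, j). \<Sum>k<length L. PConst (u (L[k := i])) * PVar (k, j)) f"

lemma chart_subst_gchart: "chart_subst L f = gchart PConst PVar L f"
  by (simp add: chart_subst_gsubst gchart_def)

text \<open>If the lines \<open>u\<close> and \<open>v\<close> satisfy the relations of a flag, then the second quotient factors through the first.\<close>

lemma gchart_change:
  fixes \<phi> :: "complex \<Rightarrow> 'c::comm_ring_1"
  assumes Q: "is_prime C Q" and \<phi>: "comm_ring_hom \<phi>" "\<And>c. \<phi> c \<in> C"
    and uM: "u M \<in> C" "u M \<notin> Q"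
    and u: "\<And>l i. l < length M \<Longrightarrow> i < d \<Longrightarrow> u (M[l := i]) \<in> C"
    and v: "\<And>k i. k < length L \<Longrightarrow> i < d \<Longrightarrow> v (L[k := i]) \<in> C"
    and M: "\<And>l. l < length M \<Longrightarrow> M ! l < d"
    and rel: "\<And>k i. k < length L \<Longrightarrow> i < d \<Longrightarrow>
      u M * v (L[k := i]) - (\<Sum>l<length M. v (L[k := M ! l]) * u (M[l := i])) \<in> Q"
    and f: "f \<in> tca_carrier d" and mem: "gchart \<phi> u M f \<in> coeffs_in Q"
  shows "gchart \<phi> v L f \<in> coeffs_in Q"
proof -
  note I = primeD(1)[OF Q]
  have C: "is_subring C" by (rule idealD(1)[OF I])
  have C': "is_subring (coeffs_in C :: (((nat \<times> nat) \<Rightarrow>\<^sub>0 nat) \<Rightarrow>\<^sub>0 'c) set)" by (rule is_subring_coeffs_in[OF C])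
  have I': "is_ideal (coeffs_in C) (coeffs_in Q :: (((nat \<times> nat) \<Rightarrow>\<^sub>0 nat) \<Rightarrow>\<^sub>0 'c) set)"
    by (rule is_ideal_coeffs_in[OF I])
  have P: "comm_ring_hom (PConst :: 'c \<Rightarrow> (nat \<times> nat \<Rightarrow>\<^sub>0 nat) \<Rightarrow>\<^sub>0 'c)" by (rule comm_ring_hom_PConst)
  interpret P: comm_ring_hom "PConst :: 'c \<Rightarrow> (nat \<times> nat \<Rightarrow>\<^sub>0 nat) \<Rightarrow>\<^sub>0 'c" by (rule P)
  have PC: "PConst a \<in> coeffs_in C" if "a \<in> C" for a :: 'c
    by (rule PConst_coeffs_in[OF that subring_closed(1)[OF C]])
  \<comment> \<open>The map from the first quotient to the second, with denominators omitted: the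
    \<open>l\<close>-th basis vector is the image of the basis vector \<open>M ! l\<close> of E. The
    default 0 keeps all values in \<open>coeffs_in C\<close>.\<close>
  define \<sigma> where "\<sigma> = (\<lambda>(l, j). if l < length M
    then \<Sum>k<length L. PConst (v (L[k := M ! l])) * PVar (k, j) else (0 :: (nat \<times> nat \<Rightarrow>\<^sub>0 nat) \<Rightarrow>\<^sub>0 'c))"
  have lin: "(\<Sum>k<length L. PConst (w k) * PVar (k, j)) \<in> coeffs_in C"
    if "\<And>k. k < length L \<Longrightarrow> w k \<in> C" for w :: "nat \<Rightarrow> 'c" and j :: nat
    by (intro subring_sum[OF C'] subring_closed(5)[OF C'] PC that PVar_coeffs_in C) simp
  have \<sigma>C: "\<sigma> v \<in> coeffs_in C" for v
    using lin v M subring_closed(1)[OF C'] by (cases v) (auto simp: \<sigma>_def)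
  have A: "gsubst PConst \<sigma> (gchart \<phi> u M f) \<in> coeffs_in Q"
    by (rule gsubst_in_ideal[OF I']) (use coeffs_inD[OF mem] idealD(3)[OF I] in \<open>auto intro: PConst_coeffs_in \<sigma>C\<close>)
  let ?A = "\<lambda>(i, j). \<Sum>k<length L. PConst (\<Sum>l<length M. v (L[k := M ! l]) * u (M[l := i])) * PVar (k, j)"
  let ?B = "\<lambda>(i, j). \<Sum>k<length L. PConst (u M * v (L[k := i])) * PVar (k, j)"
  have Aeq: "gsubst PConst \<sigma> (gchart \<phi> u M f) = gsubst (\<lambda>c. PConst (\<phi> c)) ?A f"
  proof -
    interpret S: comm_ring_hom "gsubst PConst \<sigma>" by (rule comm_ring_hom_gsubst[OF P])
    show ?thesis
      unfolding gchart_def hom_gsubst[OF S.comm_ring_hom_axioms]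
    proof (rule gsubst_cong)
      fix w :: "nat \<times> nat"
      obtain i j where w: "w = (i, j)" by (cases w)
      have "(\<Sum>l<length M. PConst (u (M[l := i])) * \<sigma> (l, j)) =
          (\<Sum>l<length M. \<Sum>k<length L. PConst (v (L[k := M ! l]) * u (M[l := i])) * PVar (k, j))"
        by (simp add: \<sigma>_def sum_distrib_left ac_simps)
      also have "\<dots> = ?A (i, j)"
        by (subst sum.swap) (simp add: P.hom_sum sum_distrib_right)
      finally show "gsubst PConst \<sigma> (case w of (i, j) \<Rightarrow> \<Sum>k<length M. PConst (u (M[k := i])) * PVar (k, j)) = ?A w"
        by (simp add: w P hom_distribs)
    qed (simp add: P)
  qed
  have diff: "gsubst (\<lambda>c. PConst (\<phi> c)) ?B f - gsubst (\<lambda>c. PConst (\<phi> c)) ?A f \<in> coeffs_in Q"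
  proof (rule gsubst_cong_ideal[OF I'])
    show "PConst (\<phi> c) \<in> coeffs_in C" for c by (rule PC[OF \<phi>(2)])
    fix w assume "w \<in> gvars f"
    then obtain i j where w: "w = (i, j)" "i < d" using f by (cases w) (auto simp: tca_carrier_iff)
    show "?B w \<in> coeffs_in C" unfolding w prod.case
      by (rule lin) (intro subring_closed(5)[OF C] uM(1) v w(2))
    show "?A w \<in> coeffs_in C" unfolding w prod.case
      by (rule lin) (intro subring_sum[OF C] subring_closed(5)[OF C] u v M w(2), simp_all)
    have "?B w - ?A w = (\<Sum>k<length L. PConst (u M * v (L[k := i]) -
        (\<Sum>l<length M. v (L[k := M ! l]) * u (M[l := i]))) * PVar (k, j))"
      unfolding w prod.case by (simp only: P.hom_minus left_diff_distrib sum_subtractf)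
    also have "\<dots> \<in> coeffs_in Q"
      by (intro ideal_sum[OF I'] idealD(6)[OF I'] PVar_coeffs_in[OF C] PConst_coeffs_in rel w(2) idealD(3)[OF I]) simp
    finally show "?B w - ?A w \<in> coeffs_in Q" .
  qed
  have "gsubst (\<lambda>c. PConst (\<phi> c)) ?B f \<in> coeffs_in Q"
    using ideal_diff_cong[OF I' diff] A unfolding Aeq by simp
  \<comment> \<open>\<open>?B\<close> scales every variable of the chart of \<open>v\<close> by
    \<open>u M\<close>; the resulting powers cancel because \<open>Q\<close> is prime and
    \<open>u M\<close> is outside it.\<close>
  also have "gsubst (\<lambda>c. PConst (\<phi> c)) ?B f = gsubst PConst (\<lambda>w. PConst (u M) * PVar w) (gchart \<phi> v L f)"
  proof -
    interpret S: comm_ring_hom "gsubst PConst (\<lambda>w :: nat \<times> nat. PConst (u M) * PVar w)" by (rule comm_ring_hom_gsubst[OF P])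
    show ?thesis
      unfolding gchart_def hom_gsubst[OF S.comm_ring_hom_axioms]
    proof (rule gsubst_cong)
      fix w :: "nat \<times> nat"
      obtain i j where w: "w = (i, j)" by (cases w)
      have "gsubst PConst (\<lambda>w. PConst (u M) * PVar w) (\<Sum>k<length L. PConst (v (L[k := i])) * PVar (k, j)) =
          (\<Sum>k<length L. PConst (v (L[k := i])) * (PConst (u M) * PVar (k, j)))"
        by (simp add: P hom_distribs)
      also have "\<dots> = ?B (i, j)" by (simp add: P.hom_mult ac_simps)
      finally show "?B w = gsubst PConst (\<lambda>w. PConst (u M) * PVar w)
          (case w of (i, j) \<Rightarrow> \<Sum>k<length L. PConst (v (L[k := i])) * PVar (k, j))" by (simp add: w)
    qed (simp add: P)
  qed
  finally have B: "gsubst PConst (\<lambda>w. PConst (u M) * PVar w) (gchart \<phi> v L f) \<in> coeffs_in Q" .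
  have "gchart \<phi> v L f \<in> coeffs_in C"
    unfolding gchart_def
  proof (rule gsubst_in[OF C'])
    fix w assume "w \<in> gvars f"
    then obtain i j where w: "w = (i, j)" "i < d" using f by (cases w) (auto simp: tca_carrier_iff)
    show "(case w of (i, j) \<Rightarrow> \<Sum>k<length L. PConst (v (L[k := i])) * PVar (k, j)) \<in> coeffs_in C"
      unfolding w prod.case by (rule lin) (intro v w(2))
  qed (rule PC[OF \<phi>(2)])
  then show ?thesis
    using coeffs_inD[OF B] primeD(3)[OF Q subring_power[OF C uM(1)]] prime_power[OF Q uM(1)] uM(2)
    unfolding coeffs_in_def lookup_gsubst_scale by blast
qed

lemma is_prime_vimage:
  assumes Q: "is_prime C' Q" and h: "comm_ring_hom h" and C: "is_subring C" "\<And>x. x \<in> C \<Longrightarrow> h x \<in> C'"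
  shows "is_prime C {x \<in> C. h x \<in> Q}"
proof -
  interpret comm_ring_hom h by (rule h)
  note I = primeD(1)[OF Q]
  show ?thesis
    unfolding is_prime_def is_ideal_def
  proof (intro conjI ballI impI C(1))
    note sub = subring_closed[OF C(1)]
    show "0 \<in> {x \<in> C. h x \<in> Q}" using idealD(3)[OF I] sub(1) by simp
    show "1 \<notin> {x \<in> C. h x \<in> Q}" using primeD(2)[OF Q] by simp
    show "a + b \<in> {x \<in> C. h x \<in> Q}" if "a \<in> {x \<in> C. h x \<in> Q}" "b \<in> {x \<in> C. h x \<in> Q}" for a b
      using that idealD(4)[OF I] sub(4) by (simp add: hom_add)
    show "a * b \<in> {x \<in> C. h x \<in> Q}" if "a \<in> C" "b \<in> {x \<in> C. h x \<in> Q}" for a b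
      using that idealD(5)[OF I C(2)] sub(5) by (simp add: hom_mult)
    show "a \<in> {x \<in> C. h x \<in> Q} \<or> b \<in> {x \<in> C. h x \<in> Q}"
      if "a \<in> C" "b \<in> C" "a * b \<in> {x \<in> C. h x \<in> Q}" for a b
      using that primeD(3)[OF Q C(2) C(2)] by (simp add: hom_mult)
  qed blast
qed

lemma homdeg_eqI: "homdeg w n f \<Longrightarrow> n = m \<Longrightarrow> homdeg w m f"
  by simp

section \<open>From a point to its prime: independence of the chart, primality, stability\<close>

locale gr_point =
  fixes d r :: nat and p :: "nat list cpoly set"
  assumes p: "p \<in> Gr d r"
begin

abbreviation "R \<equiv> carrier (poly_ring (tuples d r))"

lemma p_prime: "is_prime R p"
  using p by (simp add: Gr_def multi_Proj_def is_prime_poly)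

lemma p_ideal: "is_ideal R p"
  by (rule primeD(1)[OF p_prime])

lemma p_graded: "F \<in> p \<Longrightarrow> hom_component (\<lambda>_. 1) n F \<in> p"
  using p by (simp add: Gr_def multi_Proj_def graded_set_def)

lemma p_relation: "F \<in> R \<Longrightarrow> homdeg (\<lambda>_. 1) n F \<Longrightarrow> poly_subst PConst (minor r) F = 0 \<Longrightarrow> F \<in> p"
  using p by (auto simp: Gr_def multi_Proj_def pluecker_relations_def homogeneous_homdeg)

lemma good_tuple: "\<exists>L\<in>tuples d r. PVar L \<notin> p"
  using p by (auto simp: Gr_def multi_Proj_def)

lemma PVar_R: "T \<in> tuples d r \<Longrightarrow> PVar T \<in> R"
  by (simp add: carrier_poly_ring)

text \<open>A quadric in the coordinates that \<open>dt_exchange\<close> makes vanish on all minors,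
  hence one of the defining relations.\<close>

lemma exchange_relation:
  assumes L: "L \<in> tuples d r" and M: "M \<in> tuples d r" and k: "k < r" and i: "i < d"
  shows "PVar M * PVar (L[k := i]) - (\<Sum>l<r. PVar (L[k := M ! l]) * PVar (M[l := i])) \<in> p"
proof (rule p_relation)
  note sub = subring_closed[OF is_subring_poly]
  show "PVar M * PVar (L[k := i]) - (\<Sum>l<r. PVar (L[k := M ! l]) * PVar (M[l := i])) \<in> R"
    by (intro sub(5,6) subring_sum[OF is_subring_poly] PVar_R M tuples_update L i tuples_nth[OF M]) simp
  show "homdeg (\<lambda>_. 1) (1 + 1) (PVar M * PVar (L[k := i]) - (\<Sum>l<r. PVar (L[k := M ! l]) * PVar (M[l := i])))"
    by (intro homdeg_diff homdeg_sum homdeg_mult homdeg_PVar)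
  interpret comm_ring_hom "poly_subst PConst (minor r)" by (rule comm_ring_hom_subst)
  note dts = minor_dt[of _ r] tuples_length[OF L] tuples_length[OF M]
  show "poly_subst PConst (minor r) (PVar M * PVar (L[k := i]) - (\<Sum>l<r. PVar (L[k := M ! l]) * PVar (M[l := i]))) = 0"
    using dt_exchange[of L M k "\<lambda>k i. PVar (k, i)" i] k
    by (simp add: hom_distribs poly_subst_PVar dts)
qed

text \<open>\<open>dt_compound\<close> as a relation between coordinates: where
  \<open>PVar L\<close> is invertible, every coordinate is determined by the
  \<open>PVar (L[m := i])\<close>.\<close>

lemma compound_relation:
  assumes L: "L \<in> tuples d r" and T: "T \<in> tuples d r"
  shows "PVar L * det (mat r r (\<lambda>(m, l). PVar (L[m := T ! l]))) - PVar L ^ r * PVar T \<in> p"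
proof (rule p_relation)
  note sub = subring_closed[OF is_subring_poly]
  let ?N = "mat r r (\<lambda>(m, l). PVar (L[m := T ! l])) :: nat list cpoly mat"
  have "det ?N \<in> R"
    by (rule subring_det[OF is_subring_poly, of _ r]) (use tuples_update[OF L] tuples_nth[OF T] in \<open>auto simp: carrier_poly_ring\<close>)
  then show "PVar L * det ?N - PVar L ^ r * PVar T \<in> R"
    by (intro sub(5,6) subring_power[OF is_subring_poly] PVar_R L T)
  have N: "homdeg (\<lambda>_. 1) r (det ?N)"
    by (rule homdeg_det) (use homdeg_PVar[of "\<lambda>_. 1"] in auto)
  show "homdeg (\<lambda>_. 1) (1 + r) (PVar L * det ?N - PVar L ^ r * PVar T)"
  proof (rule homdeg_diff)
    show "homdeg (\<lambda>_. 1) (1 + r) (PVar L * det ?N)" by (intro homdeg_mult homdeg_PVar N)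
    have "homdeg (\<lambda>_. 1) (r * 1 + 1) (PVar L ^ r * PVar T)" by (intro homdeg_mult homdeg_power homdeg_PVar)
    then show "homdeg (\<lambda>_. 1) (1 + r) (PVar L ^ r * PVar T)" by (rule homdeg_eqI) simp
  qed
  interpret comm_ring_hom "poly_subst PConst (minor r)" by (rule comm_ring_hom_subst)
  note len = tuples_length[OF L] tuples_length[OF T]
  have "poly_subst PConst (minor r) (det ?N) = det (mat r r (\<lambda>(m, l). dt (\<lambda>k i. PVar (k, i)) (L[m := T ! l])))"
    unfolding hom_det_mat[OF comm_ring_hom_subst]
    by (intro arg_cong[where f = det] eq_matI) (auto simp: poly_subst_PVar minor_dt len)
  then show "poly_subst PConst (minor r) (PVar L * det ?N - PVar L ^ r * PVar T) = 0"
    using dt_compound[of T L "\<lambda>k i. PVar (k, i)"]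
    by (simp add: hom_distribs poly_subst_PVar minor_dt len)
qed

abbreviation "PP \<equiv> canonical_map d (r, p)"

text \<open>One chart decides: by \<open>exchange_relation\<close> the change to any other chart is
  the case of \<open>gchart_change\<close> in which both quotients coincide.\<close>

lemma PP_iff:
  assumes L: "L \<in> tuples d r" "PVar L \<notin> p"
  shows "f \<in> PP \<longleftrightarrow> f \<in> tca_carrier d \<and> chart_subst L f \<in> coeffs_in p"
proof -
  have "chart_subst M f \<in> coeffs_in p"
    if f: "f \<in> tca_carrier d" "chart_subst L f \<in> coeffs_in p" and M: "M \<in> tuples d r" for M
    unfolding chart_subst_gchart
  proof (rule gchart_change[OF p_prime comm_ring_hom_PConst])
    show "gchart PConst PVar L f \<in> coeffs_in p" using f(2) by (simp add: chart_subst_gchart)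
    show "PVar L * PVar (M[k := i]) - (\<Sum>l<length L. PVar (M[k := L ! l]) * PVar (L[l := i])) \<in> p"
      if "k < length M" "i < d" for k i
      using exchange_relation[OF M L(1)] that tuples_length[OF L(1)] tuples_length[OF M] by simp
  qed (use L f M in \<open>auto simp: PVar_R tuples_update tuples_nth tuples_length carrier_poly_ring\<close>)
  then show ?thesis using L by (auto simp: canonical_map_alt)
qed

lemma coeffs_p_prime: "is_prime (coeffs_in R) (coeffs_in p :: (((nat \<times> nat) \<Rightarrow>\<^sub>0 nat) \<Rightarrow>\<^sub>0 nat list cpoly) set)"
  by (rule is_prime_coeffs_in[OF p_prime])

lemma PP_prime: "is_prime (tca_carrier d) PP"
proof -
  obtain L where L: "L \<in> tuples d r" "PVar L \<notin> p" using good_tuple by blast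
  have "is_prime (tca_carrier d) {f \<in> tca_carrier d. chart_subst L f \<in> coeffs_in p}"
    by (rule is_prime_vimage[OF coeffs_p_prime comm_ring_hom_chart is_subring_tca chart_subst_carrier[OF L(1)]])
  also have "{f \<in> tca_carrier d. chart_subst L f \<in> coeffs_in p} = PP" using PP_iff[OF L] by blast
  finally show ?thesis .
qed

text \<open>The group acts on the index j and the chart on the index i, so the chart substitution
  carries the action to one on the y_kj.\<close>

lemma PP_GL:
  assumes f: "f \<in> PP" shows "GL_act g f \<in> PP"
proof -
  obtain L where L: "L \<in> tuples d r" "PVar L \<notin> p" using good_tuple by blast
  have f': "f \<in> tca_carrier d" "chart_subst L f \<in> coeffs_in p" using f PP_iff[OF L] by blast+
  define \<sigma> where "\<sigma> = (\<lambda>(k, j). \<Sum>m\<in>{m. g m j \<noteq> 0}. PConst (PConst (g m j)) * PVar (k, m) ::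
    ((nat \<times> nat) \<Rightarrow>\<^sub>0 nat) \<Rightarrow>\<^sub>0 nat list cpoly)"
  have P: "comm_ring_hom (PConst :: nat list cpoly \<Rightarrow> (nat \<times> nat \<Rightarrow>\<^sub>0 nat) \<Rightarrow>\<^sub>0 nat list cpoly)"
    by (rule comm_ring_hom_PConst)
  have "chart_subst L (GL_act g f) = gsubst PConst \<sigma> (chart_subst L f)"
  proof -
    interpret C: comm_ring_hom "chart_subst L" by (rule comm_ring_hom_chart)
    interpret S: comm_ring_hom "gsubst PConst \<sigma>" by (rule comm_ring_hom_gsubst[OF P])
    have c: "chart_subst L (PConst c) = PConst (PConst c)" for c
      by (simp add: chart_subst_gsubst comm_ring_hom_PConst2)
    have v: "chart_subst L (PVar (i, j)) = (\<Sum>k<length L. PConst (PVar (L[k := i])) * PVar (k, j))" for i j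
      by (simp add: chart_subst_gsubst comm_ring_hom_PConst2)
    show ?thesis
      unfolding GL_act_def poly_subst_gsubst hom_gsubst[OF comm_ring_hom_chart]
      unfolding chart_subst_gsubst[of L f] hom_gsubst[OF S.comm_ring_hom_axioms] c
    proof (rule gsubst_cong)
      fix w :: "nat \<times> nat"
      obtain i j where w: "w = (i, j)" by (cases w)
      have "(\<Sum>m\<in>{m. g m j \<noteq> 0}. PConst (PConst (g m j)) * (\<Sum>k<length L. PConst (PVar (L[k := i])) * PVar (k, m))) =
          (\<Sum>k<length L. PConst (PVar (L[k := i])) * \<sigma> (k, j))"
        unfolding \<sigma>_def prod.case sum_distrib_left by (subst sum.swap) (simp add: ac_simps)
      then show "chart_subst L (case w of (i, j) \<Rightarrow> \<Sum>k\<in>{k. g k j \<noteq> 0}. PConst (g k j) * PVar (i, k)) =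
          gsubst PConst \<sigma> (case w of (i, j) \<Rightarrow> \<Sum>k<length L. PConst (PVar (L[k := i])) * PVar (k, j))"
        by (simp add: w P hom_distribs hom_distribs c v)
    qed (simp add: P)
  qed
  also have "\<dots> \<in> coeffs_in p"
  proof (rule gsubst_in_ideal[OF primeD(1)[OF coeffs_p_prime]])
    show "PConst (Poly_Mapping.lookup (chart_subst L f) m) \<in> coeffs_in p" for m
      by (rule PConst_coeffs_in[OF coeffs_inD[OF f'(2)] idealD(3)[OF p_ideal]])
    have C': "is_subring (coeffs_in R :: (((nat \<times> nat) \<Rightarrow>\<^sub>0 nat) \<Rightarrow>\<^sub>0 nat list cpoly) set)"
      by (rule is_subring_coeffs_in[OF is_subring_poly])
    show "\<sigma> v \<in> coeffs_in R" for v
      unfolding \<sigma>_def case_prod_unfold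
      by (intro subring_sum[OF C'] subring_closed(5)[OF C'] PVar_coeffs_in is_subring_poly PConst_coeffs_in
          subring_closed(1)[OF is_subring_poly]) (simp add: carrier_poly_ring)
  qed
  finally show ?thesis using PP_iff[OF L] GL_act_closed[OF f'(1)] by blast
qed

lemma PP_GL_prime: "GL_prime d PP"
  unfolding GL_prime_def
proof (intro conjI allI impI)
  note I = primeD(1)[OF PP_prime]
  show "GL_ideal d PP"
    using I PP_GL by (simp add: GL_ideal_def tca_A_def is_ideal_poly)
  show "PP \<noteq> tca_carrier d" using primeD(2)[OF PP_prime] subring_closed(2)[OF is_subring_tca] by blast
  \<comment> \<open>Primality among stable ideals follows from ordinary primality.\<close>
  fix I J assume IJ: "GL_ideal d I" "GL_ideal d J" "ideal_prod (tca_A d) I J \<subseteq> PP"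
  show "I \<subseteq> PP \<or> J \<subseteq> PP"
  proof (rule ccontr)
    assume "\<not> (I \<subseteq> PP \<or> J \<subseteq> PP)"
    then obtain f g where fg: "f \<in> I" "f \<notin> PP" "g \<in> J" "g \<notin> PP" by blast
    have "f * g \<in> PP"
      using ideal_prod.prod[OF fg(1,3), of "tca_A d"] IJ(3) by (auto simp: tca_A_def)
    then show False
      using primeD(3)[OF PP_prime] fg GL_ideal_subset[OF IJ(1)] GL_ideal_subset[OF IJ(2)] by blast
  qed
qed

text \<open>The point can be read off from its prime. By multiplicativity of determinants the chart
  turns the minor with rows \<open>T\<close> into \<open>Y * PConst (N T)\<close>, where
  \<open>Y\<close> is a generic determinant outside the extension of \<open>p\<close>, and
  \<open>compound_relation\<close> replaces \<open>N T\<close> by the coordinate of \<open>T\<close>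
  up to powers of \<open>PVar L\<close>.\<close>

lemma PP_ev_iff:
  assumes J: "length J = r" "distinct J" and F: "F \<in> R" "homdeg (\<lambda>_. 1) n F"
  shows "ev J F \<in> PP \<longleftrightarrow> F \<in> p"
proof -
  obtain L where L: "L \<in> tuples d r" "PVar L \<notin> p" using good_tuple by blast
  let ?C = "coeffs_in R :: (((nat \<times> nat) \<Rightarrow>\<^sub>0 nat) \<Rightarrow>\<^sub>0 nat list cpoly) set"
  note I' = primeD(1)[OF coeffs_p_prime]
  have C: "is_subring R" by (rule is_subring_poly)
  have C': "is_subring ?C" by (rule is_subring_coeffs_in[OF C])
  have P: "comm_ring_hom (PConst :: nat list cpoly \<Rightarrow> (nat \<times> nat \<Rightarrow>\<^sub>0 nat) \<Rightarrow>\<^sub>0 nat list cpoly)"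
    by (rule comm_ring_hom_PConst)
  define N where "N = (\<lambda>T. det (mat r r (\<lambda>(m, l). PVar (L[m := T ! l])) :: nat list cpoly mat))"
  define Y where "Y = (det (mat r r (\<lambda>(k, m). PVar (m, J ! k))) :: ((nat \<times> nat) \<Rightarrow>\<^sub>0 nat) \<Rightarrow>\<^sub>0 nat list cpoly)"
  have NR: "N T \<in> R" if "T \<in> tuples d r" for T
    unfolding N_def by (rule subring_det[OF C, of _ r])
      (use tuples_update[OF L(1)] tuples_nth[OF that] in \<open>auto simp: carrier_poly_ring\<close>)
  have chart: "chart_subst L (ev J F) = Y ^ n * PConst (gsubst PConst N F)"
  proof -
    have "chart_subst L (Delta T J) = Y * PConst (N T)" if "T \<in> gvars F" for T
    proof -
      have T: "T \<in> tuples d r" using that F(1) by (auto simp: carrier_tuples)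
      have "chart_subst L (Delta T J) =
          det (mat r r (\<lambda>(k, l). \<Sum>m<r. PVar (m, J ! k) * PConst (PVar (L[m := T ! l]))))"
        unfolding Delta_def dt_def hom_det_mat[OF comm_ring_hom_chart]
        by (simp add: case_prod_unfold chart_subst_gsubst comm_ring_hom_PConst2 tuples_length[OF T] tuples_length[OF L(1)] mult.commute)
      also have "\<dots> = Y * det (mat r r (\<lambda>(m, l). PConst (PVar (L[m := T ! l]))))"
        unfolding det_mult_explicit Y_def ..
      also have "det (mat r r (\<lambda>(m, l). PConst (PVar (L[m := T ! l])))) =
          (PConst (N T) :: ((nat \<times> nat) \<Rightarrow>\<^sub>0 nat) \<Rightarrow>\<^sub>0 nat list cpoly)"
        unfolding N_def hom_det_mat[OF P] by (simp add: case_prod_unfold)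
      finally show ?thesis .
    qed
    then have "chart_subst L (ev J F) = gsubst (\<lambda>c. PConst (PConst c)) (\<lambda>T. Y * PConst (N T)) F"
      unfolding ev_def hom_gsubst[OF comm_ring_hom_chart]
      by (intro gsubst_cong) (auto simp: chart_subst_gsubst comm_ring_hom_PConst2)
    also have "\<dots> = Y ^ n * gsubst (\<lambda>c. PConst (PConst c)) (\<lambda>T. PConst (N T)) F"
      by (rule gsubst_scale_homdeg[OF F(2)])
    also have "gsubst (\<lambda>c. PConst (PConst c)) (\<lambda>T. PConst (N T)) F =
        (PConst (gsubst PConst N F) :: ((nat \<times> nat) \<Rightarrow>\<^sub>0 nat) \<Rightarrow>\<^sub>0 nat list cpoly)"
      unfolding hom_gsubst[OF P] ..
    finally show ?thesis .
  qed
  have Yp: "Y \<notin> coeffs_in p"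
  proof
    assume Y: "Y \<in> coeffs_in p"
    \<comment> \<open>Specialising the y_kj to the identity matrix in the columns \<open>J\<close>
      sends \<open>Y\<close> to 1; this uses that \<open>J\<close> is distinct.\<close>
    define \<sigma> where "\<sigma> = (\<lambda>(m, j). if j = J ! m then 1 else 0 :: ((nat \<times> nat) \<Rightarrow>\<^sub>0 nat) \<Rightarrow>\<^sub>0 nat list cpoly)"
    have "gsubst PConst \<sigma> Y \<in> coeffs_in p"
    proof (rule gsubst_in_ideal[OF I'])
      show "PConst (Poly_Mapping.lookup Y m) \<in> coeffs_in p" for m
        by (rule PConst_coeffs_in[OF coeffs_inD[OF Y] idealD(3)[OF p_ideal]])
      show "\<sigma> v \<in> ?C" for v using subring_closed(1,2)[OF C'] by (auto simp: \<sigma>_def case_prod_unfold)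
    qed
    also have "gsubst PConst \<sigma> Y = det (mat r r (\<lambda>(k, m). if k = m then 1 else 0))"
      unfolding Y_def hom_det_mat[OF comm_ring_hom_gsubst[OF P]]
      by (intro arg_cong[where f = det] eq_matI) (auto simp: P \<sigma>_def nth_eq_iff_index_eq J)
    also have "\<dots> = 1" unfolding det_diagonal by simp
    finally show False using primeD(2)[OF coeffs_p_prime] by simp
  qed
  have YC: "Y \<in> ?C"
    unfolding Y_def by (rule subring_det[OF C', of _ r]) (auto intro: PVar_coeffs_in[OF C])
  have NF: "gsubst PConst N F \<in> R"
  proof (rule gsubst_in[OF C])
    show "N T \<in> R" if "T \<in> gvars F" for T using F(1) that by (intro NR) (auto simp: carrier_tuples)
  qed (simp add: carrier_poly_ring)
  have "ev J F \<in> PP \<longleftrightarrow> Y ^ n * PConst (gsubst PConst N F) \<in> coeffs_in p"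
    using PP_iff[OF L] ev_tca[OF F(1) J(1)] by (simp add: chart)
  also have "\<dots> \<longleftrightarrow> PConst (gsubst PConst N F) \<in> (coeffs_in p :: (((nat \<times> nat) \<Rightarrow>\<^sub>0 nat) \<Rightarrow>\<^sub>0 nat list cpoly) set)"
    using primeD(3)[OF coeffs_p_prime subring_power[OF C' YC, of n] PConst_coeffs_in[OF NF subring_closed(1)[OF C]]]
      prime_power[OF coeffs_p_prime YC] Yp idealD(5)[OF I' subring_power[OF C' YC, of n]] by blast
  also have "\<dots> \<longleftrightarrow> gsubst PConst N F \<in> p"
    by (rule PConst_coeffs_in_iff[OF idealD(3)[OF p_ideal]])
  \<comment> \<open>\<open>F\<close> has degree n, so this factor turns each \<open>N T\<close> into
    \<open>PVar L * N T\<close>, the form in which \<open>compound_relation\<close> applies.\<close>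
  also have "\<dots> \<longleftrightarrow> PVar L ^ n * gsubst PConst N F \<in> p"
    using primeD(3)[OF p_prime subring_power[OF C PVar_R[OF L(1)], of n] NF]
      prime_power[OF p_prime PVar_R[OF L(1)]] L(2) idealD(5)[OF p_ideal subring_power[OF C PVar_R[OF L(1)], of n]] by blast
  also have "\<dots> \<longleftrightarrow> (PVar L ^ r) ^ n * F \<in> p"
  proof (rule ideal_diff_cong[OF p_ideal])
    have "gsubst PConst (\<lambda>T. PVar L * N T) F - gsubst PConst (\<lambda>T. PVar L ^ r * PVar T) F \<in> p"
    proof (rule gsubst_cong_ideal[OF p_ideal])
      fix T assume "T \<in> gvars F"
      then have T: "T \<in> tuples d r" using F(1) by (auto simp: carrier_tuples)
      show "PVar L * N T - PVar L ^ r * PVar T \<in> p" unfolding N_def by (rule compound_relation[OF L(1) T])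
      show "PVar L * N T \<in> R" by (rule subring_closed(5)[OF C PVar_R[OF L(1)] NR[OF T]])
      show "PVar L ^ r * PVar T \<in> R"
        by (rule subring_closed(5)[OF C subring_power[OF C PVar_R[OF L(1)]] PVar_R[OF T]])
    qed (simp add: carrier_poly_ring)
    then show "PVar L ^ n * gsubst PConst N F - (PVar L ^ r) ^ n * F \<in> p"
      unfolding gsubst_scale_homdeg[OF F(2)] gsubst_ident .
  qed
  also have "\<dots> \<longleftrightarrow> F \<in> p"
    using primeD(3)[OF p_prime subring_power[OF C subring_power[OF C PVar_R[OF L(1)]], of r n] F(1)]
      prime_power[OF p_prime PVar_R[OF L(1)]] prime_power[OF p_prime subring_power[OF C PVar_R[OF L(1)]]] L(2)
      idealD(5)[OF p_ideal subring_power[OF C subring_power[OF C PVar_R[OF L(1)]], of r n]] by blast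
  finally show ?thesis .
qed

text \<open>On the chart the generic matrix factors through a space of dimension
  \<open>r\<close>.\<close>

lemma PP_big_minor:
  assumes T: "T \<in> tuples d s" and rs: "r < s"
  shows "Delta T J \<in> PP"
proof -
  obtain L where L: "L \<in> tuples d r" "PVar L \<notin> p" using good_tuple by blast
  have "chart_subst L (Delta T J) =
      det (mat s s (\<lambda>(k, l). \<Sum>m<r. PVar (m, J ! k) * PConst (PVar (L[m := T ! l]))))"
    unfolding Delta_def dt_def hom_det_mat[OF comm_ring_hom_chart]
    by (simp add: case_prod_unfold chart_subst_gsubst comm_ring_hom_PConst2 tuples_length[OF T] tuples_length[OF L(1)] mult.commute)
  also have "\<dots> = 0" by (rule det_low_rank[OF rs])
  finally have "chart_subst L (Delta T J) \<in> coeffs_in p"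
    using idealD(3)[OF primeD(1)[OF coeffs_p_prime]] by simp
  then show ?thesis using PP_iff[OF L] Delta_tca[OF tuples_set[OF T]] by blast
qed

end

section \<open>Bijectivity of the canonical map\<close>

lemma canonical_map_rank:
  assumes "p \<in> Gr d r" "q \<in> Gr d s" "canonical_map d (s, q) \<subseteq> canonical_map d (r, p)"
  shows "r \<le> s"
proof (rule ccontr)
  assume "\<not> r \<le> s"
  interpret p: gr_point d r p by unfold_locales (rule assms)
  interpret q: gr_point d s q by unfold_locales (rule assms)
  obtain L where L: "L \<in> tuples d r" "PVar L \<notin> p" using p.good_tuple by blast
  \<comment> \<open>A minor of size \<open>r\<close> vanishes at every point of smaller rank, while
    this one does not vanish at \<open>p\<close>.\<close>
  have "Delta L [0..<r] \<in> canonical_map d (s, q)"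
    using q.PP_big_minor[OF L(1)] \<open>\<not> r \<le> s\<close> by simp
  then have "ev [0..<r] (PVar L) \<in> canonical_map d (r, p)" using assms(3) by (auto simp: ev_PVar)
  then show False using p.PP_ev_iff[OF _ _ p.PVar_R[OF L(1)] homdeg_PVar] L(2) by simp
qed

lemma canonical_map_same_rank:
  assumes "p \<in> Gr d r" "q \<in> Gr d r" "canonical_map d (r, q) \<subseteq> canonical_map d (r, p)"
  shows "q \<subseteq> p"
proof
  interpret p: gr_point d r p by unfold_locales (rule assms)
  interpret q: gr_point d r q by unfold_locales (rule assms)
  fix F assume F: "F \<in> q"
  then have FR: "F \<in> p.R" using idealD(2)[OF q.p_ideal] by blast
  show "F \<in> p"
  proof (rule ideal_of_components[OF p.p_ideal, where w = "\<lambda>_. 1"])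
    fix n
    let ?F = "hom_component (\<lambda>_. 1) n F"
    have "?F \<in> p.R" "homdeg (\<lambda>_. 1) n ?F" "?F \<in> q"
      using hom_component_closed[OF FR] homdeg_hom_component q.p_graded[OF F] by blast+
    then show "?F \<in> p"
      using q.PP_ev_iff[of "[0..<r]" ?F n] p.PP_ev_iff[of "[0..<r]" ?F n] assms(3) by auto
  qed
qed

lemma canonical_map_inj: "inj_on (canonical_map d) (total_Gr d)"
proof (rule inj_onI)
  fix x y assume xy: "x \<in> total_Gr d" "y \<in> total_Gr d" "canonical_map d x = canonical_map d y"
  obtain r p s q where x: "x = (r, p)" and y: "y = (s, q)" by (cases x, cases y)
  have p: "p \<in> Gr d r" and q: "q \<in> Gr d s" using xy by (auto simp: x y total_Gr_def)
  have "r \<le> s" "s \<le> r"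
    using canonical_map_rank[OF p q] canonical_map_rank[OF q p] xy(3) by (simp_all add: x y)
  then have "r = s" by simp
  then have "p = q"
    using canonical_map_same_rank[of p d r q] canonical_map_same_rank[of q d r p] p q xy(3) by (simp add: x y)
  then show "x = y" using \<open>r = s\<close> by (simp add: x y)
qed

lemma canonical_map_Spec: "x \<in> total_Gr d \<Longrightarrow> canonical_map d x \<in> Spec_A d"
  by (auto simp: total_Gr_def Spec_A_def intro: gr_point.PP_GL_prime gr_point.intro)

lemma canonical_map_bij: "bij_betw (canonical_map d) (total_Gr d) (Spec_A d)"
  unfolding bij_betw_def using canonical_map_inj canonical_map_Spec canonical_map_surj
  by (fastforce simp: Spec_A_def)

section \<open>Prime ideals avoiding a multiplicative set\<close>

lemma ideal_adjoin:
  assumes I: "is_ideal C I" and a: "a \<in> C"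
  shows "is_ideal C {x. \<exists>q\<in>I. \<exists>c\<in>C. x = q + c * a}"
  unfolding is_ideal_def
proof (intro conjI ballI idealD(1)[OF I])
  note sub = subring_closed[OF idealD(1)[OF I]]
  let ?J = "{x. \<exists>q\<in>I. \<exists>c\<in>C. x = q + c * a}"
  show "?J \<subseteq> C" using idealD(2)[OF I] a sub(4,5) by blast
  show "0 \<in> ?J" using idealD(3)[OF I] sub(1) by force
  fix x y assume y: "y \<in> ?J"
  then obtain q c where q: "q \<in> I" "c \<in> C" "y = q + c * a" by blast
  {
    assume "x \<in> ?J"
    then obtain q' c' where q': "q' \<in> I" "c' \<in> C" "x = q' + c' * a" by blast
    have "x + y = (q' + q) + (c' + c) * a" by (simp add: q q' algebra_simps)
    then show "x + y \<in> ?J" using idealD(4)[OF I q'(1) q(1)] sub(4)[OF q'(2) q(2)] by blast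
  }
  assume x: "x \<in> C"
  have "x * y = x * q + (x * c) * a" by (simp add: q algebra_simps)
  then show "x * y \<in> ?J" using idealD(5)[OF I x q(1)] sub(5)[OF x q(2)] by blast
qed

text \<open>Zorn's lemma: an ideal maximal among those avoiding \<open>S\<close> is prime, since
  adjoining any outside element produces an element of \<open>S\<close>.\<close>

lemma ex_prime_avoiding:
  assumes I: "is_ideal C I" and S: "S \<subseteq> C" "1 \<in> S" "\<And>a b. a \<in> S \<Longrightarrow> b \<in> S \<Longrightarrow> a * b \<in> S" "S \<inter> I = {}"
  shows "\<exists>Q. is_prime C Q \<and> I \<subseteq> Q \<and> S \<inter> Q = {}"
proof -
  define X where "X = {Q. is_ideal C Q \<and> I \<subseteq> Q \<and> S \<inter> Q = {}}"
  have "\<exists>Q\<in>X. \<forall>Q'\<in>X. Q \<subseteq> Q' \<longrightarrow> Q' = Q"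
  proof (rule subset_Zorn_nonempty)
    show "X \<noteq> {}" using I S(4) by (auto simp: X_def)
    fix K assume ne: "K \<noteq> {}" and ch: "subset.chain X K"
    have K: "\<And>Q. Q \<in> K \<Longrightarrow> is_ideal C Q \<and> I \<subseteq> Q \<and> S \<inter> Q = {}"
      using ch unfolding subset.chain_def X_def by blast
    have tot: "\<And>A B. A \<in> K \<Longrightarrow> B \<in> K \<Longrightarrow> A \<subseteq> B \<or> B \<subseteq> A"
      using ch unfolding subset.chain_def by blast
    have "is_ideal C (\<Union>K)"
      unfolding is_ideal_def
    proof (intro conjI ballI idealD(1)[OF I])
      show "\<Union>K \<subseteq> C" using K idealD(2) by blast
      show "0 \<in> \<Union>K" using K ne idealD(3) by blast
      show "a + b \<in> \<Union>K" if ab: "a \<in> \<Union>K" "b \<in> \<Union>K" for a b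
      proof -
        obtain A B where AB: "A \<in> K" "B \<in> K" "a \<in> A" "b \<in> B" using ab by blast
        then obtain D where "D \<in> K" "a \<in> D" "b \<in> D" using tot by blast
        then show ?thesis using K idealD(4) by blast
      qed
      show "a * b \<in> \<Union>K" if "a \<in> C" "b \<in> \<Union>K" for a b
        using that K idealD(5) by blast
    qed
    then show "\<Union>K \<in> X" using K ne unfolding X_def by blast
  qed
  then obtain Q where QX: "Q \<in> X" and maxX: "\<forall>Q'\<in>X. Q \<subseteq> Q' \<longrightarrow> Q' = Q" by (rule bexE)
  have Q: "is_ideal C Q" "I \<subseteq> Q" "S \<inter> Q = {}" using QX by (simp_all add: X_def)
  have max: "Q' = Q" if "is_ideal C Q'" "I \<subseteq> Q'" "S \<inter> Q' = {}" "Q \<subseteq> Q'" for Q'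
    using maxX that by (simp add: X_def)
  have meets: "\<exists>q\<in>Q. \<exists>c\<in>C. q + c * a \<in> S" if a: "a \<in> C" "a \<notin> Q" for a
  proof (rule ccontr)
    assume none: "\<not> ?thesis"
    let ?J = "{x. \<exists>q\<in>Q. \<exists>c\<in>C. x = q + c * a}"
    note sub = subring_closed[OF idealD(1)[OF I]]
    have QJ: "Q \<subseteq> ?J"
    proof
      fix q assume "q \<in> Q"
      then show "q \<in> ?J" using sub(1) by (intro CollectI bexI[of _ q] bexI[of _ 0]) simp_all
    qed
    have "?J = Q" by (rule max[OF ideal_adjoin[OF Q(1) a(1)] _ _ QJ]) (use Q(2) QJ none in blast)+
    moreover have "a \<in> ?J" using sub(2) idealD(3)[OF Q(1)] by (intro CollectI bexI[of _ 0] bexI[of _ 1]) simp_all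
    ultimately show False using a(2) by blast
  qed
  have "is_prime C Q"
    unfolding is_prime_def
  proof (intro conjI ballI impI Q(1))
    show "1 \<notin> Q" using S(2) Q(3) by blast
    fix a b assume ab: "a \<in> C" "b \<in> C" "a * b \<in> Q"
    show "a \<in> Q \<or> b \<in> Q"
    proof (rule ccontr)
      assume "\<not> (a \<in> Q \<or> b \<in> Q)"
      then have nab: "a \<notin> Q" "b \<notin> Q" by blast+
      obtain q c where q: "q \<in> Q" "c \<in> C" "q + c * a \<in> S" using meets[OF ab(1) nab(1)] by blast
      obtain q' c' where q': "q' \<in> Q" "c' \<in> C" "q' + c' * b \<in> S" using meets[OF ab(2) nab(2)] by blast
      note sub = subring_closed[OF idealD(1)[OF I]]
      have "(q + c * a) * (q' + c' * b) = q * (q' + c' * b) + (c * a) * q' + (c * c') * (a * b)"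
        by (simp add: algebra_simps)
      also have "\<dots> \<in> Q"
        using q q' ab S(1) by (intro idealD(4)[OF Q(1)] idealD(6)[OF Q(1) _ q(1)] idealD(5)[OF Q(1) _ q'(1)]
            idealD(5)[OF Q(1) _ ab(3)] sub(5)) auto
      finally show False using S(3)[OF q(3) q'(3)] Q(3) by blast
    qed
  qed
  then show ?thesis using Q by blast
qed

text \<open>Passes from an arbitrary prime to the largest graded ideal inside it; only graded primes
  are points of \<open>multi_Proj\<close>.\<close>

lemma is_prime_star:
  assumes Q: "is_prime C Q" and C: "\<And>f n. f \<in> C \<Longrightarrow> hom_component w n f \<in> C"
  shows "is_prime C {f \<in> C. \<forall>n. hom_component w n f \<in> Q}"
proof (rule graded_primeI[where w = w])
  note I = primeD(1)[OF Q]
  note sub = subring_closed[OF idealD(1)[OF I]]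
  let ?Q = "{f \<in> C. \<forall>n. hom_component w n f \<in> Q}"
  show "is_ideal C ?Q"
    unfolding is_ideal_def
  proof (intro conjI ballI idealD(1)[OF I])
    show "0 \<in> ?Q" using sub(1) idealD(3)[OF I] by (simp add: hom_component_def)
    show "a + b \<in> ?Q" if "a \<in> ?Q" "b \<in> ?Q" for a b
      using that idealD(4)[OF I] sub(4) by (simp add: hom_component_add)
    show "a * b \<in> ?Q" if "a \<in> C" "b \<in> ?Q" for a b
      using that by (auto simp: hom_component_mult intro: ideal_sum[OF I] idealD(5)[OF I] C sub(5))
  qed blast
  have hom: "F \<in> ?Q \<longleftrightarrow> F \<in> Q" if "F \<in> C" "homdeg w n F" for F n
    using that idealD(3)[OF I] by (auto simp: hom_component_homdeg[OF that(2)])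
  show "1 \<notin> ?Q" using hom[OF sub(2) homdeg_one] primeD(2)[OF Q] by blast
  show "hom_component w n f \<in> ?Q" if "f \<in> ?Q" for f n
    using that hom[OF C homdeg_hom_component, of f n] by blast
  show "F \<in> ?Q \<or> G \<in> ?Q" if "F \<in> C" "G \<in> C" "homdeg w n F" "homdeg w k G" "F * G \<in> ?Q" for F G n k
    using that hom[OF that(1,3)] hom[OF that(2,4)] hom[OF sub(5)[OF that(1,2)] homdeg_mult[OF that(3,4)]]
      primeD(3)[OF Q that(1,2)] by blast
qed (rule C)

text \<open>The generators are eliminated one at a time.\<close>

lemma nakayama:
  assumes I: "is_ideal R I" and q: "is_prime C q" and \<iota>: "comm_ring_hom \<iota>" "\<And>x. x \<in> C \<Longrightarrow> \<iota> x \<in> R"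
    and "finite G" "G \<subseteq> R" "u \<in> C" "u \<notin> q"
    and "\<And>x. x \<in> G \<Longrightarrow> \<exists>h. (\<forall>y\<in>G. h y \<in> q) \<and> \<iota> u * x - (\<Sum>y\<in>G. \<iota> (h y) * y) \<in> I"
  shows "\<exists>u'\<in>C. u' \<notin> q \<and> (\<forall>x\<in>G. \<iota> u' * x \<in> I)"
  using assms(5-)
proof (induction G arbitrary: u rule: finite_induct)
  case empty
  then show ?case by blast
next
  case (insert z G)
  interpret comm_ring_hom \<iota> by (rule \<iota>(1))
  note qI = primeD(1)[OF q]
  note subC = subring_closed[OF idealD(1)[OF qI]] and subR = subring_closed[OF idealD(1)[OF I]]
  have "\<forall>x\<in>insert z G. \<exists>h. (\<forall>y\<in>insert z G. h y \<in> q) \<and> \<iota> u * x - (\<Sum>y\<in>insert z G. \<iota> (h y) * y) \<in> I"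
    using insert.prems(4) by blast
  from bchoice[OF this] obtain h where "\<forall>x\<in>insert z G. (\<forall>y\<in>insert z G. h x y \<in> q) \<and>
      \<iota> u * x - (\<Sum>y\<in>insert z G. \<iota> (h x y) * y) \<in> I" ..
  then have h: "\<And>x y. x \<in> insert z G \<Longrightarrow> y \<in> insert z G \<Longrightarrow> h x y \<in> q"
    and hI: "\<And>x. x \<in> insert z G \<Longrightarrow> \<iota> u * x - (\<iota> (h x z) * z + (\<Sum>y\<in>G. \<iota> (h x y) * y)) \<in> I"
    using insert.hyps by auto
  have hC: "h x y \<in> C" if "x \<in> insert z G" "y \<in> insert z G" for x y
    using idealD(2)[OF qI h[OF that]] .
  \<comment> \<open>In the relation for \<open>z\<close> its own term is moved to the left;
    \<open>u1\<close> stays outside \<open>q\<close> because \<open>h z z\<close> is in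
    \<open>q\<close>.\<close>
  define u1 where "u1 = u - h z z"
  have u1: "u1 \<in> C" "u1 \<notin> q"
    using subC(6)[OF insert.prems(2) hC[of z z]] idealD(4)[OF qI, of u1 "h z z"] h[of z z] insert.prems(3)
    by (auto simp: u1_def)
  define D where "D = \<iota> u1 * z - (\<Sum>y\<in>G. \<iota> (h z y) * y)"
  have D: "D \<in> I" using hI[of z] by (simp add: D_def u1_def hom_minus algebra_simps)
  have uu: "u1 * u \<in> C" "u1 * u \<notin> q"
    using subC(5)[OF u1(1) insert.prems(2)] primeD(3)[OF q u1(1) insert.prems(2)] u1(2) insert.prems(3) by auto
  \<comment> \<open>The relation for \<open>x\<close> is multiplied by \<open>u1\<close>, and
    \<open>u1\<close> times \<open>z\<close> is then eliminated by means of
    \<open>D\<close>.\<close>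
  have "\<exists>h'. (\<forall>y\<in>G. h' y \<in> q) \<and> \<iota> (u1 * u) * x - (\<Sum>y\<in>G. \<iota> (h' y) * y) \<in> I" if x: "x \<in> G" for x
  proof (intro exI[of _ "\<lambda>y. u1 * h x y + h x z * h z y"] conjI ballI)
    show "u1 * h x y + h x z * h z y \<in> q" if "y \<in> G" for y
      using that x by (intro idealD(4)[OF qI] idealD(5)[OF qI] u1(1) h hC) auto
    have "\<iota> (u1 * u) * x - (\<Sum>y\<in>G. \<iota> (u1 * h x y + h x z * h z y) * y) =
        \<iota> u1 * (\<iota> u * x - (\<iota> (h x z) * z + (\<Sum>y\<in>G. \<iota> (h x y) * y))) + \<iota> (h x z) * D"
      by (simp add: D_def hom_distribs algebra_simps sum.distrib sum_distrib_left)
    also have "\<dots> \<in> I"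
      using x by (intro idealD(4)[OF I] idealD(5)[OF I] D hI \<iota>(2) u1(1) hC) auto
    finally show "\<iota> (u1 * u) * x - (\<Sum>y\<in>G. \<iota> (u1 * h x y + h x z * h z y) * y) \<in> I" .
  qed
  then obtain u2 where u2: "u2 \<in> C" "u2 \<notin> q" "\<And>x. x \<in> G \<Longrightarrow> \<iota> u2 * x \<in> I"
    using insert.IH[OF _ uu] insert.prems(1) by blast
  have "\<iota> (u2 * u1) * x \<in> I" if x: "x \<in> insert z G" for x
  proof (cases "x = z")
    case True
    have "\<iota> (u2 * u1) * z = \<iota> u2 * D + (\<Sum>y\<in>G. \<iota> (h z y) * (\<iota> u2 * y))"
      by (simp add: D_def hom_distribs algebra_simps sum_distrib_left)
    also have "\<dots> \<in> I"
      by (intro idealD(4)[OF I] idealD(5)[OF I] ideal_sum[OF I] D u2 \<iota>(2) hC) auto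
    finally show ?thesis using True by simp
  next
    case False
    have "\<iota> (u2 * u1) * x = \<iota> u1 * (\<iota> u2 * x)" by (simp add: hom_mult ac_simps)
    then show ?thesis using x False idealD(5)[OF I \<iota>(2)[OF u1(1)] u2(3)] by simp
  qed
  moreover have "u2 * u1 \<notin> q" using primeD(3)[OF q u2(1) u1(1)] u2(2) u1(2) by blast
  ultimately show ?case using subC(5)[OF u2(1) u1(1)] by blast
qed

section \<open>Flag varieties\<close>

lemma proj_s_Gr:
  assumes P: "P \<in> Fl d r s" shows "proj_s d s P \<in> Gr d s"
proof -
  have e: "Inl ` tuples d s \<subseteq> Fl_coords d r s" by (auto simp: Fl_coords_def)
  have prime: "primeideal (proj_s d s P) (poly_ring (tuples d s))"
    unfolding proj_s_def
    by (rule primeideal_contract[OF _ e]) (use P in \<open>simp add: Fl_def multi_Proj_def\<close>)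
  have rel: "pluecker_relations d s \<subseteq> proj_s d s P"
  proof
    fix F assume F: "F \<in> pluecker_relations d s"
    have "poly_rename Inl F \<in> flag_relations d r s"
      using F poly_rename_closed[OF _ e, of F] homogeneous_rename[of deg_s Inl F]
        homogeneous_rename[of deg_r Inl F] homogeneous_zero[of F]
      by (simp add: pluecker_relations_def flag_relations_def poly_subst_subst poly_subst_PVar)
    then show "F \<in> proj_s d s P"
      using P F by (auto simp: proj_s_def Fl_def multi_Proj_def pluecker_relations_def)
  qed
  have graded: "graded_set (\<lambda>_. 1) (proj_s d s P)"
    unfolding graded_set_def
  proof (intro ballI allI)
    fix F n assume F: "F \<in> proj_s d s P"
    have "hom_component deg_s n (poly_rename Inl F) \<in> P"
      using P F by (simp add: proj_s_def Fl_def multi_Proj_def graded_set_def)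
    then show "hom_component (\<lambda>_. 1) n F \<in> proj_s d s P"
      using F by (simp add: proj_s_def hom_component_rename hom_component_closed)
  qed
  have "\<not> {PVar v |v. v \<in> Fl_coords d r s \<and> deg_s v = 1} \<subseteq> P"
    using P by (simp add: Fl_def multi_Proj_def)
  then obtain L where "L \<in> tuples d s" "PVar (Inl L) \<notin> P"
    by (auto simp: Fl_coords_def)
  then have "\<not> {PVar v |v. v \<in> tuples d s} \<subseteq> proj_s d s P"
    by (auto simp: proj_s_def poly_subst_PVar)
  then show ?thesis
    using prime rel graded by (simp add: Gr_def multi_Proj_def)
qed

text \<open>\<open>dt_exchange\<close> for a minor in the first \<open>r\<close> rows and one in all
  \<open>s\<close> rows; both sides have bidegree (1, 1).\<close>

lemma flag_exchange:
  assumes L: "L \<in> tuples d r" and M: "M \<in> tuples d s" and rs: "r \<le> s" and k: "k < r" and i: "i < d"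
  shows "PVar (Inl M) * PVar (Inr (L[k := i])) - (\<Sum>l<s. PVar (Inr (L[k := M ! l])) * PVar (Inl (M[l := i])))
    \<in> flag_relations d r s" (is "?F \<in> _")
proof -
  note sub = subring_closed[OF is_subring_poly]
  note len = tuples_length[OF L] tuples_length[OF M]
  have v: "PVar (Inl T) \<in> carrier (poly_ring (Fl_coords d r s))" if "T \<in> tuples d s" for T
    using that by (simp add: carrier_poly_ring Fl_coords_def)
  have w: "PVar (Inr T) \<in> carrier (poly_ring (Fl_coords d r s))" if "T \<in> tuples d r" for T
    using that by (simp add: carrier_poly_ring Fl_coords_def)
  have "?F \<in> carrier (poly_ring (Fl_coords d r s))"
    by (intro sub(5,6) subring_sum[OF is_subring_poly] v w M tuples_update L i tuples_nth[OF M]) simp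
  moreover have "homdeg g (g (Inl M) + g (Inr L)) ?F" if g: "g = deg_s \<or> g = deg_r" for g
  proof -
    have a: "g (Inl T) = g (Inl M)" "g (Inr T) = g (Inr L)" for T using g by auto
    have "homdeg g (g (Inl M) + g (Inr L)) (PVar (Inl T) * PVar (Inr T'))" for T T'
      using homdeg_mult[OF homdeg_PVar[of g "Inl T"] homdeg_PVar[of g "Inr T'"]] unfolding a(1)[of T] a(2)[of T'] .
    moreover from this have "homdeg g (g (Inl M) + g (Inr L)) (PVar (Inr T') * PVar (Inl T))" for T T'
      by (subst mult.commute) blast
    ultimately show ?thesis by (intro homdeg_diff homdeg_sum) blast+
  qed
  moreover have "poly_subst PConst (case_sum (minor s) (minor r)) ?F = 0"
  proof -
    interpret comm_ring_hom "poly_subst PConst (case_sum (minor s) (minor r))" by (rule comm_ring_hom_subst)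
    show ?thesis
      using dt_exchange[of L M k "\<lambda>k i. PVar (k, i)" i] k rs
      by (simp add: hom_distribs poly_subst_PVar minor_dt len)
  qed
  ultimately show ?thesis by (auto simp: flag_relations_def homogeneous_homdeg)
qed

lemma gchart_hom:
  assumes "comm_ring_hom h" "\<And>c. h (PConst c) = PConst c"
  shows "Poly_Mapping.lookup (gchart PConst (\<lambda>L. h (PVar L)) M f) \<beta> = h (Poly_Mapping.lookup (chart_subst M f) \<beta>)"
proof -
  have "gsubst (\<lambda>c. PConst (h c)) PVar (chart_subst M f) = gchart PConst (\<lambda>L. h (PVar L)) M f"
    unfolding gchart_def
    by (rule gsubst_chart_subst[OF comm_ring_hom_comp[OF comm_ring_hom_PConst assms(1)]]) (simp add: assms(2))
  then show ?thesis using lookup_gsubst_coeff[OF assms(1), of "chart_subst M f" \<beta>] by simp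
qed

text \<open>Both charts are compared in the coordinate ring of the flag variety modulo
  \<open>Q\<close>, where \<open>flag_exchange\<close> supplies the hypothesis of
  \<open>gchart_change\<close>.\<close>

lemma flag_canonical_subset:
  assumes Q: "Q \<in> Fl d r s" and rs: "r \<le> s"
  shows "canonical_map d (s, proj_s d s Q) \<subseteq> canonical_map d (r, proj_r d r Q)"
proof
  interpret ps: gr_point d s "proj_s d s Q" by unfold_locales (rule proj_s_Gr[OF Q])
  interpret pr: gr_point d r "proj_r d r Q" by unfold_locales (rule proj_r_Gr[OF Q])
  let ?C = "carrier (poly_ring (Fl_coords d r s))"
  have Qp: "is_prime ?C Q" and rel: "flag_relations d r s \<subseteq> Q"
    using Q by (simp_all add: Fl_def multi_Proj_def is_prime_poly)
  obtain L where L: "L \<in> tuples d r" "PVar L \<notin> proj_r d r Q" using pr.good_tuple by blast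
  obtain M where M: "M \<in> tuples d s" "PVar M \<notin> proj_s d s Q" using ps.good_tuple by blast
  fix f assume f: "f \<in> canonical_map d (s, proj_s d s Q)"
  then have fA: "f \<in> tca_carrier d" and chart: "chart_subst M f \<in> coeffs_in (proj_s d s Q)"
    using ps.PP_iff[OF M] by blast+
  have "gchart PConst (\<lambda>T. PVar (Inl T)) M f \<in> coeffs_in Q"
    unfolding coeffs_in_def
  proof (intro CollectI allI)
    fix \<beta>
    show "Poly_Mapping.lookup (gchart PConst (\<lambda>T. PVar (Inl T)) M f) \<beta> \<in> Q"
      using gchart_hom[OF comm_ring_hom_subst poly_subst_PConst, of "\<lambda>T. PVar (Inl T :: nat list + nat list)" M f \<beta>]
        coeffs_inD[OF chart, of \<beta>] by (simp add: proj_s_def poly_subst_PVar)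
  qed
  then have "gchart PConst (\<lambda>T. PVar (Inr T)) L f \<in> coeffs_in Q"
  proof (rule gchart_change[OF Qp comm_ring_hom_PConst, rotated -1])
    show "PVar (Inl M) \<notin> Q" using M by (simp add: proj_s_def carrier_poly_ring poly_subst_PVar)
    show "PVar (Inl M) * PVar (Inr (L[k := i])) -
        (\<Sum>l<length M. PVar (Inr (L[k := M ! l])) * PVar (Inl (M[l := i]))) \<in> Q"
      if "k < length L" "i < d" for k i
      using flag_exchange[OF L(1) M(1) rs, of k i] that rel tuples_length[OF L(1)] tuples_length[OF M(1)] by auto
    show "PVar (Inl (M[l := i])) \<in> ?C" if "i < d" for l i
      using tuples_update[OF M(1) that] by (simp add: carrier_poly_ring Fl_coords_def)
    show "PVar (Inr (L[k := i])) \<in> ?C" if "i < d" for k i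
      using tuples_update[OF L(1) that] by (simp add: carrier_poly_ring Fl_coords_def)
    show "M ! l < d" if "l < length M" for l using that tuples_nth[OF M(1)] tuples_length[OF M(1)] by simp
  qed (use M fA in \<open>simp_all add: carrier_poly_ring Fl_coords_def\<close>)
  note mem = coeffs_inD[OF this]
  have "Poly_Mapping.lookup (chart_subst L f) \<beta> \<in> proj_r d r Q" for \<beta>
    using gchart_hom[OF comm_ring_hom_subst poly_subst_PConst, of "\<lambda>T. PVar (Inr T :: nat list + nat list)" L f \<beta>]
      coeffs_inD[OF chart_subst_carrier[OF L(1) fA], of \<beta>] mem[of \<beta>]
    by (simp add: proj_r_def poly_subst_PVar)
  then show "f \<in> canonical_map d (r, proj_r d r Q)"
    using pr.PP_iff[OF L] fA by (simp add: coeffs_in_def)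
qed

section \<open>Lifting to the flag variety\<close>

abbreviation \<iota>l :: "nat list cpoly \<Rightarrow> (nat list + nat list) cpoly" where
  "\<iota>l \<equiv> poly_rename Inl"

abbreviation \<iota>r :: "nat list cpoly \<Rightarrow> (nat list + nat list) cpoly" where
  "\<iota>r \<equiv> poly_rename Inr"

section \<open>Components for the two gradings\<close>

definition bicomp :: "nat \<Rightarrow> nat \<Rightarrow> (nat list + nat list) cpoly \<Rightarrow> (nat list + nat list) cpoly" where
  "bicomp a b F = hom_component deg_s a (hom_component deg_r b F)"

lemma lookup_bicomp: "Poly_Mapping.lookup (bicomp a b F) m =
    (if mon_deg deg_s m = a \<and> mon_deg deg_r m = b then Poly_Mapping.lookup F m else 0)"
  by (simp add: bicomp_def lookup_hom_component)

lemma bicomp_alt: "bicomp a b F = hom_component deg_r b (hom_component deg_s a F)"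
  by (rule poly_mapping_eqI) (simp add: lookup_bicomp lookup_hom_component)

lemma bicomp_bicomp: "bicomp a b (bicomp a' b' F) = (if a = a' \<and> b = b' then bicomp a b F else 0)"
  by (rule poly_mapping_eqI) (auto simp: lookup_bicomp)

lemma bicomp_homdeg:
  "homdeg deg_s a' F \<Longrightarrow> homdeg deg_r b' F \<Longrightarrow> bicomp a b F = (if a = a' \<and> b = b' then F else 0)"
  by (rule poly_mapping_eqI) (auto simp: lookup_bicomp homdeg_lookup)

lemma bicomp_add: "bicomp a b (F + G) = bicomp a b F + bicomp a b G"
  by (simp add: bicomp_def hom_component_add)

lemma bicomp_mult:
  "bicomp a b (F * G) = (\<Sum>i\<le>b. \<Sum>j\<le>a. bicomp j i F * bicomp (a - j) (b - i) G)"
  by (simp add: bicomp_def hom_component_mult hom_component_sum)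

lemma ideal_of_bicomps:
  assumes "is_ideal C I" "\<And>a b. bicomp a b f \<in> I" shows "f \<in> I"
proof (rule ideal_of_components[OF assms(1), where w = deg_r])
  show "hom_component deg_r b f \<in> I" for b
    by (rule ideal_of_components[OF assms(1), where w = deg_s]) (use assms(2) in \<open>simp add: bicomp_def\<close>)
qed

lemma homdeg_rename_l: "homdeg (\<lambda>_. 1) n F \<Longrightarrow> homdeg deg_s n (\<iota>l F)" "homdeg deg_r 0 (\<iota>l F)"
proof -
  have "homdeg (\<lambda>_. 0) 0 F" by (simp add: homdeg_def mon_deg_def)
  then have "hom_component deg_r 0 (\<iota>l F) = \<iota>l F"
    by (simp add: hom_component_rename hom_component_homdeg)
  then show "homdeg deg_r 0 (\<iota>l F)" using homdeg_hom_component by metis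
  assume "homdeg (\<lambda>_. 1) n F"
  then have "hom_component deg_s n (\<iota>l F) = \<iota>l F"
    by (simp add: hom_component_rename hom_component_homdeg)
  then show "homdeg deg_s n (\<iota>l F)" using homdeg_hom_component by metis
qed

lemma homdeg_rename_r: "homdeg (\<lambda>_. 1) n F \<Longrightarrow> homdeg deg_r n (\<iota>r F)" "homdeg deg_s 0 (\<iota>r F)"
proof -
  have "homdeg (\<lambda>_. 0) 0 F" by (simp add: homdeg_def mon_deg_def)
  then have "hom_component deg_s 0 (\<iota>r F) = \<iota>r F"
    by (simp add: hom_component_rename hom_component_homdeg)
  then show "homdeg deg_s 0 (\<iota>r F)" using homdeg_hom_component by metis
  assume "homdeg (\<lambda>_. 1) n F"
  then have "hom_component deg_r n (\<iota>r F) = \<iota>r F"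
    by (simp add: hom_component_rename hom_component_homdeg)
  then show "homdeg deg_r n (\<iota>r F)" using homdeg_hom_component by metis
qed

lemma bicomp_rename_l: "bicomp a b (\<iota>l F) = (if b = 0 then \<iota>l (hom_component (\<lambda>_. 1) a F) else 0)"
proof -
  have "bicomp a b (\<iota>l F) = hom_component deg_r b (\<iota>l (hom_component (\<lambda>_. 1) a F))"
    by (simp add: bicomp_alt hom_component_rename[of deg_s])
  then show ?thesis using hom_component_homdeg[OF homdeg_rename_l(2)] by simp
qed

lemma bicomp_rename_r: "bicomp a b (\<iota>r F) = (if a = 0 then \<iota>r (hom_component (\<lambda>_. 1) b F) else 0)"
proof -
  have "bicomp a b (\<iota>r F) = hom_component deg_s a (\<iota>r (hom_component (\<lambda>_. 1) b F))"
    by (simp add: bicomp_def hom_component_rename[of deg_r])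
  then show ?thesis using hom_component_homdeg[OF homdeg_rename_r(2)] by simp
qed

text \<open>\<open>above\<close> says that the prime of \<open>p'\<close> contains all functions
  vanishing on \<open>Z\<close>. The goal, \<open>flag_point\<close>, is that \<open>p'\<close> is
  then the image of a flag whose larger quotient is in \<open>Z\<close>.\<close>

locale flag_lift =
  fixes d r s :: nat and p' :: "nat list cpoly set" and Z :: "nat list cpoly set set" and Js :: "nat list cpoly set"
  assumes rs: "r \<le> s" and p': "p' \<in> Gr d r"
    and Z: "Z = {q \<in> Gr d s. Js \<subseteq> q}"
    and Js: "Js \<subseteq> carrier (poly_ring (tuples d s))" "\<And>F n. F \<in> Js \<Longrightarrow> hom_component (\<lambda>_. 1) n F \<in> Js"
    and above: "{f \<in> tca_carrier d. \<forall>q\<in>Z. f \<in> canonical_map d (s, q)} \<subseteq> canonical_map d (r, p')"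
begin

sublocale p': gr_point d r p'
  by unfold_locales (rule p')

lemma Z_point: "q \<in> Z \<Longrightarrow> gr_point d s q"
  by (simp add: Z gr_point_def)

abbreviation "Rs \<equiv> carrier (poly_ring (tuples d s))"
abbreviation "Rf \<equiv> carrier (poly_ring (Fl_coords d r s))"

definition Is :: "(nat \<times> nat) cpoly set" where
  "Is = {f \<in> tca_carrier d. \<forall>q\<in>Z. f \<in> canonical_map d (s, q)}"

lemma Is_ideal: "is_ideal (tca_carrier d) Is"
proof -
  have I: "is_ideal (tca_carrier d) (canonical_map d (s, q))" if "q \<in> Z" for q
    using primeD(1)[OF gr_point.PP_prime[OF Z_point[OF that]]] .
  show ?thesis
    unfolding is_ideal_def Is_def
    using idealD(3,4,5)[OF I] subring_closed[OF is_subring_tca] by (auto simp: is_subring_tca)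
qed

text \<open>The list \<open>[0..<r]\<close> begins \<open>[0..<s]\<close>, just as the matrix of the
  smaller quotient consists of the first rows of that of the larger; hence flag relations evaluate
  to 0.\<close>

definition ev2 :: "(nat list + nat list) cpoly \<Rightarrow> (nat \<times> nat) cpoly" where
  "ev2 = gsubst PConst (case_sum (\<lambda>T. Delta T [0..<s]) (\<lambda>T. Delta T [0..<r]))"

lemma ev2_hom: "comm_ring_hom ev2"
  unfolding ev2_def by (rule comm_ring_hom_gsubst[OF comm_ring_hom_PConst])

lemma ev2_l: "ev2 (\<iota>l F) = ev [0..<s] F"
  unfolding poly_subst_gsubst hom_gsubst[OF ev2_hom] unfolding ev_def ev2_def
  by (simp add: comm_ring_hom_PConst)

lemma ev2_r: "ev2 (\<iota>r F) = ev [0..<r] F"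
  unfolding poly_subst_gsubst hom_gsubst[OF ev2_hom] unfolding ev_def ev2_def
  by (simp add: comm_ring_hom_PConst)

lemma Fl_coords_cases:
  assumes "F \<in> Rf" "v \<in> gvars F"
  obtains T where "v = Inl T" "T \<in> tuples d s" | T where "v = Inr T" "T \<in> tuples d r"
  using assms by (auto simp: carrier_poly_ring poly_vars_gvars Fl_coords_def)

lemma ev2_tca:
  assumes "F \<in> Rf" shows "ev2 F \<in> tca_carrier d"
  unfolding ev2_def
proof (rule gsubst_in[OF is_subring_tca])
  fix v assume "v \<in> gvars F"
  then show "case_sum (\<lambda>T. Delta T [0..<s]) (\<lambda>T. Delta T [0..<r]) v \<in> tca_carrier d"
    by (rule Fl_coords_cases[OF assms]) (simp_all add: Delta_tca tuples_set)
qed (rule PConst_tca)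

lemma ev2_flag_relation:
  assumes "F \<in> flag_relations d r s" shows "ev2 F = 0"
proof -
  have F: "F \<in> Rf" "poly_subst PConst (case_sum (minor s) (minor r)) F = 0"
    using assms by (simp_all add: flag_relations_def)
  let ?\<tau> = "\<lambda>(k, i). PVar (i, k) :: (nat \<times> nat) cpoly"
  have minor: "poly_subst PConst ?\<tau> (minor n T) = Delta T [0..<n]" if "length T = n" for n T
    unfolding minor_dt[OF that] hom_dt[OF comm_ring_hom_subst] Delta_def
    by (rule dt_cong) (simp add: poly_subst_PVar that)
  have "poly_subst PConst ?\<tau> (poly_subst PConst (case_sum (minor s) (minor r)) F) = ev2 F"
    unfolding poly_subst_gsubst[of PConst "case_sum (minor s) (minor r)"] hom_gsubst[OF comm_ring_hom_subst]
    unfolding ev2_def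
  proof (rule gsubst_cong)
    fix v assume "v \<in> gvars F"
    then show "poly_subst PConst ?\<tau> (case_sum (minor s) (minor r) v) =
        case_sum (\<lambda>T. Delta T [0..<s]) (\<lambda>T. Delta T [0..<r]) v"
      by (rule Fl_coords_cases[OF F(1)]) (simp_all add: minor tuples_length)
  qed (simp add: poly_subst_PConst)
  then show ?thesis by (simp add: F(2))
qed

lemma bicomp_Rf: "F \<in> Rf \<Longrightarrow> bicomp a b F \<in> Rf"
  unfolding bicomp_def by (intro hom_component_closed)

lemma l_Rf: "F \<in> Rs \<Longrightarrow> \<iota>l F \<in> Rf"
  by (erule poly_rename_closed) (auto simp: Fl_coords_def)

lemma r_Rf: "F \<in> p'.R \<Longrightarrow> \<iota>r F \<in> Rf"
  by (erule poly_rename_closed) (auto simp: Fl_coords_def)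

lemma Rf: "is_subring Rf"
  by (rule is_subring_poly)

text \<open>Bihomogeneous equations that hold for all flags over \<open>Z\<close>, tested on minors.
  It contains the flag relations and \<open>Js\<close>, so a suitable prime above it is a flag over
  \<open>Z\<close>.\<close>

definition A0 :: "(nat list + nat list) cpoly set" where
  "A0 = {F \<in> Rf. \<forall>a b. ev2 (bicomp a b F) \<in> Is}"

lemma A0_ideal: "is_ideal Rf A0"
  unfolding is_ideal_def
proof (intro conjI ballI Rf)
  interpret comm_ring_hom ev2 by (rule ev2_hom)
  note sub = subring_closed[OF Rf]
  show "A0 \<subseteq> Rf" by (auto simp: A0_def)
  have "bicomp a b 0 = 0" for a b by (rule poly_mapping_eqI) (simp add: lookup_bicomp)
  then show "0 \<in> A0" using idealD(3)[OF Is_ideal] sub(1) by (simp add: A0_def)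
  show "F + G \<in> A0" if "F \<in> A0" "G \<in> A0" for F G
    using that idealD(4)[OF Is_ideal] sub(4) by (simp add: A0_def bicomp_add hom_add)
  show "F * G \<in> A0" if F: "F \<in> Rf" and G: "G \<in> A0" for F G
  proof -
    have "ev2 (bicomp a b (F * G)) \<in> Is" for a b
      unfolding bicomp_mult hom_sum hom_mult
      using G by (intro ideal_sum[OF Is_ideal] idealD(5)[OF Is_ideal] ev2_tca bicomp_Rf F) (simp add: A0_def)
    then show ?thesis using F G sub(5) by (simp add: A0_def)
  qed
qed

lemma A0_bicomp: "F \<in> A0 \<Longrightarrow> bicomp a b F \<in> A0"
proof -
  assume F: "F \<in> A0"
  interpret comm_ring_hom ev2 by (rule ev2_hom)
  show ?thesis
    using F idealD(3)[OF Is_ideal] by (simp add: A0_def bicomp_Rf bicomp_bicomp)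
qed

lemma flag_relations_A0: "flag_relations d r s \<subseteq> A0"
proof
  fix F assume F: "F \<in> flag_relations d r s"
  then obtain a b where ab: "homdeg deg_s a F" "homdeg deg_r b F" "F \<in> Rf"
    by (auto simp: flag_relations_def homogeneous_homdeg)
  interpret comm_ring_hom ev2 by (rule ev2_hom)
  show "F \<in> A0"
    using ab(3) idealD(3)[OF Is_ideal] by (simp add: A0_def bicomp_homdeg[OF ab(1,2)] ev2_flag_relation[OF F])
qed

lemma Js_A0: "F \<in> Js \<Longrightarrow> \<iota>l F \<in> A0"
proof -
  assume F: "F \<in> Js"
  interpret comm_ring_hom ev2 by (rule ev2_hom)
  have "ev [0..<s] (hom_component (\<lambda>_. 1) a F) \<in> Is" for a
  proof -
    let ?F = "hom_component (\<lambda>_. 1) a F"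
    have FR: "?F \<in> Rs" using Js(1)[THEN subsetD, OF F] by (rule hom_component_closed)
    have "ev [0..<s] ?F \<in> canonical_map d (s, q)" if q: "q \<in> Z" for q
      using gr_point.PP_ev_iff[OF Z_point[OF q] _ _ FR homdeg_hom_component, of "[0..<s]"] Js(2)[OF F, of a] q
      by (auto simp: Z)
    then show ?thesis using ev_tca[OF FR] by (simp add: Is_def)
  qed
  then show ?thesis
    using l_Rf Js(1) F idealD(3)[OF Is_ideal] by (auto simp: A0_def bicomp_rename_l ev2_l)
qed

section \<open>The forms of degree n in the larger quotient as a finite module\<close>

definition mon_l :: "(nat list \<Rightarrow> nat) \<Rightarrow> (nat list + nat list) cpoly" where
  "mon_l e = (\<Prod>T\<in>tuples d s. PVar (Inl T) ^ e T)"

text \<open>Generators, over the coordinates of the smaller quotient, of the part of degree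
  \<open>n\<close> for \<open>deg_s\<close>; this is the module to which \<open>nakayama\<close> is
  applied.\<close>

definition Mon :: "nat \<Rightarrow> (nat list + nat list) cpoly set" where
  "Mon n = mon_l ` {e. (\<Sum>T\<in>tuples d s. e T) = n}"

lemma finite_tuples: "finite (tuples d s)"
  using finite_lists_length_eq[of "{..<d}" s] by (simp add: tuples_def conj_commute)

lemma finite_Mon: "finite (Mon n)"
proof (rule finite_subset)
  show "Mon n \<subseteq> mon_l ` (tuples d s \<rightarrow>\<^sub>E {..n})"
  proof
    fix x assume "x \<in> Mon n"
    then obtain e where e: "(\<Sum>T\<in>tuples d s. e T) = n" "x = mon_l e" by (auto simp: Mon_def)
    have "x = mon_l (restrict e (tuples d s))"
      unfolding e(2) mon_l_def by (rule prod.cong) auto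
    moreover have "restrict e (tuples d s) \<in> tuples d s \<rightarrow>\<^sub>E {..n}"
      using e(1) member_le_sum[of _ "tuples d s" e] finite_tuples by auto
    ultimately show "x \<in> mon_l ` (tuples d s \<rightarrow>\<^sub>E {..n})" by blast
  qed
  show "finite (mon_l ` (tuples d s \<rightarrow>\<^sub>E {..n}))"
    by (intro finite_imageI finite_PiE finite_tuples) simp
qed

lemma Inl_Rf: "T \<in> tuples d s \<Longrightarrow> PVar (Inl T) \<in> Rf"
  by (simp add: carrier_poly_ring Fl_coords_def)

lemma Mon_Rf: "Mon n \<subseteq> Rf"
  unfolding Mon_def mon_l_def by (auto intro!: subring_prod[OF Rf] subring_power[OF Rf] Inl_Rf)

lemma homdeg_prod_sum:
  "(\<And>x. x \<in> S \<Longrightarrow> homdeg w (k x) (f x)) \<Longrightarrow> homdeg w (sum k S) (prod f S)"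
  by (induction S rule: infinite_finite_induct) (auto intro: homdeg_one homdeg_mult)

lemma Mon_homdeg: "x \<in> Mon n \<Longrightarrow> homdeg deg_s n x" "x \<in> Mon n \<Longrightarrow> homdeg deg_r 0 x"
proof -
  assume "x \<in> Mon n"
  then obtain e where e: "(\<Sum>T\<in>tuples d s. e T) = n" "x = mon_l e" by (auto simp: Mon_def)
  have "homdeg deg_s (e T) (PVar (Inl T) ^ e T)" for T
    using homdeg_power[OF homdeg_PVar[of deg_s "Inl T"], of "e T"] by simp
  then have "homdeg deg_s (\<Sum>T\<in>tuples d s. e T) x" unfolding e(2) mon_l_def by (intro homdeg_prod_sum)
  then show "homdeg deg_s n x" unfolding e(1) .
  have "homdeg deg_r 0 (PVar (Inl T) ^ e T)" for T
    using homdeg_power[OF homdeg_PVar[of deg_r "Inl T"], of "e T"] by simp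
  then have "homdeg deg_r (\<Sum>T\<in>tuples d s. 0) x" unfolding e(2) mon_l_def by (intro homdeg_prod_sum)
  then show "homdeg deg_r 0 x" by simp
qed

lemma Mon_mult: "x \<in> Mon n \<Longrightarrow> y \<in> Mon m \<Longrightarrow> x * y \<in> Mon (n + m)"
proof -
  assume "x \<in> Mon n" "y \<in> Mon m"
  then obtain e e' where e: "(\<Sum>T\<in>tuples d s. e T) = n" "x = mon_l e"
    "(\<Sum>T\<in>tuples d s. e' T) = m" "y = mon_l e'" by (auto simp: Mon_def)
  have "x * y = mon_l (\<lambda>T. e T + e' T)"
    unfolding e mon_l_def by (simp add: power_add prod.distrib)
  then show ?thesis unfolding Mon_def using e by (auto simp: sum.distrib)
qed

lemma Mon_power: "T \<in> tuples d s \<Longrightarrow> PVar (Inl T) ^ n \<in> Mon n"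
proof -
  assume T: "T \<in> tuples d s"
  let ?e = "\<lambda>T'. if T' = T then n else 0"
  have "mon_l ?e = (\<Prod>T'\<in>tuples d s. if T' = T then PVar (Inl T) ^ n else 1)"
    unfolding mon_l_def by (rule prod.cong) auto
  then have "mon_l ?e = PVar (Inl T) ^ n" using T finite_tuples by simp
  moreover have "(\<Sum>T'\<in>tuples d s. ?e T') = n" using T finite_tuples by simp
  ultimately show ?thesis unfolding Mon_def by (metis (mono_tags, lifting) image_eqI mem_Collect_eq)
qed

inductive_set Span :: "nat \<Rightarrow> (nat list + nat list) cpoly set" for n where
  zero: "0 \<in> Span n"
| base: "c \<in> p'.R \<Longrightarrow> x \<in> Mon n \<Longrightarrow> \<iota>r c * x \<in> Span n"
| add: "y \<in> Span n \<Longrightarrow> z \<in> Span n \<Longrightarrow> y + z \<in> Span n"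

lemma Span_sum: "(\<And>i. i \<in> S \<Longrightarrow> f i \<in> Span n) \<Longrightarrow> sum f S \<in> Span n"
  by (induction S rule: infinite_finite_induct) (simp_all add: Span.zero Span.add)

lemma Span_mult: "y \<in> Span n \<Longrightarrow> z \<in> Span m \<Longrightarrow> y * z \<in> Span (n + m)"
proof (induction rule: Span.induct)
  case (base c x)
  show ?case
    using base.prems
  proof (induction rule: Span.induct)
    case (base c' x')
    have "\<iota>r (c * c') * (x * x') \<in> Span (n + m)"
      by (intro Span.base Mon_mult subring_closed(5)[OF is_subring_poly]) fact+
    then show ?case by (simp add: poly_subst_mult ac_simps)
  qed (simp_all add: Span.zero Span.add distrib_left)
qed (simp_all add: Span.zero Span.add distrib_right)

text \<open>The polynomials whose components all satisfy the claim form a subring that contains the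
  constants and the variables.\<close>

lemma component_Span:
  assumes g: "g \<in> Rf" shows "hom_component deg_s n g \<in> Span n"
proof -
  define C where "C = {g :: (nat list + nat list) cpoly. \<forall>n. hom_component deg_s n g \<in> Span n}"
  have homC: "g \<in> C" if "homdeg deg_s k g" "g \<in> Span k" for g k
    using that by (simp add: C_def hom_component_homdeg[OF that(1)] Span.zero)
  have Mon0: "1 \<in> Mon 0"
    unfolding Mon_def by (rule image_eqI[of _ _ "\<lambda>_. 0"]) (simp_all add: mon_l_def)
  have const: "\<iota>r c \<in> C" if "c \<in> p'.R" for c
    using homC[OF homdeg_rename_r(2)] Span.base[OF that Mon0] by simp
  have one: "1 \<in> p'.R" by (rule subring_closed(2)[OF is_subring_poly])
  have "is_subring C"
    unfolding is_subring_def
  proof (intro conjI ballI)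
    show "0 \<in> C" by (rule homC[OF homdeg_zero Span.zero])
    show "1 \<in> C" using const[OF one] by (simp add: poly_subst_one)
    fix g h assume g: "g \<in> C" and h: "h \<in> C"
    then show "g + h \<in> C" by (simp add: C_def hom_component_add Span.add)
    have "hom_component deg_s i g * hom_component deg_s (k - i) h \<in> Span k" if "i \<le> k" for i k
      using Span_mult[of "hom_component deg_s i g" i "hom_component deg_s (k - i) h" "k - i"] g h that
      by (simp add: C_def)
    then show "g * h \<in> C" unfolding C_def mem_Collect_eq hom_component_mult by (intro allI Span_sum) simp
  next
    fix g assume "g \<in> C"
    interpret comm_ring_hom \<iota>r by (rule comm_ring_hom_subst)
    have neg: "- 1 \<in> Span 0"
      using Span.base[OF subring_closed(3)[OF is_subring_poly one] Mon0] by (simp add: hom_uminus)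
    have "hom_component deg_s k (- g) = - 1 * hom_component deg_s k g" for k
      by (rule poly_mapping_eqI) (simp add: lookup_hom_component)
    then show "- g \<in> C"
      using Span_mult[OF neg] \<open>g \<in> C\<close> by (simp add: C_def)
  qed
  moreover have "PVar v \<in> C" if "v \<in> gvars g" for v
    using that
  proof (rule Fl_coords_cases[OF g])
    fix T assume T: "v = Inl T" "T \<in> tuples d s"
    have "\<iota>r 1 * PVar (Inl T) ^ 1 \<in> Span 1" by (rule Span.base[OF one Mon_power[OF T(2)]])
    then show ?thesis using homC[OF homdeg_PVar[of deg_s "Inl T"]] by (simp add: T poly_subst_one)
  next
    fix T assume T: "v = Inr T" "T \<in> tuples d r"
    show ?thesis using const[of "PVar T"] T by (simp add: poly_subst_PVar carrier_poly_ring)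
  qed
  moreover have "PConst c \<in> C" for c
    using const[of "PConst c"] by (simp add: poly_subst_PConst carrier_poly_ring)
  ultimately have "gsubst PConst PVar g \<in> C" by (intro gsubst_in)
  then show ?thesis by (simp add: gsubst_ident C_def)
qed

inductive_set pR :: "(nat list + nat list) cpoly set" where
  zero: "0 \<in> pR"
| base: "h \<in> p' \<Longrightarrow> g \<in> Rf \<Longrightarrow> \<iota>r h * g \<in> pR"
| add: "y \<in> pR \<Longrightarrow> z \<in> pR \<Longrightarrow> y + z \<in> pR"

lemma pR_ideal: "is_ideal Rf pR"
  unfolding is_ideal_def
proof (intro conjI ballI Rf pR.zero)
  note sub = subring_closed[OF Rf]
  show "pR \<subseteq> Rf"
  proof
    fix y assume "y \<in> pR"
    then show "y \<in> Rf"
      by induction (auto intro: sub r_Rf idealD(2)[OF p'.p_ideal])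
  qed
  show "a * y \<in> pR" if "a \<in> Rf" "y \<in> pR" for a y
    using that(2)
  proof induction
    case (base h g)
    have "\<iota>r h * (a * g) \<in> pR" using base sub(5)[OF that(1)] by (intro pR.base) auto
    then show ?case by (simp add: ac_simps)
  qed (simp_all add: pR.zero pR.add distrib_left)
qed (rule pR.add)

text \<open>One coefficient in \<open>p'\<close> per generator, the shape that the hypothesis of
  \<open>nakayama\<close> requires.\<close>

definition pSpan :: "nat \<Rightarrow> (nat list + nat list) cpoly set" where
  "pSpan n = {z. \<exists>h. (\<forall>y\<in>Mon n. h y \<in> p') \<and> z = (\<Sum>y\<in>Mon n. \<iota>r (h y) * y)}"

lemma pSpan_add: "y \<in> pSpan n \<Longrightarrow> z \<in> pSpan n \<Longrightarrow> y + z \<in> pSpan n"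
proof -
  assume "y \<in> pSpan n" "z \<in> pSpan n"
  then obtain h h' where "\<forall>y\<in>Mon n. h y \<in> p'" "y = (\<Sum>y\<in>Mon n. \<iota>r (h y) * y)"
    "\<forall>y\<in>Mon n. h' y \<in> p'" "z = (\<Sum>y\<in>Mon n. \<iota>r (h' y) * y)" by (auto simp: pSpan_def)
  then show ?thesis
    unfolding pSpan_def using idealD(4)[OF p'.p_ideal]
    by (intro CollectI exI[of _ "\<lambda>y. h y + h' y"]) (simp add: poly_subst_add distrib_right sum.distrib)
qed

lemma pSpan_single: "h \<in> p' \<Longrightarrow> x \<in> Mon n \<Longrightarrow> \<iota>r h * x \<in> pSpan n"
proof -
  assume h: "h \<in> p'" and x: "x \<in> Mon n"
  have "(\<Sum>y\<in>Mon n. \<iota>r (if y = x then h else 0) * y) = (\<Sum>y\<in>Mon n. if y = x then \<iota>r h * x else 0)"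
    by (rule sum.cong) auto
  also have "\<dots> = \<iota>r h * x" using x finite_Mon by simp
  finally show ?thesis
    unfolding pSpan_def using h idealD(3)[OF p'.p_ideal]
    by (intro CollectI exI[of _ "\<lambda>y. if y = x then h else 0"]) simp
qed

lemma pSpan_zero: "0 \<in> pSpan n"
  unfolding pSpan_def using idealD(3)[OF p'.p_ideal] by (intro CollectI exI[of _ "\<lambda>y. 0"]) simp

lemma pSpan_Span:
  assumes h: "h \<in> p'" and "y \<in> Span n" shows "\<iota>r h * y \<in> pSpan n"
  using assms(2)
proof induction
  case (base c x)
  then have "\<iota>r (h * c) * x \<in> pSpan n" by (intro pSpan_single idealD(6)[OF p'.p_ideal _ h])
  then show ?case by (simp add: poly_subst_mult mult.assoc)
qed (simp_all add: pSpan_zero pSpan_add distrib_left)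

lemma pR_component: "y \<in> pR \<Longrightarrow> hom_component deg_s n y \<in> pSpan n"
proof (induction rule: pR.induct)
  case zero
  then show ?case by (simp add: pSpan_zero hom_component_def)
next
  case (base h g)
  have "hom_component deg_s n (\<iota>r h * g) = (\<Sum>i\<le>n. if i = 0 then \<iota>r h * hom_component deg_s n g else 0)"
    unfolding hom_component_mult by (rule sum.cong) (auto simp: hom_component_homdeg[OF homdeg_rename_r(2)])
  also have "\<dots> = \<iota>r h * hom_component deg_s n g" by simp
  finally show ?case using pSpan_Span[OF base(1) component_Span[OF base(2)]] by simp
next
  case (add y z)
  then show ?case by (simp add: hom_component_add pSpan_add)
qed

text \<open>The sum of \<open>A0\<close> and the extension of \<open>p'\<close>: the equations of
  the fibre over \<open>p'\<close>.\<close>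

definition B0 :: "(nat list + nat list) cpoly set" where
  "B0 = {x. \<exists>a\<in>A0. \<exists>y\<in>pR. x = a + y}"

lemma B0_ideal: "is_ideal Rf B0"
  unfolding is_ideal_def
proof (intro conjI ballI Rf)
  note sub = subring_closed[OF Rf]
  show "B0 \<subseteq> Rf" using idealD(2)[OF A0_ideal] idealD(2)[OF pR_ideal] sub(4) by (auto simp: B0_def)
  show "0 \<in> B0" using idealD(3)[OF A0_ideal] pR.zero by (force simp: B0_def)
  fix x y assume y: "y \<in> B0"
  then obtain a b where ab: "a \<in> A0" "b \<in> pR" "y = a + b" by (auto simp: B0_def)
  {
    assume "x \<in> B0"
    then obtain a' b' where ab': "a' \<in> A0" "b' \<in> pR" "x = a' + b'" by (auto simp: B0_def)
    have "x + y = (a' + a) + (b' + b)" by (simp add: ab ab' algebra_simps)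
    then show "x + y \<in> B0" unfolding B0_def
      using idealD(4)[OF A0_ideal ab'(1) ab(1)] pR.add[OF ab'(2) ab(2)] by blast
  }
  assume x: "x \<in> Rf"
  have "x * y = x * a + x * b" by (simp add: ab algebra_simps)
  then show "x * y \<in> B0" unfolding B0_def
    using idealD(5)[OF A0_ideal x ab(1)] idealD(5)[OF pR_ideal x ab(2)] by blast
qed

lemma A0_B0: "A0 \<subseteq> B0"
proof
  fix x assume "x \<in> A0"
  then show "x \<in> B0" unfolding B0_def using pR.zero by (intro CollectI bexI[of _ x] bexI[of _ 0]) simp_all
qed

lemma p_B0: "h \<in> p' \<Longrightarrow> \<iota>r h \<in> B0"
proof -
  assume "h \<in> p'"
  then have "\<iota>r h * 1 \<in> pR" by (intro pR.base subring_closed(2)[OF Rf])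
  then show ?thesis unfolding B0_def using idealD(3)[OF A0_ideal] by (intro CollectI bexI[of _ 0] bexI[of _ "\<iota>r h"]) simp_all
qed

text \<open>Otherwise Nakayama's lemma gives an equation \<open>u\<close> of the image of the flag variety that does not vanish at \<open>p'\<close>.\<close>

lemma not_irrelevant:
  assumes u: "u \<in> p'.R" "u \<notin> p'"
  shows "\<exists>x\<in>Mon n. \<iota>r u * x \<notin> B0"
proof (rule ccontr)
  assume "\<not> ?thesis"
  then have all: "\<And>x. x \<in> Mon n \<Longrightarrow> \<iota>r u * x \<in> B0" by blast
  have "\<exists>u'\<in>p'.R. u' \<notin> p' \<and> (\<forall>x\<in>Mon n. \<iota>r u' * x \<in> A0)"
  proof (rule nakayama[OF A0_ideal p'.p_prime comm_ring_hom_subst r_Rf finite_Mon Mon_Rf u])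
    fix x assume x: "x \<in> Mon n"
    obtain a y where ay: "a \<in> A0" "y \<in> pR" "\<iota>r u * x = a + y" using all[OF x] by (auto simp: B0_def)
    have "homdeg deg_s (0 + n) (\<iota>r u * x)" by (rule homdeg_mult[OF homdeg_rename_r(2) Mon_homdeg(1)[OF x]])
    then have "\<iota>r u * x = hom_component deg_s n (\<iota>r u * x)" by (simp add: hom_component_homdeg)
    also have "\<dots> = hom_component deg_s n a + hom_component deg_s n y" by (simp add: ay hom_component_add)
    finally have eq: "\<iota>r u * x = hom_component deg_s n a + hom_component deg_s n y" .
    obtain h where h: "\<forall>y\<in>Mon n. h y \<in> p'" "hom_component deg_s n y = (\<Sum>y\<in>Mon n. \<iota>r (h y) * y)"
      using pR_component[OF ay(2), of n] by (auto simp: pSpan_def)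
    have "hom_component deg_s n a \<in> A0"
    proof (rule ideal_of_components[OF A0_ideal, where w = deg_r])
      show "hom_component deg_r b (hom_component deg_s n a) \<in> A0" for b
        using A0_bicomp[OF ay(1), of n b] by (simp add: bicomp_alt)
    qed
    then have "\<iota>r u * x - (\<Sum>y\<in>Mon n. \<iota>r (h y) * y) \<in> A0" by (simp add: eq h(2))
    then show "\<exists>h. (\<forall>y\<in>Mon n. h y \<in> p') \<and> \<iota>r u * x - (\<Sum>y\<in>Mon n. \<iota>r (h y) * y) \<in> A0"
      using h(1) by blast
  qed
  then obtain u' where u': "u' \<in> p'.R" "u' \<notin> p'" "\<And>x. x \<in> Mon n \<Longrightarrow> \<iota>r u' * x \<in> A0" by blast
  obtain k where k: "hom_component (\<lambda>_. 1) k u' \<notin> p'"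
    using ideal_of_components[OF p'.p_ideal, of "\<lambda>_. 1" u'] u'(2) by blast
  \<comment> \<open>A homogeneous component is needed because \<open>PP_ev_iff\<close> speaks of
    forms.\<close>
  define v where "v = hom_component (\<lambda>_. 1) k u'"
  have v: "v \<in> p'.R" "homdeg (\<lambda>_. 1) k v"
    unfolding v_def by (rule hom_component_closed[OF u'(1)], rule homdeg_hom_component)
  interpret E: comm_ring_hom ev2 by (rule ev2_hom)
  have "ev [0..<r] v \<in> Is"
    unfolding Is_def
  proof (intro CollectI conjI ballI)
    show vA: "ev [0..<r] v \<in> tca_carrier d" by (rule ev_tca[OF v(1)]) simp
    fix q assume q: "q \<in> Z"
    interpret q: gr_point d s q by (rule Z_point[OF q])
    obtain T where T: "T \<in> tuples d s" "PVar T \<notin> q" using q.good_tuple by blast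
    \<comment> \<open>The n-th power of a coordinate that does not vanish at \<open>q\<close> is one
      of the generators killed by \<open>u'\<close>, and it can be cancelled modulo the prime of
      \<open>q\<close>.\<close>
    let ?x = "PVar (Inl T) ^ n :: (nat list + nat list) cpoly"
    have x: "?x \<in> Mon n" by (rule Mon_power[OF T(1)])
    have "bicomp n k (\<iota>r u' * ?x) = \<iota>r v * ?x"
    proof -
      have "hom_component deg_r k (\<iota>r u' * ?x) = (\<Sum>i\<le>k. if i = k then \<iota>r v * ?x else 0)"
        unfolding hom_component_mult
        by (rule sum.cong) (auto simp: hom_component_homdeg[OF Mon_homdeg(2)[OF x]] hom_component_rename v_def)
      also have "\<dots> = \<iota>r v * ?x" by simp
      finally show ?thesis
        using hom_component_homdeg[OF homdeg_mult[OF homdeg_rename_r(2) Mon_homdeg(1)[OF x]], of n v]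
        by (simp add: bicomp_def)
    qed
    then have "ev2 (\<iota>r v * ?x) \<in> Is" using u'(3)[OF x] by (auto simp: A0_def dest: spec2[of _ n k])
    then have "ev [0..<r] v * Delta T [0..<s] ^ n \<in> q.PP"
      using q by (simp add: hom_distribs ev2_r Is_def) (simp add: ev2_def comm_ring_hom_PConst)
    moreover have DA: "Delta T [0..<s] \<in> tca_carrier d" by (rule Delta_tca[OF tuples_set[OF T(1)]])
    moreover have "Delta T [0..<s] \<notin> q.PP"
      using q.PP_ev_iff[OF _ _ q.PVar_R[OF T(1)] homdeg_PVar, of "[0..<s]"] T(2) by (simp add: ev_PVar)
    ultimately show "ev [0..<r] v \<in> q.PP"
      using primeD(3)[OF q.PP_prime vA subring_power[OF is_subring_tca DA, of n]] prime_power[OF q.PP_prime DA, of n]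
      by blast
  qed
  then have "ev [0..<r] v \<in> p'.PP" using above by (auto simp: Is_def)
  then have "v \<in> p'" using p'.PP_ev_iff[OF _ _ v, of "[0..<r]"] by simp
  then show False using k by (simp add: v_def)
qed

text \<open>Otherwise each coordinate has a power killed by some element outside \<open>p'\<close>.
  The product of these elements then kills every monomial whose degree exceeds the sum of the
  exponents, since one exponent must be large; this contradicts
  \<open>not_irrelevant\<close>.\<close>

lemma ex_good_tuple: "\<exists>T\<in>tuples d s. \<forall>n. \<forall>u\<in>p'.R. u \<notin> p' \<longrightarrow> \<iota>r u * PVar (Inl T) ^ n \<notin> B0"
proof (rule ccontr)
  assume "\<not> ?thesis"
  then have "\<forall>T\<in>tuples d s. \<exists>nu. snd nu \<in> p'.R \<and> snd nu \<notin> p' \<and> \<iota>r (snd nu) * PVar (Inl T) ^ fst nu \<in> B0"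
    by fastforce
  from bchoice[OF this] obtain nu where nu: "\<forall>T\<in>tuples d s. snd (nu T) \<in> p'.R \<and> snd (nu T) \<notin> p' \<and>
      \<iota>r (snd (nu T)) * PVar (Inl T) ^ fst (nu T) \<in> B0" ..
  define u where "u = (\<Prod>T\<in>tuples d s. snd (nu T))"
  have u: "u \<in> p'.R" "u \<notin> p'"
    unfolding u_def
    by (rule subring_prod[OF is_subring_poly], use nu in blast,
        rule prime_prod[OF p'.p_prime finite_tuples], use nu in blast, use nu in blast)
  define N where "N = Suc (\<Sum>T\<in>tuples d s. fst (nu T))"
  obtain x where x: "x \<in> Mon N" "\<iota>r u * x \<notin> B0" using not_irrelevant[OF u] by blast
  obtain e where e: "(\<Sum>T\<in>tuples d s. e T) = N" "x = mon_l e" using x(1) by (auto simp: Mon_def)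
  obtain T where T: "T \<in> tuples d s" "fst (nu T) \<le> e T"
  proof (rule ccontr)
    assume "\<not> thesis"
    then have "e T \<le> fst (nu T)" if "T \<in> tuples d s" for T
      using that \<open>\<And>T. T \<in> tuples d s \<Longrightarrow> fst (nu T) \<le> e T \<Longrightarrow> thesis\<close> by (meson nle_le)
    then have "(\<Sum>T\<in>tuples d s. e T) \<le> (\<Sum>T\<in>tuples d s. fst (nu T))" by (rule sum_mono)
    then show False using e(1) by (simp add: N_def)
  qed
  let ?rest = "\<Prod>T'\<in>tuples d s - {T}. PVar (Inl T') ^ e T' :: (nat list + nat list) cpoly"
  let ?u = "\<Prod>T'\<in>tuples d s - {T}. snd (nu T')"
  have "x = PVar (Inl T) ^ e T * ?rest"
    unfolding e(2) mon_l_def by (rule prod.remove[OF finite_tuples T(1)])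
  moreover have "PVar (Inl T) ^ e T = PVar (Inl T) ^ fst (nu T) * (PVar (Inl T) ^ (e T - fst (nu T)) :: (nat list + nat list) cpoly)"
    using T(2) by (simp flip: power_add)
  moreover have "u = snd (nu T) * ?u" unfolding u_def by (rule prod.remove[OF finite_tuples T(1)])
  ultimately have "\<iota>r u * x = (\<iota>r ?u * (PVar (Inl T) ^ (e T - fst (nu T)) * ?rest)) *
      (\<iota>r (snd (nu T)) * PVar (Inl T) ^ fst (nu T))"
    by (simp add: poly_subst_mult ac_simps)
  also have "\<dots> \<in> B0"
  proof (rule idealD(5)[OF B0_ideal])
    have "?u \<in> p'.R" by (rule subring_prod[OF is_subring_poly]) (use nu in blast)
    then show "\<iota>r ?u * (PVar (Inl T) ^ (e T - fst (nu T)) * ?rest) \<in> Rf"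
      by (intro subring_closed(5)[OF Rf] r_Rf subring_power[OF Rf] Inl_Rf T(1) subring_prod[OF Rf]) auto
  qed (use nu T in blast)
  finally show False using x(2) by blast
qed

text \<open>The coordinate of the tuple \<open>T\<close> from \<open>ex_good_tuple\<close> is not
  nilpotent in the fibre localised at \<open>p'\<close>, so the fibre has a point where it does not
  vanish.\<close>

lemma flag_point: "\<exists>Q\<in>Fl d r s. proj_s d s Q \<in> Z \<and> proj_r d r Q = p'"
proof -
  obtain T where T: "T \<in> tuples d s"
    and good: "\<And>n u. u \<in> p'.R \<Longrightarrow> u \<notin> p' \<Longrightarrow> \<iota>r u * PVar (Inl T) ^ n \<notin> B0"
    using ex_good_tuple by blast
  \<comment> \<open>Avoiding the factors \<open>u\<close> keeps the contraction to the smaller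
    Grassmannian inside \<open>p'\<close>; avoiding the powers keeps the prime away from the
    irrelevant ideal of the larger one.\<close>
  define S where "S = {x. \<exists>u\<in>p'.R. u \<notin> p' \<and> (\<exists>n. x = \<iota>r u * PVar (Inl T) ^ n)}"
  have one: "1 \<in> p'.R" "1 \<notin> p'" using subring_closed(2)[OF is_subring_poly] primeD(2)[OF p'.p_prime] by auto
  have S_mem: "\<iota>r u * PVar (Inl T) ^ n \<in> S" if "u \<in> p'.R" "u \<notin> p'" for u n using that by (auto simp: S_def)
  have "\<exists>Q. is_prime Rf Q \<and> B0 \<subseteq> Q \<and> S \<inter> Q = {}"
  proof (rule ex_prime_avoiding[OF B0_ideal])
    show "S \<subseteq> Rf"
      unfolding S_def by (auto intro!: subring_closed(5)[OF Rf] r_Rf subring_power[OF Rf] Inl_Rf T)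
    show "1 \<in> S" using S_mem[OF one, of 0] by (simp add: poly_subst_one)
    show "a * b \<in> S" if ab: "a \<in> S" "b \<in> S" for a b
    proof -
      obtain u n u' n' where u: "u \<in> p'.R" "u \<notin> p'" "a = \<iota>r u * PVar (Inl T) ^ n"
        and u': "u' \<in> p'.R" "u' \<notin> p'" "b = \<iota>r u' * PVar (Inl T) ^ n'" using ab by (auto simp: S_def)
      have "a * b = \<iota>r (u * u') * PVar (Inl T) ^ (n + n')"
        by (simp add: u u' poly_subst_mult power_add ac_simps)
      moreover have "u * u' \<in> p'.R" by (rule subring_closed(5)[OF is_subring_poly u(1) u'(1)])
      moreover have "u * u' \<notin> p'" using primeD(3)[OF p'.p_prime u(1) u'(1)] u(2) u'(2) by blast
      ultimately show ?thesis using S_mem by simp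
    qed
    show "S \<inter> B0 = {}" using good by (auto simp: S_def)
  qed
  then obtain Q0 where Q0: "is_prime Rf Q0" "B0 \<subseteq> Q0" "S \<inter> Q0 = {}" by blast
  \<comment> \<open>The largest ideal inside \<open>Q0\<close> that is graded for both gradings,
    prime by two applications of \<open>is_prime_star\<close>.\<close>
  define Q where "Q = {F \<in> Rf. \<forall>a b. bicomp a b F \<in> Q0}"
  have "is_prime Rf {f \<in> Rf. \<forall>a. hom_component deg_s a f \<in> {f \<in> Rf. \<forall>b. hom_component deg_r b f \<in> Q0}}"
    by (rule is_prime_star[OF is_prime_star[OF Q0(1)]]) (rule hom_component_closed, assumption)+
  also have "{f \<in> Rf. \<forall>a. hom_component deg_s a f \<in> {f \<in> Rf. \<forall>b. hom_component deg_r b f \<in> Q0}} = Q"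
    unfolding Q_def bicomp_alt using hom_component_closed by blast
  finally have Q: "is_prime Rf Q" .
  have QQ0: "F \<in> Q0" if "F \<in> Q" for F
    using ideal_of_bicomps[OF primeD(1)[OF Q0(1)], of F] that by (simp add: Q_def)
  have Q_zero: "0 \<in> Q0" by (rule idealD(3)[OF primeD(1)[OF Q0(1)]])
  have A0Q: "A0 \<subseteq> Q"
    using A0_bicomp A0_B0 Q0(2) idealD(2)[OF A0_ideal] unfolding Q_def by blast
  have bi: "bicomp a b F \<in> Q" if "F \<in> Q" for a b F
    using that Q_zero by (simp add: Q_def bicomp_bicomp bicomp_Rf)
  have notQ: "F \<in> S \<Longrightarrow> F \<notin> Q" for F using QQ0 Q0(3) by blast
  have projr: "proj_r d r Q = p'"
  proof (intro equalityI subsetI)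
    fix F assume F: "F \<in> proj_r d r Q"
    then have FR: "F \<in> p'.R" "\<iota>r F \<in> Q" by (simp_all add: proj_r_def)
    show "F \<in> p'"
    proof (rule ccontr)
      assume "F \<notin> p'"
      then show False using S_mem[OF FR(1), of 0] notQ FR(2) by simp
    qed
  next
    fix F assume F: "F \<in> p'"
    have FR: "F \<in> p'.R" by (rule idealD(2)[OF p'.p_ideal F])
    have "bicomp a b (\<iota>r F) \<in> Q0" for a b
      using p_B0[OF p'.p_graded[OF F]] Q0(2) Q_zero by (auto simp: bicomp_rename_r)
    then show "F \<in> proj_r d r Q" using FR r_Rf[OF FR] by (simp add: proj_r_def Q_def)
  qed
  have TQ: "PVar (Inl T) \<notin> Q" using notQ[OF S_mem[OF one, of 1]] by (simp add: poly_subst_one)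
  obtain L where L: "L \<in> tuples d r" "PVar L \<notin> p'" using p'.good_tuple by blast
  have LQ: "PVar (Inr L) \<notin> Q"
    using notQ[OF S_mem[OF p'.PVar_R[OF L(1)] L(2), of 0]] by (simp add: poly_subst_PVar)
  have graded: "graded_set deg_s Q" "graded_set deg_r Q"
    unfolding graded_set_def
  proof (safe)
    fix F n assume F: "F \<in> Q"
    show "hom_component deg_s n F \<in> Q"
      by (rule ideal_of_components[OF primeD(1)[OF Q], where w = deg_r]) (use bi[OF F] in \<open>simp add: bicomp_alt\<close>)
    show "hom_component deg_r n F \<in> Q"
      by (rule ideal_of_components[OF primeD(1)[OF Q], where w = deg_s]) (use bi[OF F] in \<open>simp add: bicomp_def\<close>)
  qed
  have "\<not> {PVar v |v. v \<in> Fl_coords d r s \<and> deg_s v = 1} \<subseteq> Q"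
    using TQ T by (force simp: Fl_coords_def)
  moreover have "\<not> {PVar v |v. v \<in> Fl_coords d r s \<and> deg_r v = 1} \<subseteq> Q"
    using LQ L(1) by (force simp: Fl_coords_def)
  ultimately have QFl: "Q \<in> Fl d r s"
    using Q graded flag_relations_A0 A0Q by (simp add: Fl_def multi_Proj_def is_prime_poly)
  moreover have "proj_s d s Q \<in> Z"
    unfolding Z
  proof (intro CollectI conjI proj_s_Gr[OF QFl] subsetI)
    fix F assume "F \<in> Js"
    then show "F \<in> proj_s d s Q" using Js_A0 A0Q Js(1) by (auto simp: proj_s_def)
  qed
  ultimately show ?thesis using projr by blast
qed

end

section \<open>The homeomorphism\<close>

lemma GL_ideal_graded:
  assumes I: "GL_ideal d I" shows "is_ideal (tca_carrier d) I"
  using I by (simp add: GL_ideal_def tca_A_def is_ideal_poly)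

lemma slice_closed:
  assumes I: "I \<subseteq> tca_carrier d"
  shows "Gr_closed d r {p \<in> Gr d r. I \<subseteq> canonical_map d (r, p)}"
proof -
  let ?R = "carrier (poly_ring (tuples d r))"
  let ?Z = "{p \<in> Gr d r. I \<subseteq> canonical_map d (r, p)}"
  define J where "J = {F \<in> ?R. \<forall>p\<in>?Z. F \<in> p}"
  have point: "gr_point d r p" if "p \<in> Gr d r" for p using that by unfold_locales
  have pI: "is_ideal ?R p" if "p \<in> ?Z" for p using gr_point.p_ideal[OF point] that by blast
  have "is_ideal ?R J"
    unfolding is_ideal_def J_def
    using idealD(3,4,5)[OF pI] subring_closed[OF is_subring_poly] by (auto simp: is_subring_poly)
  moreover have "graded_set (\<lambda>_. 1) J"
    unfolding graded_set_def
  proof (intro ballI allI)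
    fix F n assume F: "F \<in> J"
    then have "hom_component (\<lambda>_. 1) n F \<in> ?R" by (intro hom_component_closed) (simp add: J_def)
    moreover have "hom_component (\<lambda>_. 1) n F \<in> p" if p: "p \<in> ?Z" for p
    proof (rule gr_point.p_graded[OF point])
      show "p \<in> Gr d r" using p by blast
      show "F \<in> p" using F p unfolding J_def by blast
    qed
    ultimately show "hom_component (\<lambda>_. 1) n F \<in> J" unfolding J_def by blast
  qed
  moreover have "?Z = {p \<in> Gr d r. J \<subseteq> p}"
  proof (intro equalityI subsetI)
    fix p assume "p \<in> ?Z"
    then show "p \<in> {p \<in> Gr d r. J \<subseteq> p}" unfolding J_def by blast
  next
    fix p assume p: "p \<in> {p \<in> Gr d r. J \<subseteq> p}"
    interpret p: gr_point d r p using p point by blast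
    obtain L where L: "L \<in> tuples d r" "PVar L \<notin> p" using p.good_tuple by blast
    have "f \<in> canonical_map d (r, p)" if f: "f \<in> I" for f
    proof -
      have fA: "f \<in> tca_carrier d" using f I by blast
      note c = coeffs_inD[OF chart_subst_carrier[OF L(1) fA]]
      have "Poly_Mapping.lookup (chart_subst L f) \<beta> \<in> p" for \<beta>
      proof -
        \<comment> \<open>At points where \<open>PVar L\<close> vanishes this chart gives no
          information; the factor \<open>PVar L\<close> makes the product vanish there too.\<close>
        have "PVar L * Poly_Mapping.lookup (chart_subst L f) \<beta> \<in> q" if q: "q \<in> ?Z" for q
        proof (cases "PVar L \<in> q")
          case True
          then show ?thesis by (rule idealD(6)[OF pI[OF q] c])
        next
          case False
          have q': "q \<in> Gr d r" "f \<in> canonical_map d (r, q)" using q f by blast+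
          then have "chart_subst L f \<in> coeffs_in q"
            using gr_point.PP_iff[OF point[OF q'(1)] L(1) False] by blast
          then show ?thesis by (intro idealD(5)[OF pI[OF q] p.PVar_R[OF L(1)]] coeffs_inD)
        qed
        moreover have "PVar L * Poly_Mapping.lookup (chart_subst L f) \<beta> \<in> ?R"
          by (rule subring_closed(5)[OF is_subring_poly p.PVar_R[OF L(1)] c])
        ultimately have "PVar L * Poly_Mapping.lookup (chart_subst L f) \<beta> \<in> J" unfolding J_def by blast
        then have "PVar L * Poly_Mapping.lookup (chart_subst L f) \<beta> \<in> p" using p by blast
        then show ?thesis using primeD(3)[OF p.p_prime p.PVar_R[OF L(1)] c] L(2) by blast
      qed
      then show ?thesis using p.PP_iff[OF L] fA by (simp add: coeffs_in_def)
    qed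
    then show "p \<in> ?Z" using p by blast
  qed
  ultimately show ?thesis unfolding Gr_closed_def is_ideal_poly by blast
qed

lemma preimage_closed:
  assumes I: "I \<subseteq> tca_carrier d"
  shows "total_Gr_closed d {x \<in> total_Gr d. I \<subseteq> canonical_map d x}" (is "total_Gr_closed d ?Z")
proof (rule total_Gr_closedI)
  show "?Z \<subseteq> total_Gr d" by blast
  have slice: "?Z `` {r} = {p \<in> Gr d r. I \<subseteq> canonical_map d (r, p)}" if "r \<le> d" for r
    using that by (auto simp: total_Gr_def)
  show "Gr_closed d r (?Z `` {r})" if "r \<le> d" for r
    unfolding slice[OF that] by (rule slice_closed[OF I])
  show "proj_r d r Q \<in> ?Z `` {r}"
    if "s \<le> d" "r \<le> s" "Q \<in> Fl d r s" "proj_s d s Q \<in> ?Z `` {s}" for r s Q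
    using that slice[of r] slice[of s] proj_r_Gr[OF that(3)] flag_canonical_subset[OF that(3,2)] by auto
qed

text \<open>The ideal of \<open>Z\<close> contains all products of functions vanishing on its
  finitely many slices, so a prime above it contains the ideal of one slice, say of rank s. Then
  \<open>flag_lift\<close> yields a flag from that slice to the point of the prime, and
  \<open>Z\<close> is downwards closed.\<close>

lemma image_closed:
  assumes Z: "total_Gr_closed d Z"
  shows "Spec_closed d (canonical_map d ` Z)"
proof -
  have ZT: "Z \<subseteq> total_Gr d" by (rule total_Gr_closedD(1)[OF Z])
  define I where "I = {f \<in> tca_carrier d. \<forall>x\<in>Z. f \<in> canonical_map d x}"
  have GL: "GL_ideal d (canonical_map d x)" if "x \<in> Z" for x
    using canonical_map_Spec[of x d] that ZT by (auto simp: Spec_A_def GL_prime_def)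
  have idI: "is_ideal (tca_carrier d) (canonical_map d x)" if "x \<in> Z" for x
    by (rule GL_ideal_graded[OF GL[OF that]])
  have "is_ideal (tca_carrier d) I"
    unfolding is_ideal_def I_def
    using idealD(3,4,5)[OF idI] subring_closed[OF is_subring_tca] by (auto simp: is_subring_tca)
  then have I: "GL_ideal d I"
    using GL GL_act_closed by (auto simp: GL_ideal_def tca_A_def is_ideal_poly I_def)
  have "canonical_map d ` Z = {P \<in> Spec_A d. I \<subseteq> P}"
  proof (intro equalityI subsetI)
    fix P assume "P \<in> canonical_map d ` Z"
    then show "P \<in> {P \<in> Spec_A d. I \<subseteq> P}" using canonical_map_Spec ZT by (auto simp: I_def)
  next
    fix P assume P: "P \<in> {P \<in> Spec_A d. I \<subseteq> P}"
    then obtain r p where rp: "r \<le> d" "p \<in> Gr d r" "P = canonical_map d (r, p)"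
      using canonical_map_surj[of d P] by (auto simp: Spec_A_def total_Gr_def)
    interpret p: gr_point d r p by unfold_locales (rule rp(2))
    let ?I = "\<lambda>s. {f \<in> tca_carrier d. \<forall>q\<in>Z `` {s}. f \<in> canonical_map d (s, q)}"
    have "\<exists>s\<le>d. ?I s \<subseteq> P"
    proof (rule ccontr)
      assume "\<not> ?thesis"
      then have "\<forall>s\<in>{..d}. \<exists>f. f \<in> ?I s \<and> f \<notin> P" by blast
      from bchoice[OF this] obtain f where f: "\<forall>s\<in>{..d}. f s \<in> ?I s \<and> f s \<notin> P" ..
      have "prod f {..d} \<in> I"
        unfolding I_def
      proof (intro CollectI conjI ballI)
        show "prod f {..d} \<in> tca_carrier d" by (rule subring_prod[OF is_subring_tca]) (use f in blast)
        fix x assume x: "x \<in> Z"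
        then obtain s q where sq: "x = (s, q)" "s \<le> d" using ZT by (auto simp: total_Gr_def)
        have "prod f {..d} = f s * prod f ({..d} - {s})" by (rule prod.remove) (use sq in auto)
        also have "\<dots> \<in> canonical_map d x"
        proof (rule idealD(6)[OF idI[OF x]])
          show "f s \<in> canonical_map d x" using f sq x by blast
          show "prod f ({..d} - {s}) \<in> tca_carrier d" by (rule subring_prod[OF is_subring_tca]) (use f in blast)
        qed
        finally show "prod f {..d} \<in> canonical_map d x" .
      qed
      moreover have "prod f {..d} \<notin> P"
        unfolding rp(3) by (rule prime_prod[OF p.PP_prime]) (use f rp(3) in auto)
      ultimately show False using P by blast
    qed
    then obtain s where s: "s \<le> d" "?I s \<subseteq> P" by blast
    have point: "gr_point d s q" if "q \<in> Z `` {s}" for q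
      using that ZT by (auto simp: total_Gr_def gr_point_def)
    \<comment> \<open>Minors of size \<open>r\<close> vanish on a slice of smaller rank, but one of
      them does not vanish at \<open>p\<close>.\<close>
    have rs: "r \<le> s"
    proof (rule ccontr)
      assume "\<not> r \<le> s"
      obtain L where L: "L \<in> tuples d r" "PVar L \<notin> p" using p.good_tuple by blast
      have "Delta L [0..<r] \<in> ?I s"
        using gr_point.PP_big_minor[OF point L(1)] \<open>\<not> r \<le> s\<close> Delta_tca[OF tuples_set[OF L(1)]] by auto
      then have "ev [0..<r] (PVar L) \<in> p.PP" using s(2) rp(3) by (auto simp: ev_PVar)
      then show False using p.PP_ev_iff[OF _ _ p.PVar_R[OF L(1)] homdeg_PVar] L(2) by simp
    qed
    obtain J where J: "ideal J (poly_ring (tuples d s))" "graded_set (\<lambda>_. 1) J" "Z `` {s} = {q \<in> Gr d s. J \<subseteq> q}"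
      using total_Gr_closedD(2)[OF Z s(1)] by (auto simp: Gr_closed_def)
    note down = total_Gr_closedD(3)[OF Z s(1) rs]
    interpret flag_lift d r s p "Z `` {s}" J
    proof (rule flag_lift.intro)
      show "J \<subseteq> carrier (poly_ring (tuples d s))" by (rule subsetI) (rule ideal.Icarr[OF J(1)])
      show "hom_component (\<lambda>_. 1) n F \<in> J" if "F \<in> J" for F n
        using J(2) that unfolding graded_set_def by blast
      show "?I s \<subseteq> canonical_map d (r, p)" using s(2) unfolding rp(3) .
    qed (rule rs rp(2) J(3))+
    obtain Q where Q: "Q \<in> Fl d r s" "proj_s d s Q \<in> Z `` {s}" "proj_r d r Q = p" using flag_point by blast
    then have "p \<in> Z `` {r}" using down[of Q] by blast
    then show "P \<in> canonical_map d ` Z" unfolding rp(3) by blast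
  qed
  then show ?thesis using I unfolding Spec_closed_def by blast
qed

lemma closedin_total_Gr: "closedin (total_Gr_topology d) Z \<longleftrightarrow> total_Gr_closed d Z"
proof -
  have "Z \<subseteq> total_Gr d \<Longrightarrow> total_Gr d - (total_Gr d - Z) = Z" by blast
  then show ?thesis
    unfolding closedin_def topspace_total_Gr openin_total_Gr
    using total_Gr_closedD(1)[of d Z] by auto
qed

lemma closedin_Spec: "closedin (Spec_topology d) Z \<longleftrightarrow> Spec_closed d Z"
proof -
  have "Z \<subseteq> Spec_A d \<Longrightarrow> Spec_A d - (Spec_A d - Z) = Z" by blast
  moreover have "Spec_closed d Z \<Longrightarrow> Z \<subseteq> Spec_A d" by (auto simp: Spec_closed_def)
  ultimately show ?thesis
    unfolding closedin_def topspace_Spec openin_Spec by auto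
qed

theorem theorem1p1:
  fixes d :: nat
  shows "homeomorphic_map (total_Gr_topology d) (Spec_topology d) (canonical_map d)"
proof (rule bijective_closed_imp_homeomorphic_map)
  show "continuous_map (total_Gr_topology d) (Spec_topology d) (canonical_map d)"
    unfolding continuous_map_closedin topspace_total_Gr topspace_Spec
  proof (intro conjI allI impI)
    show "canonical_map d \<in> total_Gr d \<rightarrow> Spec_A d" using canonical_map_Spec by blast
    fix C assume "closedin (Spec_topology d) C"
    then obtain I where I: "GL_ideal d I" "C = {P \<in> Spec_A d. I \<subseteq> P}"
      by (auto simp: closedin_Spec Spec_closed_def)
    have "{x \<in> total_Gr d. canonical_map d x \<in> C} = {x \<in> total_Gr d. I \<subseteq> canonical_map d x}"
      unfolding I(2) using canonical_map_Spec by blast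
    then show "closedin (total_Gr_topology d) {x \<in> total_Gr d. canonical_map d x \<in> C}"
      using preimage_closed[OF GL_ideal_subset[OF I(1)]] by (simp add: closedin_total_Gr)
  qed
  show "closed_map (total_Gr_topology d) (Spec_topology d) (canonical_map d)"
    unfolding closed_map_def closedin_total_Gr closedin_Spec using image_closed by blast
  show "canonical_map d ` topspace (total_Gr_topology d) = topspace (Spec_topology d)"
    "inj_on (canonical_map d) (topspace (total_Gr_topology d))"
    using canonical_map_bij[of d] by (simp_all add: bij_betw_def topspace_total_Gr topspace_Spec)
qed

end
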